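(* Let $n\ge 2$, let $l$ be an integer, let $w\in W_{\mathrm{af}}$ and $m\ge 1$. Then in $H^*(\widetilde{Fl})$ we have $$\xi^{\psi^{-l}(\rho_m)}\,\xi^w=\sum_S \xi^{\mathrm{inside}(S)},$$ where the sum runs over all strong strips $S$ of size $m$ with respect to $l$ such that $\mathrm{outside}(S)=w$.
   Context: Fix an integer $n\ge 2$. $W_{\mathrm{af}}$ is the affine symmetric group (the affine Weyl group of type $\widetilde A_{n-1}$), with simple generators $s_0,s_1,\dots,s_{n-1}$ (indices modulo $n$), length function $\ell$ and Bruhat (strong) order; $v\lessdot u$ means $v<u$ and $\ell(v)=\ell(u)-1$. It is realized as the group of bijections $w:\mathbb Z\to\mathbb Z$ with $w(x+n)=w(x)+n$ for all $x$ and $\sum_{x=1}^n w(x)=n(n+1)/2$, with product given by composition; $s_i$ exchanges $i+kn$ and $i+1+kn$ for all $k\in\mathbb Z$. For $i<j$ with $i\not\equiv j \pmod n$, $t_{ij}\in W_{\mathrm{af}}$ is the reflection exchanging $i+kn$ and $j+kn$ for all $k\in\mathbb Z$. For $m\ge1$, $\rho_m=s_{m-1}s_{m-2}\cdots s_1s_0$, indices modulo $n$. $\psi:W_{\mathrm{af}}\to W_{\mathrm{af}}$ is the group automorphism with $s_i\mapsto s_{i-1}$; so $\psi^{-l}(\rho_m)=s_{l+m-1}\cdots s_{l+1}s_l$. Strong strips with respect to $l$: a marked strong cover with respect to $l$, $u\overset{a}{\longrightarrow}v$, consists of $u,v\in W_{\mathrm{af}}$ and an integer $a$ such that $u=vt_{ij}$,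 $v\lessdot u$ and $a=u(j)=v(i)$ for some integers $i\le l<j$. A strong strip $S$ of size $m$ with respect to $l$ from $u$ to $v$ is a path of such marked strong covers $u\overset{a_1}{\longrightarrow}u_1\overset{a_2}{\longrightarrow}\cdots\overset{a_m}{\longrightarrow}u_m=v$ with $a_1>a_2>\cdots>a_m$ (markings are part of the data, so strips with different markings are distinct); $\mathrm{inside}(S)=u$ and $\mathrm{outside}(S)=v$. Cohomology of the affine flag variety: $\widetilde{Fl}=G_{\mathrm{af}}/B_{\mathrm{af}}$ is the Kac–Moody flag ind-variety of the affine Kac–Moody group $G_{\mathrm{af}}$ associated with $SL(n)$, $B_{\mathrm{af}}$ its Borel subgroup, paved by the cells $B_{\mathrm{af}}\dot wB_{\mathrm{af}}/B_{\mathrm{af}}\cong\mathbb C^{\ell(w)}$, $w\in W_{\mathrm{af}}$; $\{\xi^w\mid w\in W_{\mathrm{af}}\}$ is the Schubert basis of $H^*(\widetilde{Fl})=H^*(\widetilde{Fl},\mathbb Z)$. By Kostant–Kumar, this ring is the free abelian group on the $\xi^w$ with product $\xi^u\xi^v=\sum_w\phi(p^w_{u,v})\xi^w$, where the integers $\phi(p^w_{u,v})$ are as follows. Let $P=\mathbb Z^n/\mathbb Z(1,\dots,1)$ be the weight lattice of $SL(n)$, with $e_i$ the images of the standard basis vectors, $\alpha_i=e_i-e_{i+1}$ for $1\le i\le n-1$, $\theta=e_1-e_n$, and $\alpha_0:=-\theta$. $W_{\mathrm{af}}$ acts on $P$ by the level zero action: $s_i$ ($1\le i\le n-1$) is the reflection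 in $\alpha_i$ and $s_0$ acts as the reflection in $\theta$. Let $S=\mathrm{Sym}(P)$, $F=\mathrm{Frac}(S)$, and let $F_{W_{\mathrm{af}}}=\bigoplus_{w\in W_{\mathrm{af}}}Fw$ with product $(pv)(qw)=(p\,(v\cdot q))(vw)$ for $p,q\in F$. Put $A_i=\alpha_i^{-1}(1-s_i)$ for $i\in\mathbb Z/n\mathbb Z$, and $A_w=A_{i_1}\cdots A_{i_r}$ for any reduced word $w=s_{i_1}\cdots s_{i_r}$ (well defined; the $A_w$ form a left $F$-basis). Let $\Delta:F_{W_{\mathrm{af}}}\to F_{W_{\mathrm{af}}}\otimes_F F_{W_{\mathrm{af}}}$ (tensor product of left $F$-vector spaces) be the left $F$-linear map with $\Delta(w)=w\otimes w$. Then $p^w_{u,v}\in S$ is defined by $\Delta(A_w)=\sum_{u,v}p^w_{u,v}A_u\otimes A_v$ and is homogeneous of degree $\ell(u)+\ell(v)-\ell(w)$; $\phi:S\to\mathbb Z$ takes the constant term. *)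

theory Defs
  imports
    "HOL-Library.Poly_Mapping"
    "HOL-Computational_Algebra.Fraction_Field"
    "HOL-Number_Theory.Cong"
begin

section \<open>The affine symmetric group\<close>

definition aff_sym :: "nat \<Rightarrow> (int \<Rightarrow> int) set" where
  "aff_sym n = {w. bij w \<and> (\<forall>x. w (x + int n) = w x + int n) \<and>
                   (\<Sum>x = 1..int n. w x) = int n * (int n + 1) div 2}"

text \<open>The reflection \<open>t\<^sub>i\<^sub>j\<close>, meaningful when \<open>i\<close> and \<open>j\<close> are incongruent modulo \<open>n\<close>.\<close>

definition aff_refl :: "nat \<Rightarrow> int \<Rightarrow> int \<Rightarrow> int \<Rightarrow> int" where
  "aff_refl n i j x =
     (if [x = i] (mod int n) then x + (j - i)
      else if [x = j] (mod int n) then x - (j - i)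
      else x)"

text \<open>Simple generators are indexed by all integers; the index only matters modulo \<open>n\<close>.\<close>

definition simple_refl :: "nat \<Rightarrow> int \<Rightarrow> int \<Rightarrow> int" where
  "simple_refl n i = aff_refl n i (i + 1)"

definition word_elt :: "nat \<Rightarrow> int list \<Rightarrow> int \<Rightarrow> int" where
  "word_elt n is = foldr (\<lambda>i w. simple_refl n i \<circ> w) is id"

definition aff_length :: "nat \<Rightarrow> (int \<Rightarrow> int) \<Rightarrow> nat" where
  "aff_length n w = (LEAST k. \<exists>is. length is = k \<and> word_elt n is = w)"

definition reduced_word :: "nat \<Rightarrow> int list \<Rightarrow> (int \<Rightarrow> int) \<Rightarrow> bool" where
  "reduced_word n is w \<longleftrightarrow> word_elt n is = w \<and> length is = aff_length n w"

definition bruhat_step :: "nat \<Rightarrow> (int \<Rightarrow> int) \<Rightarrow> (int \<Rightarrow> int) \<Rightarrow> bool" where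
  "bruhat_step n v u \<longleftrightarrow> v \<in> aff_sym n \<and> aff_length n v < aff_length n u \<and>
     (\<exists>i j. i < j \<and> \<not> [i = j] (mod int n) \<and> u = v \<circ> aff_refl n i j)"

definition bruhat_less :: "nat \<Rightarrow> (int \<Rightarrow> int) \<Rightarrow> (int \<Rightarrow> int) \<Rightarrow> bool" where
  "bruhat_less n = (bruhat_step n)\<^sup>+\<^sup>+"

definition bruhat_cover :: "nat \<Rightarrow> (int \<Rightarrow> int) \<Rightarrow> (int \<Rightarrow> int) \<Rightarrow> bool" where
  "bruhat_cover n v u \<longleftrightarrow> bruhat_less n v u \<and> aff_length n u = aff_length n v + 1"

definition rho :: "nat \<Rightarrow> nat \<Rightarrow> int \<Rightarrow> int" where
  "rho n m = word_elt n (map int (rev [0..<m]))"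

text \<open>The automorphism \<open>s\<^sub>i \<mapsto> s\<^sub>i\<^sub>-\<^sub>1\<close> is conjugation by the shift \<open>x \<mapsto> x + 1\<close>,
  which does not itself lie in the group; see \<open>psi_simple_refl\<close>, \<open>psi_comp\<close>,
  \<open>psi_image_aff_sym\<close>.  The formula makes sense for all maps on the integers and gives a
  bijection there, so that its integer powers can be formed.\<close>

definition psi :: "(int \<Rightarrow> int) \<Rightarrow> int \<Rightarrow> int" where
  "psi w = (\<lambda>x. w (x + 1) - 1)"

definition psi_zpow :: "int \<Rightarrow> (int \<Rightarrow> int) \<Rightarrow> int \<Rightarrow> int" where
  "psi_zpow k = (if 0 \<le> k then psi ^^ nat k else (inv psi) ^^ nat (- k))"


section \<open>Strong strips\<close>

definition marked_cover ::
    "nat \<Rightarrow> int \<Rightarrow> (int \<Rightarrow> int) \<Rightarrow> int \<Rightarrow> (int \<Rightarrow> int) \<Rightarrow> bool" where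
  "marked_cover n l u a v \<longleftrightarrow> u \<in> aff_sym n \<and> v \<in> aff_sym n \<and> bruhat_cover n v u \<and>
     (\<exists>i j. i \<le> l \<and> l < j \<and> \<not> [i = j] (mod int n) \<and> u = v \<circ> aff_refl n i j \<and>
            a = u j \<and> a = v i)"

text \<open>A path \<open>u \<rightarrow> u\<^sub>1 \<rightarrow> \<dots> \<rightarrow> u\<^sub>m\<close> with markings \<open>a\<^sub>1, \<dots>, a\<^sub>m\<close> is the pair of \<open>u\<close> and the
  list of the pairs \<open>(a\<^sub>k, u\<^sub>k)\<close>.\<close>

type_synonym strip = "(int \<Rightarrow> int) \<times> (int \<times> (int \<Rightarrow> int)) list"

fun marked_path :: "nat \<Rightarrow> int \<Rightarrow> (int \<Rightarrow> int) \<Rightarrow> (int \<times> (int \<Rightarrow> int)) list \<Rightarrow> bool" where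
  "marked_path n l u [] \<longleftrightarrow> u \<in> aff_sym n"
| "marked_path n l u ((a, v) # ps) \<longleftrightarrow> marked_cover n l u a v \<and> marked_path n l v ps"

definition strong_strip :: "nat \<Rightarrow> int \<Rightarrow> nat \<Rightarrow> strip \<Rightarrow> bool" where
  "strong_strip n l m S \<longleftrightarrow> marked_path n l (fst S) (snd S) \<and> length (snd S) = m \<and>
     sorted_wrt (>) (map fst (snd S))"

definition inside :: "strip \<Rightarrow> int \<Rightarrow> int" where
  "inside S = fst S"

definition outside :: "strip \<Rightarrow> int \<Rightarrow> int" where
  "outside S = (if snd S = [] then fst S else snd (last (snd S)))"


section \<open>The symmetric algebra of the weight lattice and its fraction field\<close>

text \<open>The weight lattice \<open>P = \<int>\<^sup>n / \<int>(1,\<dots>,1)\<close> is free with basis \<open>e\<^sub>1, \<dots>, e\<^sub>n\<^sub>-\<^sub>1\<close>, and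
  \<open>e\<^sub>n = - (e\<^sub>1 + \<dots> + e\<^sub>n\<^sub>-\<^sub>1)\<close>.  Hence \<open>Sym P\<close> is the integral polynomial ring in
  \<open>X\<^sub>0, \<dots>, X\<^sub>n\<^sub>-\<^sub>2\<close>, where \<open>X\<^sub>r\<close> stands for \<open>e\<^sub>r\<^sub>+\<^sub>1\<close>.  It is carved out of a polynomial ring
  with a variable for every natural number.\<close>

type_synonym mpol = "(nat \<Rightarrow>\<^sub>0 nat) \<Rightarrow>\<^sub>0 int"

definition sym_wt :: "nat \<Rightarrow> mpol set" where
  "sym_wt n = {p. \<forall>\<mu> \<in> Poly_Mapping.keys p. Poly_Mapping.keys \<mu> \<subseteq> {..<n - 1}}"

definition frac_wt :: "nat \<Rightarrow> mpol fract set" where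
  "frac_wt n = {Fract a b | a b. a \<in> sym_wt n \<and> b \<in> sym_wt n \<and> b \<noteq> 0}"

definition mvar :: "nat \<Rightarrow> mpol" where
  "mvar r = Poly_Mapping.single (Poly_Mapping.single r 1) 1"

text \<open>The index \<open>j\<close> of \<open>e\<^sub>j\<close> is extended \<open>n\<close>-periodically to all integers.\<close>

definition e_wt :: "nat \<Rightarrow> int \<Rightarrow> mpol" where
  "e_wt n j = (let r = nat ((j - 1) mod int n) in
     if r < n - 1 then mvar r else - (\<Sum>k<n - 1. mvar k))"

text \<open>By periodicity the case \<open>i = 0\<close> reads \<open>\<alpha>\<^sub>0 = e\<^sub>n - e\<^sub>1 = - \<theta>\<close>.\<close>

definition alpha :: "nat \<Rightarrow> int \<Rightarrow> mpol" where
  "alpha n i = e_wt n i - e_wt n (i + 1)"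

text \<open>The level zero action on \<open>Sym P\<close>: the ring homomorphism sending \<open>e\<^sub>j\<close> to
  \<open>e\<^bsub>w(j)\<^esub>\<close>; see \<open>act_sym_e_wt\<close>, and \<open>act_sym_simple_refl\<close> for the comparison with the
  reflections in the roots.\<close>

definition act_sym :: "nat \<Rightarrow> (int \<Rightarrow> int) \<Rightarrow> mpol \<Rightarrow> mpol" where
  "act_sym n w = frag_extend (\<lambda>\<mu>.
     \<Prod>r\<in>Poly_Mapping.keys \<mu>. e_wt n (w (int r + 1)) ^ Poly_Mapping.lookup \<mu> r)"

definition act_frac :: "nat \<Rightarrow> (int \<Rightarrow> int) \<Rightarrow> mpol fract \<Rightarrow> mpol fract" where
  "act_frac n w q = (THE r. \<forall>a\<in>sym_wt n. \<forall>b\<in>sym_wt n. b \<noteq> 0 \<longrightarrow> q = Fract a b \<longrightarrow>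
     r = Fract (act_sym n w a) (act_sym n w b))"

text \<open>The constant term of an element of \<open>Sym P\<close>, given as an element of the fraction field.\<close>

definition const_term :: "nat \<Rightarrow> mpol fract \<Rightarrow> int" where
  "const_term n q = Poly_Mapping.lookup (THE s. s \<in> sym_wt n \<and> q = Fract s 1) 0"


section \<open>The Kostant--Kumar structure constants\<close>

text \<open>The twisted group algebra consists of the finitely supported maps from \<^term>\<open>aff_sym n\<close> to
  \<^term>\<open>frac_wt n\<close>, and its tensor square over the field (as a left vector space) of the
  finitely supported maps on pairs of group elements.\<close>

type_synonym twisted = "(int \<Rightarrow> int) \<Rightarrow>\<^sub>0 mpol fract"
type_synonym twisted2 = "((int \<Rightarrow> int) \<times> (int \<Rightarrow> int)) \<Rightarrow>\<^sub>0 mpol fract"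

definition tw_mult :: "nat \<Rightarrow> twisted \<Rightarrow> twisted \<Rightarrow> twisted" where
  "tw_mult n f g = (\<Sum>v\<in>Poly_Mapping.keys f. \<Sum>w\<in>Poly_Mapping.keys g.
     Poly_Mapping.single (v \<circ> w) (Poly_Mapping.lookup f v * act_frac n v (Poly_Mapping.lookup g w)))"

definition A_gen :: "nat \<Rightarrow> int \<Rightarrow> twisted" where
  "A_gen n i = (let c = inverse (Fract (alpha n i) 1) in
     Poly_Mapping.single id c - Poly_Mapping.single (simple_refl n i) c)"

definition A_word :: "nat \<Rightarrow> int list \<Rightarrow> twisted" where
  "A_word n is = foldr (\<lambda>i f. tw_mult n (A_gen n i) f) is (Poly_Mapping.single id 1)"

text \<open>By the braid relations the choice of the reduced word does not matter.\<close>

definition A_elt :: "nat \<Rightarrow> (int \<Rightarrow> int) \<Rightarrow> twisted" where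
  "A_elt n w = A_word n (SOME is. reduced_word n is w)"

definition tw_coprod :: "twisted \<Rightarrow> twisted2" where
  "tw_coprod f = (\<Sum>w\<in>Poly_Mapping.keys f. Poly_Mapping.single (w, w) (Poly_Mapping.lookup f w))"

definition tw_tensor :: "twisted \<Rightarrow> twisted \<Rightarrow> twisted2" where
  "tw_tensor f g = (\<Sum>v\<in>Poly_Mapping.keys f. \<Sum>w\<in>Poly_Mapping.keys g.
     Poly_Mapping.single (v, w) (Poly_Mapping.lookup f v * Poly_Mapping.lookup g w))"

definition kk_coeffs :: "nat \<Rightarrow> (int \<Rightarrow> int) \<Rightarrow> twisted2" where
  "kk_coeffs n w = (THE p.
     Poly_Mapping.keys p \<subseteq> aff_sym n \<times> aff_sym n \<and> (\<forall>x. Poly_Mapping.lookup p x \<in> frac_wt n) \<and>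
     tw_coprod (A_elt n w) = (\<Sum>(u, v)\<in>Poly_Mapping.keys p.
       Poly_Mapping.map (\<lambda>c. Poly_Mapping.lookup p (u, v) * c) (tw_tensor (A_elt n u) (A_elt n v))))"

definition kk_const :: "nat \<Rightarrow> (int \<Rightarrow> int) \<Rightarrow> (int \<Rightarrow> int) \<Rightarrow> (int \<Rightarrow> int) \<Rightarrow> int" where
  "kk_const n u v w = const_term n (Poly_Mapping.lookup (kk_coeffs n w) (u, v))"


section \<open>The cohomology ring of the affine flag variety\<close>

text \<open>The ring is the free abelian group on the Schubert classes \<open>\<xi>\<^sup>w\<close> for \<open>w\<close> in
  \<^term>\<open>aff_sym n\<close>.  In the product of two Schubert classes only the finitely many \<open>w\<close> of length
  \<open>\<ell>(u) + \<ell>(v)\<close> contribute, by homogeneity of the coefficients.\<close>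

abbreviation schubert :: "(int \<Rightarrow> int) \<Rightarrow> (int \<Rightarrow> int) \<Rightarrow>\<^sub>0 int" where
  "schubert w \<equiv> frag_of w"

definition schubert_prod ::
    "nat \<Rightarrow> (int \<Rightarrow> int) \<Rightarrow> (int \<Rightarrow> int) \<Rightarrow> ((int \<Rightarrow> int) \<Rightarrow>\<^sub>0 int)" where
  "schubert_prod n u v =
     (\<Sum>w | w \<in> aff_sym n \<and> kk_const n u v w \<noteq> 0. frag_cmul (kk_const n u v w) (schubert w))"

definition cup ::
    "nat \<Rightarrow> ((int \<Rightarrow> int) \<Rightarrow>\<^sub>0 int) \<Rightarrow> ((int \<Rightarrow> int) \<Rightarrow>\<^sub>0 int) \<Rightarrow> ((int \<Rightarrow> int) \<Rightarrow>\<^sub>0 int)" where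
  "cup n x y = frag_extend (\<lambda>u. frag_extend (\<lambda>v. schubert_prod n u v) y) x"


section \<open>Consistency of the definitions\<close>

lemma psi_simple_refl: "psi (simple_refl n i) = simple_refl n (i - 1)"
proof -
  have "[x + 1 = k] (mod int n) \<longleftrightarrow> [x = k - 1] (mod int n)" for x k
    by (simp add: cong_iff_dvd_diff algebra_simps)
  then show ?thesis
    by (auto simp: psi_def simple_refl_def aff_refl_def fun_eq_iff)
qed

lemma psi_comp: "psi (v \<circ> w) = psi v \<circ> psi w"
  by (auto simp: psi_def)

lemma bij_psi: "bij psi"
  by (rule bij_betw_byWitness[where f' = "\<lambda>w x. w (x - 1) + 1"]) (auto simp: psi_def)

lemma inv_psi: "inv psi w = (\<lambda>x. w (x - 1) + 1)"
  by (rule inv_f_eq) (auto simp: bij_is_inj[OF bij_psi] psi_def)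

lemma psi_zpow: "psi_zpow k w = (\<lambda>x. w (x + k) - k)"
proof -
  have a: "(psi ^^ m) w = (\<lambda>x. w (x + int m) - int m)" for m
    by (induction m) (auto simp: psi_def algebra_simps)
  have b: "(inv psi ^^ m) w = (\<lambda>x. w (x - int m) + int m)" for m
    by (induction m) (auto simp: inv_psi algebra_simps)
  show ?thesis
    by (auto simp: psi_zpow_def a b)
qed

lemma psi_image_aff_sym: "psi ` aff_sym n = aff_sym n"
proof -
  have bij_shift: "bij (\<lambda>x. w (x + c) - c)" if "bij w" for w :: "int \<Rightarrow> int" and c
  proof -
    have "bij (\<lambda>x::int. x + c)"
      by (rule bij_betw_byWitness[where f' = "\<lambda>x. x - c"]) auto
    moreover have "bij (\<lambda>x::int. x - c)"
      by (rule bij_betw_byWitness[where f' = "\<lambda>x. x + c"]) auto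
    ultimately have "bij ((\<lambda>x. x - c) \<circ> (w \<circ> (\<lambda>x. x + c)))"
      using that by (intro bij_comp)
    then show ?thesis by (simp add: comp_def)
  qed
  have sum_shift: "(\<Sum>x = 1..int n. w (x + 1) - 1) = (\<Sum>x = 1..int n. w x)"
    if per: "\<And>x. w (x + int n) = w x + int n" for w :: "int \<Rightarrow> int"
  proof -
    have "(\<Sum>x = 1..int n. w (x + 1)) = (\<Sum>x = 2..int n + 1. w x)"
      by (rule sum.reindex_bij_witness[where i = "\<lambda>x. x - 1" and j = "\<lambda>x. x + 1"]) auto
    also have "\<dots> = (\<Sum>x = 1..int n. w x) + int n"
    proof (cases "n = 0")
      case False
      then have "{1..int n + 1} = insert 1 {2..int n + 1}"
        "{1..int n + 1} = insert (int n + 1) {1..int n}" by auto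
      then have "w 1 + (\<Sum>x = 2..int n + 1. w x) = w (int n + 1) + (\<Sum>x = 1..int n. w x)"
        by (metis (no_types, lifting) atLeastAtMost_iff finite_atLeastAtMost_int not_one_le_zero
            one_le_numeral sum.insert zless_add1_eq order_less_irrefl add.commute linorder_not_less
            numeral_One numeral_le_iff semiring_norm(69) verit_comp_simplify1(3))
      then show ?thesis using per[of 1] by (simp add: add.commute)
    qed simp
    finally show ?thesis by (simp add: sum_subtractf)
  qed
  have "psi w \<in> aff_sym n" if "w \<in> aff_sym n" for w
  proof -
    have per: "w (x + int n) = w x + int n" for x
      using that by (simp add: aff_sym_def)
    have "psi w (x + int n) = psi w x + int n" for x
      using per[of "x + 1"] by (simp add: psi_def algebra_simps)
    then show ?thesis
      using that bij_shift[of w 1] sum_shift[of w, OF per]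
      by (simp add: aff_sym_def psi_def)
  qed
  moreover have "w \<in> psi ` aff_sym n" if "w \<in> aff_sym n" for w
  proof
    define v where "v = (\<lambda>x. w (x - 1) + 1)"
    show "w = psi v" by (simp add: v_def psi_def)
    have per: "v (x + int n) = v x + int n" for x
    proof -
      have "w (x - 1 + int n) = w (x - 1) + int n"
        using that by (simp add: aff_sym_def)
      then show ?thesis by (simp add: v_def algebra_simps)
    qed
    show "v \<in> aff_sym n"
      using that bij_shift[of w "-1"] per sum_shift[of v, OF per]
      by (auto simp: aff_sym_def v_def)
  qed
  ultimately show ?thesis by auto
qed

lemma simple_refl_in_aff_sym:
  assumes "n \<ge> 2"
  shows "simple_refl n i \<in> aff_sym n"
proof -
  let ?s = "simple_refl n i"
  have ne: "\<not> [i + 1 = i] (mod int n)"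
    using assms by (auto simp: cong_iff_dvd_diff dest: zdvd_imp_le)
  have s: "?s x = (if [x = i] (mod int n) then x + 1
                   else if [x = i + 1] (mod int n) then x - 1 else x)" for x
    by (simp add: simple_refl_def aff_refl_def)
  have "?s (?s x) = x" for x
  proof -
    consider "[x = i] (mod int n)" | "\<not> [x = i] (mod int n)" "[x = i + 1] (mod int n)"
      | "\<not> [x = i] (mod int n)" "\<not> [x = i + 1] (mod int n)" by blast
    then show ?thesis
    proof cases
      case 1
      then have "[x + 1 = i + 1] (mod int n)" by (simp add: cong_add)
      moreover from this have "\<not> [x + 1 = i] (mod int n)"
        using ne by (meson cong_sym cong_trans)
      ultimately show ?thesis using 1 by (simp add: s)
    next
      case 2
      have "[x - 1 = i] (mod int n)"
        using cong_diff[OF 2(2) cong_refl, of 1] by simp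
      with 2 show ?thesis by (simp add: s)
    next
      case 3
      then show ?thesis by (simp add: s)
    qed
  qed
  then have "bij ?s"
    by (intro bij_betw_byWitness[where f' = ?s]) auto
  moreover have "?s (x + int n) = ?s x + int n" for x
    by (simp add: s cong_def)
  moreover have "(\<Sum>x = 1..int n. ?s x) = int n * (int n + 1) div 2"
  proof -
    let ?d = "\<lambda>c x. if [x = c] (mod int n) then 1 else (0::int)"
    have one: "(\<Sum>x = 1..int n. ?d c x) = 1" for c
    proof -
      define y where "y = (c - 1) mod int n + 1"
      have y: "y \<in> {1..int n}"
        using assms pos_mod_bound[of "int n" "c - 1"] pos_mod_sign[of "int n" "c - 1"]
        unfolding y_def atLeastAtMost_iff by linarith
      have yc: "[y = c] (mod int n)"
        by (simp add: y_def cong_def mod_simps)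
      have "[x = c] (mod int n) \<longleftrightarrow> x = y" if "x \<in> {1..int n}" for x
      proof
        assume "[x = c] (mod int n)"
        then have "[x - 1 = y - 1] (mod int n)"
          using yc by (meson cong_diff cong_refl cong_sym cong_trans)
        then show "x = y" using that y by (simp add: cong_def)
      qed (use yc in simp)
      then have "(\<Sum>x = 1..int n. ?d c x) = (\<Sum>x = 1..int n. if x = y then 1 else 0)"
        by (intro sum.cong) auto
      also have "\<dots> = 1" using y by simp
      finally show ?thesis .
    qed
    have "?s x = x + (?d i x - ?d (i + 1) x)" for x
      using ne by (auto simp: s) (meson cong_sym cong_trans)
    then have "(\<Sum>x = 1..int n. ?s x) =
        (\<Sum>x = 1..int n. x) + ((\<Sum>x = 1..int n. ?d i x) - (\<Sum>x = 1..int n. ?d (i + 1) x))"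
      by (simp only: sum.distrib sum_subtractf)
    also have "\<dots> = (\<Sum>x = 1..int n. x)" by (simp only: one)
    also have "\<dots> = int n * (int n + 1) div 2"
    proof -
      have "2 * (\<Sum>x = 1..int n. x) = int n * (int n + 1)"
      proof (induction n)
        case (Suc n)
        have "{1..int (Suc n)} = insert (int (Suc n)) {1..int n}" by auto
        then show ?case using Suc by (simp add: algebra_simps)
      qed simp
      then show ?thesis by simp
    qed
    finally show ?thesis .
  qed
  ultimately show ?thesis by (simp add: aff_sym_def)
qed

lemma e_wt_cong:
  assumes "[i = j] (mod int n)"
  shows "e_wt n i = e_wt n j"
proof -
  have "[i - 1 = j - 1] (mod int n)"
    using assms by (intro cong_diff) auto
  then show ?thesis by (simp add: e_wt_def cong_def)
qed

lemma e_wt_of_nat: "r < n - 1 \<Longrightarrow> e_wt n (int r + 1) = mvar r"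
  by (simp add: e_wt_def)

lemma e_wt_last: "n > 0 \<Longrightarrow> e_wt n (int n) = - (\<Sum>k<n - 1. e_wt n (int k + 1))"
proof -
  assume "n > 0"
  then have "nat ((int n - 1) mod int n) = n - 1"
    by (subst mod_pos_pos_trivial) auto
  then show ?thesis
    unfolding e_wt_def Let_def by (auto intro: sum.cong)
qed

lemma sum_e_wt:
  assumes "n > 0"
  shows "(\<Sum>j = 1..int n. e_wt n j) = 0"
proof -
  have "(\<Sum>j = 1..int n. e_wt n j) = (\<Sum>k<n. e_wt n (int k + 1))"
    by (rule sum.reindex_bij_witness[where i = "\<lambda>k. int k + 1" and j = "\<lambda>j. nat (j - 1)"]) auto
  also have "\<dots> = (\<Sum>k<n - 1. e_wt n (int k + 1)) + e_wt n (int n)"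
    using assms by (cases n) (auto simp: add.commute)
  finally show ?thesis using e_wt_last[OF assms] by simp
qed

lemma aff_sym_periodic:
  assumes "w \<in> aff_sym n"
  shows "w (x + k * int n) = w x + k * int n"
proof (induction k rule: int_induct[where k = 0])
  case (step1 k)
  then show ?case using assms
    by (auto simp: aff_sym_def algebra_simps dest: spec[of _ "x + k * int n"])
next
  case (step2 k)
  then show ?case using assms
    by (auto simp: aff_sym_def algebra_simps dest: spec[of _ "x + (k - 1) * int n"])
qed simp

lemma sum_e_wt_aff_sym:
  assumes "n > 0" "w \<in> aff_sym n"
  shows "(\<Sum>j = 1..int n. e_wt n (w j)) = 0"
proof -
  define f where "f j = (w j - 1) mod int n + 1" for j
  have "inj_on f {1..int n}"
  proof
    fix j k assume jk: "j \<in> {1..int n}" "k \<in> {1..int n}" "f j = f k"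
    then have "int n dvd w j - w k"
      by (simp add: f_def mod_eq_dvd_iff)
    then obtain q where "w j = w k + q * int n"
      by (metis add_diff_cancel_left' dvdE mult.commute diff_add_cancel add.commute)
    then have "w j = w (k + q * int n)"
      using aff_sym_periodic[OF assms(2)] by simp
    then have "j = k + q * int n"
      using assms(2) by (auto simp: aff_sym_def bij_def dest: injD)
    then have "(j - 1) mod int n = (k - 1) mod int n"
      by (simp add: algebra_simps mod_eq_dvd_iff)
    then show "j = k" using jk by simp
  qed
  moreover have "f j \<in> {1..int n}" for j
    using assms(1) pos_mod_bound[of "int n" "w j - 1"] pos_mod_sign[of "int n" "w j - 1"]
    unfolding f_def atLeastAtMost_iff by linarith
  ultimately have "f ` {1..int n} = {1..int n}" "inj_on f {1..int n}"
    by (simp_all add: endo_inj_surj image_subset_iff)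
  then have "(\<Sum>j = 1..int n. e_wt n (f j)) = (\<Sum>j = 1..int n. e_wt n j)"
    by (metis (no_types, lifting) sum.reindex_cong)
  moreover have "e_wt n (f j) = e_wt n (w j)" for j
    by (rule e_wt_cong) (simp add: f_def cong_def mod_simps)
  ultimately show ?thesis using sum_e_wt[OF assms(1)] by simp
qed

lemma act_sym_mvar: "act_sym n w (mvar r) = e_wt n (w (int r + 1))"
  by (simp add: act_sym_def mvar_def)

lemma act_sym_e_wt:
  assumes "n > 0" "w \<in> aff_sym n"
  shows "act_sym n w (e_wt n j) = e_wt n (w j)"
proof -
  define r where "r = nat ((j - 1) mod int n)"
  have r: "r < n" "int r + 1 = 1 + (j - 1) mod int n"
    using assms(1) by (auto simp: r_def nat_less_iff)
  have cong: "[j = int r + 1] (mod int n)"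
    by (simp add: r cong_def mod_simps)
  then obtain q where q: "j = int r + 1 + q * int n"
    by (metis cong_iff_lin cong_sym mult.commute)
  have *: "act_sym n w (e_wt n (int r + 1)) = e_wt n (w (int r + 1))" if "r < n - 1" for r
    by (simp only: e_wt_of_nat[OF that] act_sym_mvar)
  have "act_sym n w (e_wt n (int r + 1)) = e_wt n (w (int r + 1))"
  proof (cases "r < n - 1")
    case True
    then show ?thesis by (rule *)
  next
    case False
    then have rn: "int r + 1 = int n" using r by simp
    have "(\<Sum>j = 1..int n. e_wt n (w j)) = (\<Sum>k<n. e_wt n (w (int k + 1)))"
      by (rule sum.reindex_bij_witness[where i = "\<lambda>k. int k + 1" and j = "\<lambda>j. nat (j - 1)"]) auto
    also have "\<dots> = (\<Sum>k<n - 1. e_wt n (w (int k + 1))) + e_wt n (w (int n))"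
      using assms(1) by (cases n) (auto simp: add.commute)
    finally have "e_wt n (w (int n)) = - (\<Sum>k<n - 1. e_wt n (w (int k + 1)))"
      using sum_e_wt_aff_sym[OF assms] by (simp add: eq_neg_iff_add_eq_0 add.commute)
    moreover have "act_sym n w (e_wt n (int n)) =
        - (\<Sum>k<n - 1. act_sym n w (e_wt n (int k + 1)))"
      unfolding e_wt_last[OF assms(1)] act_sym_def
      by (simp add: frag_extend_minus frag_extend_sum comp_def)
    ultimately show ?thesis unfolding rn by (simp add: *)
  qed
  moreover have "e_wt n (w j) = e_wt n (w (int r + 1))"
    by (rule e_wt_cong) (simp add: q aff_sym_periodic[OF assms(2)] cong_def)
  ultimately show ?thesis using e_wt_cong[OF cong] by simp
qed

text \<open>The integer subtracted from \<open>e\<^sub>j\<close> times the root is the value of the coroot of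
  \<open>\<alpha>\<^sub>i\<close> on \<open>e\<^sub>j\<close>.\<close>

lemma act_sym_simple_refl:
  assumes "n \<ge> 2"
  shows "act_sym n (simple_refl n i) (e_wt n j) = e_wt n j -
    ((if [j = i] (mod int n) then 1 else 0) - (if [j = i + 1] (mod int n) then 1 else 0)) * alpha n i"
proof -
  have "\<not> [i + 1 = i] (mod int n)"
    using assms(1) by (auto simp: cong_iff_dvd_diff dest: zdvd_imp_le)
  then have "\<not> ([j = i] (mod int n) \<and> [j = i + 1] (mod int n))"
    by (meson cong_sym cong_trans)
  moreover have "e_wt n (j + 1) = e_wt n (i + 1)" "e_wt n j = e_wt n i"
    if "[j = i] (mod int n)" using that by (auto intro!: e_wt_cong cong_add)
  moreover have "e_wt n (j - 1) = e_wt n i" "e_wt n j = e_wt n (i + 1)"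
    if "[j = i + 1] (mod int n)"
    using that e_wt_cong[OF cong_diff[OF that cong_refl, of 1]] by (auto intro: e_wt_cong)
  ultimately show ?thesis
    using assms(1) act_sym_e_wt[OF _ simple_refl_in_aff_sym[OF assms], of i j]
    by (auto simp: simple_refl_def aff_refl_def alpha_def)
qed

end

theory Submission
  imports Defs "HOL-Computational_Algebra.Formal_Power_Series"
begin

text \<open>
Everything is computed by localization, with a formal variable \<open>t\<close>.  For each \<open>l\<close> consider the
class \<open>G\<close> whose value at \<open>x\<close> is the product of \<open>1 - t e\<^sub>b\<close> over \<open>b \<le> l\<close> divided by the product of
\<open>1 - t e\<^sub>b\<close> over \<open>b \<in> x({..l})\<close>; after cancellation both products are finite.  Evaluating \<open>G\<close> on
the basis \<open>A\<^sub>u\<close>, by splitting off the last letter of a reduced word, gives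
\<open>G = \<Sum>\<^sub>k t\<^sup>k (\<Prod>\<^sub>1\<^sub>\<le>\<^sub>j\<^sub>\<le>\<^sub>k (1 - t e\<^bsub>l+j\<^esub>)\<inverse>) \<xi>\<^bsup>r(k)\<^esup>\<close> with \<open>r(k) = s\<^bsub>l+k-1\<^esub> \<cdots> s\<^sub>l\<close>.

On the other hand, multiplication by \<open>G\<close> is, up to a unit, the product over the markings \<open>a\<close>, in
decreasing order, of the operators \<open>K\<^sub>a = 1 + t (1 - t e\<^sub>a)\<inverse> (e\<^sub>a \<theta>\<^sub>a + N\<^sub>a)\<close> on the indices of the
basis \<open>A\<^sub>u\<close>, where \<open>N\<^sub>a\<close> sums over the strong covers with marking \<open>a\<close> and \<open>\<theta>\<^sub>a\<close> tests whether
the value \<open>a\<close> stands at a position \<open>\<le> l\<close>.  Both sides satisfy the same recursion under left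
multiplication by \<open>A\<^sub>i\<close>: it passes through \<open>K\<^sub>a\<close> unless \<open>a\<close> is \<open>i\<close> or \<open>i + 1\<close> modulo \<open>n\<close>, and
through the products \<open>K\<^bsub>a+1\<^esub> K\<^sub>a\<close> with \<open>a \<equiv> i\<close>.

Taking constant terms turns \<open>K\<^sub>a\<close> into \<open>1 + t N\<^sub>a\<close>, whose decreasing product enumerates strong
strips, and turns \<open>G\<close> into the generating function of the \<open>\<xi>\<^bsup>r(k)\<^esup>\<close>.
\<close>

section \<open>Periodic permutations\<close>

text \<open>The obstacle is that left multiplication by A_i does not pass through a single K_a with
  a congruent to i or i + 1: the cover between u and s_i u produces a correction. In a pair K_{a+1}
  K_a the corrections are absorbed by the divided differences of the factors 1 / (1 - t e_a). This
  is why the order of the markings matters, why the equivariant denominators are carried along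
  although only constant terms are wanted, and why the induction on the length of u uses windows
  made of whole periods that begin at the residue of i: they never cut a pair.

  The infinite products can be truncated, since a marking below all relevant values acts by a unit
  that occurs on both sides, and a marking above them acts trivially.

  Pairing the two expansions of G with the basis dual to A_u gives, for each power t^m, a linear
  relation between the structure constants of r(j), j \<le> m, in which that of r(m) has coefficient
  1. Solving these relations also shows that the constants lie in Sym P, which has to be known
  before constant terms can be read off.\<close>

locale affine_symmetric =
  fixes n :: nat
  assumes n2: "n \<ge> 2"
begin

abbreviation W where "W \<equiv> aff_sym n"
abbreviation s where "s \<equiv> simple_refl n"
abbreviation t where "t \<equiv> aff_refl n"
abbreviation len where "len \<equiv> aff_length n"
abbreviation ceq :: "int \<Rightarrow> int \<Rightarrow> bool" (infix "\<simeq>" 50) where "x \<simeq> y \<equiv> [x = y] (mod int n)"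
abbreviation pos :: "(int \<Rightarrow> int) \<Rightarrow> int \<Rightarrow> int" where "pos u \<equiv> inv u"

lemma ceqE: assumes "x \<simeq> y" obtains k where "x = y + k * int n"
  using assms by (metis cong_iff_lin cong_sym mult.commute)

lemma ceq_shift [simp]: "x + k * int n \<simeq> y \<longleftrightarrow> x \<simeq> y" "x \<simeq> y + k * int n \<longleftrightarrow> x \<simeq> y"
  by (simp_all add: cong_def)

lemma not_ceq_Suc: "\<not> x \<simeq> x + 1" "\<not> x + 1 \<simeq> x"
  using n2 by (auto simp: cong_iff_dvd_diff dest: zdvd_imp_le)

lemma ceq_Suc_iff: "x + 1 \<simeq> y + 1 \<longleftrightarrow> x \<simeq> y"
  by (simp add: cong_iff_dvd_diff)

lemma ceq_less: assumes "x \<simeq> y" "x < y" shows "x + int n \<le> y"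
proof -
  obtain k where k: "y = x + k * int n" using assms(1) cong_sym ceqE by metis
  with assms(2) have "k * int n > 0" by simp
  then have "k \<ge> 1" using n2 by (simp add: zero_less_mult_iff)
  then have "k * int n \<ge> 1 * int n" by (intro mult_right_mono) auto
  then show ?thesis using k by simp
qed

lemma W_bij: "w \<in> W \<Longrightarrow> bij w" by (simp add: aff_sym_def)
lemma W_inj: "w \<in> W \<Longrightarrow> w x = w y \<longleftrightarrow> x = y"
  by (meson W_bij bij_def injD)
lemma W_shift: "w \<in> W \<Longrightarrow> w (x + k * int n) = w x + k * int n"
  by (rule aff_sym_periodic)
lemma W_shift1: "w \<in> W \<Longrightarrow> w (x + int n) = w x + int n"
  using W_shift[of w x 1] by simp
lemma W_shift1': "w \<in> W \<Longrightarrow> w (x - int n) = w x - int n"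
  using W_shift[of w x "-1"] by simp

lemma W_pos: "w \<in> W \<Longrightarrow> w (pos w a) = a" "w \<in> W \<Longrightarrow> pos w (w x) = x"
  by (simp_all add: W_bij bij_is_surj surj_f_inv_f bij_is_inj)

lemma W_pos_eq: "w \<in> W \<Longrightarrow> pos w a = x \<longleftrightarrow> w x = a"
  using W_pos by metis

lemma pos_shift: "w \<in> W \<Longrightarrow> pos w (a + k * int n) = pos w a + k * int n"
  by (simp add: W_pos_eq W_shift W_pos)

lemma pos_inj: "w \<in> W \<Longrightarrow> pos w a = pos w b \<longleftrightarrow> a = b"
  by (metis W_pos(1))

lemma W_ceq: assumes "w \<in> W" shows "w x \<simeq> w y \<longleftrightarrow> x \<simeq> y"
proof
  assume "w x \<simeq> w y"
  then obtain k where "w x = w y + k * int n" by (rule ceqE)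
  then have "w x = w (y + k * int n)" using assms W_shift by simp
  then have "x = y + k * int n" using assms W_inj by simp
  then show "x \<simeq> y" by simp
next
  assume "x \<simeq> y"
  then obtain k where "x = y + k * int n" by (rule ceqE)
  then have "w x = w y + k * int n" using assms W_shift by simp
  then show "w x \<simeq> w y" by simp
qed

text \<open>w permutes the residues modulo n; \<open>g\<close> makes this visible by reducing the
  values of w into {1..n}. It is applied to the periodic displacement w x - x.\<close>

lemma sum_periodic_W:
  fixes f :: "int \<Rightarrow> int"
  assumes w: "w \<in> W" and f: "\<And>x k. f (x + k * int n) = f x"
  shows "(\<Sum>x = 1..int n. f (w x)) = (\<Sum>x = 1..int n. f x)"
proof -
  define g where "g j = (w j - 1) mod int n + 1" for j
  have gw: "g j \<simeq> w j" for j by (simp add: g_def cong_def mod_simps)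
  have "inj_on g {1..int n}"
  proof
    fix j k assume jk: "j \<in> {1..int n}" "k \<in> {1..int n}" "g j = g k"
    then have "w j \<simeq> w k" using gw by (metis cong_sym cong_trans)
    then have "j \<simeq> k" using W_ceq w by blast
    then show "j = k" using jk ceq_less[of j k] ceq_less[of k j] cong_sym[of j k] by fastforce
  qed
  moreover have "g j \<in> {1..int n}" for j
    using n2 pos_mod_bound[of "int n" "w j - 1"] pos_mod_sign[of "int n" "w j - 1"]
    unfolding g_def atLeastAtMost_iff by linarith
  ultimately have "g ` {1..int n} = {1..int n}" "inj_on g {1..int n}"
    by (simp_all add: endo_inj_surj image_subset_iff)
  then have "(\<Sum>j = 1..int n. f (g j)) = (\<Sum>j = 1..int n. f j)"
    by (metis (no_types, lifting) sum.reindex_cong)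
  moreover have "f (g j) = f (w j)" for j
    using gw[of j] f by (metis ceqE)
  ultimately show ?thesis by simp
qed

text \<open>With the normalization read as vanishing total displacement, composition adds
  displacements and inversion negates them.\<close>

lemma W_iff: "w \<in> W \<longleftrightarrow> bij w \<and> (\<forall>x. w (x + int n) = w x + int n) \<and> (\<Sum>x = 1..int n. w x - x) = 0"
proof -
  have "2 * (\<Sum>x = 1..int n. x) = int n * (int n + 1)"
  proof (induction n)
    case (Suc n)
    have "{1..int (Suc n)} = insert (int (Suc n)) {1..int n}" by auto
    then show ?case using Suc by (simp add: algebra_simps)
  qed simp
  then have "(\<Sum>x = 1..int n. x) = int n * (int n + 1) div 2" by simp
  then show ?thesis by (auto simp: aff_sym_def sum_subtractf)
qed

lemma id_W [simp]: "id \<in> W" by (simp add: W_iff)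

lemma displacement_periodic:
  assumes "w \<in> W" shows "w (x + k * int n) - (x + k * int n) = w x - x"
  using W_shift[OF assms] by simp

lemma comp_W [simp, intro]: assumes "v \<in> W" "w \<in> W" shows "v \<circ> w \<in> W"
proof -
  have "(\<Sum>x = 1..int n. (v (w x) - w x)) = (\<Sum>x = 1..int n. v x - x)"
    using sum_periodic_W[OF assms(2), of "\<lambda>x. v x - x"] displacement_periodic[OF assms(1)] by simp
  moreover have "(\<Sum>x = 1..int n. v (w x) - x) =
      (\<Sum>x = 1..int n. v (w x) - w x) + (\<Sum>x = 1..int n. w x - x)"
    by (simp add: sum.distrib[symmetric])
  ultimately have "(\<Sum>x = 1..int n. (v \<circ> w) x - x) = 0"
    using assms by (simp add: W_iff)
  then show ?thesis using assms unfolding W_iff by (auto intro: bij_comp)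
qed

lemma inv_W [simp, intro]: assumes "w \<in> W" shows "inv w \<in> W"
proof -
  have per: "inv w (x + k * int n) - (x + k * int n) = inv w x - x" for x k
    using pos_shift[OF assms] by simp
  have "(\<Sum>x = 1..int n. inv w x - x) = (\<Sum>x = 1..int n. inv w (w x) - w x)"
    using sum_periodic_W[OF assms, of "\<lambda>x. inv w x - x"] per by simp
  also have "\<dots> = (\<Sum>x = 1..int n. - (w x - x))" using W_pos assms by simp
  also have "\<dots> = 0" using assms unfolding sum_negf by (simp add: W_iff)
  finally have "(\<Sum>x = 1..int n. inv w x - x) = 0" .
  moreover have "inv w (x + int n) = inv w x + int n" for x
    using pos_shift[OF assms, of x 1] by simp
  ultimately show ?thesis
    using bij_imp_bij_inv[OF W_bij[OF assms]] unfolding W_iff by blast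
qed

lemma s_W [intro, simp]: "s i \<in> W" by (rule simple_refl_in_aff_sym[OF n2])

section \<open>Reflections and their conjugates\<close>

lemma t_left: "x \<simeq> i \<Longrightarrow> t i j x = x + (j - i)" by (simp add: aff_refl_def)
lemma t_right: "\<lbrakk>\<not> i \<simeq> j; x \<simeq> j\<rbrakk> \<Longrightarrow> t i j x = x - (j - i)"
  unfolding aff_refl_def by (meson cong_sym cong_trans)
lemma t_other: "\<lbrakk>\<not> x \<simeq> i; \<not> x \<simeq> j\<rbrakk> \<Longrightarrow> t i j x = x" by (simp add: aff_refl_def)

lemma t_cases [case_names left right other]:
  assumes "\<not> i \<simeq> j"
  obtains k where "x = i + k * int n" "t i j x = j + k * int n"
  | k where "x = j + k * int n" "t i j x = i + k * int n"
  | "\<not> x \<simeq> i" "\<not> x \<simeq> j" "t i j x = x"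
proof (cases "x \<simeq> i")
  case True
  then obtain k where "x = i + k * int n" by (rule ceqE)
  then show ?thesis using that(1)[of k] t_left[OF True, of j] by simp
next
  case F: False
  show ?thesis
  proof (cases "x \<simeq> j")
    case True
    then obtain k where "x = j + k * int n" by (rule ceqE)
    then show ?thesis using that(2)[of k] t_right[OF assms True] by simp
  qed (use F that(3) t_other in auto)
qed

lemma t_i [simp]: "t i j i = j" by (simp add: t_left)
lemma t_j [simp]: "\<not> i \<simeq> j \<Longrightarrow> t i j j = i" by (simp add: t_right)

lemma t_ik [simp]: "t i j (i + k * int n) = j + k * int n" by (simp add: t_left)
lemma t_jk [simp]: "\<not> i \<simeq> j \<Longrightarrow> t i j (j + k * int n) = i + k * int n" by (simp add: t_right)

lemma t_t [simp]: assumes "\<not> i \<simeq> j" shows "t i j (t i j x) = x"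
  by (cases x rule: t_cases[OF assms]) (use assms in auto)

lemma t_comp_t: assumes "\<not> i \<simeq> j" shows "t i j \<circ> t i j = id"
  using assms by (auto simp: fun_eq_iff)

lemma t_sym: assumes "\<not> i \<simeq> j" shows "t i j = t j i"
proof
  have ne: "\<not> j \<simeq> i" using assms cong_sym by blast
  fix x show "t i j x = t j i x"
    using ne by (cases x rule: t_cases[OF assms]) (auto simp: t_other)
qed

lemma t_add_shift: assumes "\<not> i \<simeq> j" shows "t (i + k * int n) (j + k * int n) = t i j"
proof
  fix x show "t (i + k * int n) (j + k * int n) x = t i j x"
    by (simp add: aff_refl_def)
qed

lemma s_eq_t: "s i = t i (i + 1)" by (simp add: simple_refl_def)

lemma s_cases [case_names left right other]:
  obtains k where "x = i + k * int n" "s i x = i + 1 + k * int n"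
  | k where "x = i + 1 + k * int n" "s i x = i + k * int n"
  | "\<not> x \<simeq> i" "\<not> x \<simeq> i + 1" "s i x = x"
  unfolding s_eq_t using t_cases[OF not_ceq_Suc(1)] by metis

lemma s_s [simp]: "s i (s i x) = x" by (simp add: s_eq_t not_ceq_Suc)
lemma s_comp_s [simp]: "s i \<circ> s i = id" "s i \<circ> (s i \<circ> w) = w" "w \<circ> s i \<circ> s i = w"
  by (auto simp: fun_eq_iff)
lemma s_i [simp]: "s i i = i + 1" "s i (i + 1) = i"
  by (simp_all add: s_eq_t not_ceq_Suc)
lemma s_other: "\<lbrakk>\<not> x \<simeq> i; \<not> x \<simeq> i + 1\<rbrakk> \<Longrightarrow> s i x = x" by (simp add: s_eq_t t_other)

lemma s_ceq: assumes "i \<simeq> j" shows "s i = s j"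
proof -
  obtain k where "i = j + k * int n" using assms by (rule ceqE)
  then show ?thesis using t_add_shift[OF not_ceq_Suc(1), of j k] by (simp add: s_eq_t algebra_simps)
qed

text \<open>Exchanging two positions before w is exchanging the corresponding values after w;
  periodicity carries this to all translates.\<close>

lemma comp_t: assumes "w \<in> W" "\<not> i \<simeq> j" shows "w \<circ> t i j = t (w i) (w j) \<circ> w"
proof
  fix x
  have ne: "\<not> w i \<simeq> w j" using W_ceq assms by blast
  show "(w \<circ> t i j) x = (t (w i) (w j) \<circ> w) x"
    by (cases x rule: t_cases[OF assms(2)])
      (use assms ne in \<open>auto simp: W_shift t_other W_ceq\<close>)
qed

text \<open>Conjugation by \<open>s i\<close> replaces the pair i, j by i + 1 and
  \<open>s i j\<close>. As j is not congruent to i, \<open>s i\<close> never moves j up, so the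
  distance shrinks until it is 1.\<close>

lemma t_W: assumes "\<not> i \<simeq> j" "i < j" shows "t i j \<in> W"
  using assms
proof (induction "nat (j - i)" arbitrary: i j rule: less_induct)
  case less
  show ?case
  proof (cases "j = i + 1")
    case True then show ?thesis using s_W[of i] by (simp add: s_eq_t)
  next
    case F: False
    have ji: "\<not> j \<simeq> i" using less.prems(1) cong_sym by blast
    have sj: "s i j = (if j \<simeq> i + 1 then j - 1 else j)"
      using ji by (auto simp: s_other s_eq_t t_right t_other not_ceq_Suc)
    have j1: "\<not> i + 1 \<simeq> s i j" 
      using W_ceq[OF s_W, of i i j] less.prems(1) by simp
    then have "i + 1 \<noteq> s i j" by (metis cong_refl)
    then have lt: "i + 1 < s i j" using F less.prems(2) sj
      by (cases "j \<simeq> i + 1") (auto split: if_splits)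
    have le: "s i j \<le> j" using sj by auto
    have "t (i + 1) (s i j) \<in> W" using less.hyps[of "s i j" "i + 1"] j1 lt le less.prems by simp
    moreover have "t i j = s i \<circ> t (i + 1) (s i j) \<circ> s i"
      using comp_t[OF s_W less.prems(1), of i] by (simp add: fun_eq_iff) (metis s_s)
    ultimately show ?thesis by auto
  qed
qed

lemma t_W': assumes "\<not> i \<simeq> j" shows "t i j \<in> W"
  using t_W[OF assms] t_W[of j i] t_sym[OF assms] assms
  by (metis cong_refl cong_sym linorder_neqE_linordered_idom)

lemma inv_s: "inv (s i) = s i" by (rule inv_unique_comp) auto

lemma inv_comp_W: "\<lbrakk>v \<in> W; w \<in> W\<rbrakk> \<Longrightarrow> inv (v \<circ> w) = inv w \<circ> inv v"
  by (simp add: o_inv_distrib W_bij)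

lemma pos_s: "u \<in> W \<Longrightarrow> pos (s i \<circ> u) a = pos u (s i a)"
  by (simp add: inv_comp_W inv_s)

lemma pos_t: assumes "u \<in> W" "\<not> i \<simeq> j" shows "pos (u \<circ> t i j) a = t i j (pos u a)"
proof -
  have "inv (t i j) = t i j" using assms(2) by (intro inv_unique_comp t_comp_t)
  then show ?thesis using assms by (simp add: inv_comp_W t_W')
qed

end

section \<open>Inversions, length and covers\<close>

context affine_symmetric begin

text \<open>One representative from each translation class of inversions: the smaller position lies
  in a period that starts at c. The start is kept free so that it can be aligned with the simple
  reflection at hand.\<close>

definition inversions :: "int \<Rightarrow> (int \<Rightarrow> int) \<Rightarrow> (int \<times> int) set" where
  "inversions c u = {(x, y). c \<le> x \<and> x < c + int n \<and> x < y \<and> u y < u x}"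

lemma W_bounded: assumes "u \<in> W" shows "\<exists>B. \<forall>x. \<bar>u x - x\<bar> \<le> B"
proof (intro exI allI)
  fix x
  let ?B = "Max ((\<lambda>x. \<bar>u x - x\<bar>) ` {0..<int n})"
  have "u x - x = u (x mod int n) - x mod int n"
    using W_shift[OF assms, of "x mod int n" "x div int n"] by (simp add: algebra_simps)
  moreover have "x mod int n \<in> {0..<int n}" using n2 by simp
  ultimately show "\<bar>u x - x\<bar> \<le> ?B"
    by (simp del: Max_le_iff atLeastLessThan_iff)
qed

lemma finite_inversions: assumes "u \<in> W" shows "finite (inversions c u)"
proof -
  obtain B where B: "\<And>x. \<bar>u x - x\<bar> \<le> B" using W_bounded[OF assms] by blast
  have "inversions c u \<subseteq> {c..<c + int n} \<times> {c..c + int n + 2 * B}"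
  proof safe
    fix x y assume "(x, y) \<in> inversions c u"
    then show "x \<in> {c..<c + int n}" "y \<in> {c..c + int n + 2 * B}"
      using B[of x] B[of y] by (auto simp: inversions_def abs_le_iff)
  qed
  then show ?thesis by (rule finite_subset) auto
qed

text \<open>Only the pairs with first entry c leave the window, and their translates by n enter
  it.\<close>

lemma card_inversions_Suc: assumes "u \<in> W"
  shows "card (inversions (c + 1) u) = card (inversions c u)"
proof -
  let ?f = "\<lambda>(x, y). if x = c then (x + int n, y + int n) else (x, y)"
  let ?g = "\<lambda>(x, y). if x = c + int n then (x - int n, y - int n) else (x, y)"
  have "bij_betw ?f (inversions c u) (inversions (c + 1) u)"
  proof (rule bij_betw_byWitness[where f' = ?g])
    have f: "?f (x, y) \<in> inversions (c + 1) u \<and> ?g (?f (x, y)) = (x, y)"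
      if "(x, y) \<in> inversions c u" for x y
      using that n2 W_shift1[OF assms, of x] W_shift1[OF assms, of y]
      by (cases "x = c") (simp_all add: inversions_def)
    have g: "?g (x, y) \<in> inversions c u \<and> ?f (?g (x, y)) = (x, y)"
      if "(x, y) \<in> inversions (c + 1) u" for x y
      using that n2 W_shift1'[OF assms, of x] W_shift1'[OF assms, of y]
      by (cases "x = c + int n") (simp_all add: inversions_def)
    {
      fix p assume p: "p \<in> inversions c u"
      obtain x y where xy: "p = (x, y)" by (cases p)
      have "?f p \<in> inversions (c + 1) u \<and> ?g (?f p) = p" using f[of x y] p unfolding xy by blast
    }
    note F = this
    {
      fix p assume p: "p \<in> inversions (c + 1) u"
      obtain x y where xy: "p = (x, y)" by (cases p)
      have "?g p \<in> inversions c u \<and> ?f (?g p) = p" using g[of x y] p unfolding xy by blast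
    }
    note G = this
    show "\<forall>p\<in>inversions c u. ?g (?f p) = p" "\<forall>p\<in>inversions (c + 1) u. ?f (?g p) = p"
      "?f ` inversions c u \<subseteq> inversions (c + 1) u" "?g ` inversions (c + 1) u \<subseteq> inversions c u"
      using F G by blast+
  qed
  from bij_betw_same_card[OF this] show ?thesis by (rule sym)
qed

definition inv_count :: "(int \<Rightarrow> int) \<Rightarrow> nat" where "inv_count u = card (inversions 0 u)"

lemma card_inversions: assumes "u \<in> W" shows "card (inversions c u) = inv_count u"
proof (induction c rule: int_induct[where k = 0])
  case base show ?case by (simp add: inv_count_def)
next
  case (step1 i) then show ?case using card_inversions_Suc[OF assms] by simp
next
  case (step2 i) then show ?case using card_inversions_Suc[OF assms, of "i - 1"] by simp
qed

lemma s_mono: assumes "x < y" "\<not> (x \<simeq> i \<and> y = x + 1)" shows "s i x < s i y"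
proof -
  have sx: "s i x = (if x \<simeq> i then x + 1 else if x \<simeq> i + 1 then x - 1 else x)" for x
    by (cases x i rule: s_cases) (auto simp: not_ceq_Suc)
  \<comment> \<open>The two entries move towards each other, so a gap of 2 would not suffice. The
    next candidate after x + 1 is a whole period further, and n \<ge> 2.\<close>
  have A: "y \<ge> x + 3" if "x \<simeq> i" "y \<simeq> i + 1"
  proof -
    have "x + 1 \<simeq> y" using that by (metis ceq_Suc_iff cong_sym cong_trans)
    moreover have "x + 1 < y" using assms that by linarith
    ultimately show ?thesis using ceq_less[of "x + 1" y] n2 by linarith
  qed
  have B: "y \<noteq> x + 1" if "x \<simeq> i \<longleftrightarrow> \<not> y \<simeq> i + 1"
    using that ceq_Suc_iff[of x i] by blast
  have C: "\<not> y \<simeq> i + 1" if "y \<simeq> i"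
    using that not_ceq_Suc by (meson cong_sym cong_trans)
  show ?thesis
  proof (cases "x \<simeq> i"; cases "y \<simeq> i + 1")
    assume "x \<simeq> i" "y \<simeq> i + 1" then show ?thesis using A C by (simp add: sx)
  next
    assume "x \<simeq> i" "\<not> y \<simeq> i + 1" then show ?thesis using B assms(1) by (simp add: sx)
  next
    assume "\<not> x \<simeq> i" "y \<simeq> i + 1" then show ?thesis using B C assms(1) by (simp add: sx)
  next
    assume "\<not> x \<simeq> i" "\<not> y \<simeq> i + 1" then show ?thesis using assms(1) by (simp add: sx)
  qed
qed

text \<open>A period that starts at i contains both i and i + 1, so \<open>s i\<close> pushes
  nothing across its ends.\<close>

lemma s_window: assumes "i \<le> x" "x < i + int n" shows "i \<le> s i x \<and> s i x < i + int n"
proof (cases x i rule: s_cases)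
  case (left k)
  then have c: "x \<simeq> i" "i \<simeq> x" by simp_all
  have "x = i" using assms ceq_less[OF c(1)] ceq_less[OF c(2)] n2 by linarith
  then show ?thesis using n2 by simp
next
  case (right k)
  then have c: "i + 1 \<simeq> x" "x \<simeq> i + 1" by simp_all
  have "x = i + 1" using assms ceq_less[OF c(1)] ceq_less[OF c(2)] n2 by linarith
  then show ?thesis using n2 by simp
qed (use assms in auto)

text \<open>Relabelling both positions by \<open>s i\<close> matches the inversions of u with those
  of the product, except that (i, i + 1) is new.\<close>

lemma inv_count_s_up: assumes u: "u \<in> W" and lt: "u i < u (i + 1)"
  shows "inv_count (u \<circ> s i) = Suc (inv_count u)"
proof -
  let ?f = "\<lambda>(x, y). (s i x, s i y)"
  have xi: "x = i" if "i \<le> x" "x < i + int n" "x \<simeq> i" for x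
    using that ceq_less[of i x] cong_sym[OF that(3)] by linarith
  have mem: "(s i x, s i y) \<in> inversions i (v \<circ> s i)"
    if "(x, y) \<in> inversions i v" "(x, y) \<noteq> (i, i + 1)" for x y v
    using that s_window[of i x] s_mono[of x y i] xi[of x] by (auto simp: inversions_def)
  have "inversions i (u \<circ> s i) = insert (i, i + 1) (?f ` inversions i u)"
  proof safe
    fix x y assume xy: "(x, y) \<in> inversions i (u \<circ> s i)" "(x, y) \<notin> ?f ` inversions i u"
    have "(x, y) = (i, i + 1)"
    proof (rule ccontr)
      assume "\<not> ?thesis"
      with mem[OF xy(1)] have "(s i x, s i y) \<in> inversions i u" by (simp add: comp_def)
      then show False using xy(2) by force
    qed
    then show "x = i" "y = i + 1" by auto
  next
    show "(i, i + 1) \<in> inversions i (u \<circ> s i)" using lt n2 by (auto simp: inversions_def)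
  next
    fix x y assume xy: "(x, y) \<in> inversions i u"
    then have "(x, y) \<noteq> (i, i + 1)" using lt by (auto simp: inversions_def)
    then show "(s i x, s i y) \<in> inversions i (u \<circ> s i)" using mem xy by blast
  qed
  moreover have "(i, i + 1) \<notin> ?f ` inversions i u"
  proof
    assume "(i, i + 1) \<in> ?f ` inversions i u"
    then obtain x y where xy: "(x, y) \<in> inversions i u" "s i x = i" "s i y = i + 1" by auto
    then have "x = i + 1" "y = i" by (metis s_s s_i)+
    then show False using xy(1) by (auto simp: inversions_def)
  qed
  moreover have "inj_on ?f (inversions i u)"
    by (intro inj_onI) (auto, (metis s_s)+)
  ultimately have "card (inversions i (u \<circ> s i)) = Suc (card (inversions i u))"
    using finite_inversions[OF u] by (simp add: card_image)
  then show ?thesis using u by (simp add: card_inversions)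
qed

lemma inv_count_s_down: assumes u: "u \<in> W" and lt: "u (i + 1) < u i"
  shows "inv_count u = Suc (inv_count (u \<circ> s i))"
  using inv_count_s_up[of "u \<circ> s i" i] assms by simp

lemma inv_count_s_le: assumes u: "u \<in> W" shows "inv_count (u \<circ> s i) \<le> Suc (inv_count u)"
proof (cases "u i < u (i + 1)")
  case True then show ?thesis using inv_count_s_up[OF u True] by linarith
next
  case False
  then have "u (i + 1) < u i" using W_inj[OF u, of i "i + 1"] by linarith
  from inv_count_s_down[OF u this] show ?thesis by linarith
qed

lemma inv_count_id: "inv_count id = 0"
proof -
  have "inversions 0 id = {}" by (auto simp: inversions_def)
  then show ?thesis by (simp add: inv_count_def)
qed

text \<open>An increasing bijection of the integers is a translation, and the normalization excludes
  all but the trivial one.\<close>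

lemma inv_count_0: assumes u: "u \<in> W" and mono: "\<And>i. u i < u (i + 1)" shows "u = id"
proof -
  have less: "u x < u y" if "x < y" for x y
    using that
  proof (induction y rule: int_gr_induct)
    case base show ?case by (rule mono)
  next
    case (step i) then show ?case using mono[of i] by simp
  qed
  have step: "u (x + 1) = u x + 1" for x
  proof -
    obtain y where y: "u y = u x + 1" using W_pos[OF u] by metis
    then have "x < y" using less[of y x] by (cases "y < x"; cases "y = x") auto
    then have "u (x + 1) \<le> u y" using less[of "x + 1" y] by (cases "x + 1 = y") auto
    then show ?thesis using y mono[of x] by linarith
  qed
  have lin: "u x = u 0 + x" for x
  proof (induction x rule: int_induct[where k = 0])
    case (step2 i) then show ?case using step[of "i - 1"] by simp
  qed (simp_all add: step)
  have "(\<Sum>x = 1..int n. u x - x) = 0" using u by (simp add: W_iff)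
  moreover have "u x - x = u 0" for x using lin[of x] by linarith
  ultimately have "int n * u 0 = 0" by simp
  then have "u 0 = 0" using n2 by simp
  then have "u x = x" for x using lin[of x] by linarith
  then show ?thesis by (simp add: fun_eq_iff)
qed

section \<open>Words, and length as the number of inversions\<close>

lemma word_Nil [simp]: "word_elt n [] = id" by (simp add: word_elt_def)
lemma word_Cons [simp]: "word_elt n (i # is) = s i \<circ> word_elt n is" by (simp add: word_elt_def)
lemma word_append: "word_elt n (is @ js) = word_elt n is \<circ> word_elt n js"
  by (induction "is") (auto simp: comp_assoc)
lemma word_W [simp]: "word_elt n is \<in> W"
proof (induction "is")
  case Nil show ?case using id_W word_Nil by metis
next
  case (Cons i "is") then show ?case using comp_W[OF s_W] word_Cons by metis
qed

lemma word_inv_count: "inv_count (word_elt n is) \<le> length is"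
proof (induction "is" rule: rev_induct)
  case (snoc i "is")
  let ?u = "word_elt n is"
  have "inv_count (?u \<circ> s i) \<le> Suc (inv_count ?u)" by (rule inv_count_s_le) simp
  moreover have "word_elt n (is @ [i]) = ?u \<circ> s i" by (simp add: word_append)
  ultimately have "inv_count (word_elt n (is @ [i])) \<le> length (is @ [i])" using snoc by simp
  then show ?case .
next
  case Nil show ?case using inv_count_id word_Nil by (metis le0)
qed

lemma word_exists: assumes "u \<in> W" shows "\<exists>is. length is = inv_count u \<and> word_elt n is = u"
  using assms
proof (induction "inv_count u" arbitrary: u)
  case 0
  have "u i < u (i + 1)" for i
  proof (rule ccontr)
    assume "\<not> ?thesis"
    then have "u (i + 1) < u i" using W_inj[OF 0(2), of i "i + 1"] by linarith
    from inv_count_s_down[OF 0(2) this] show False using 0(1) by linarith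
  qed
  then have "u = id" by (rule inv_count_0[OF 0(2)])
  then show ?case using 0(1) by (intro exI[of _ "[]"]) (simp add: inv_count_id)
next
  case (Suc k)
  have "\<exists>i. u (i + 1) < u i"
  proof (rule ccontr)
    assume "\<not> ?thesis"
    then have "\<not> u (i + 1) < u i" for i by blast
    moreover have "u i \<noteq> u (i + 1)" for i using W_inj[OF Suc(3), of i "i + 1"] by simp
    ultimately have "u i < u (i + 1)" for i using linorder_neqE by blast
    then have "u = id" by (rule inv_count_0[OF Suc(3)])
    then show False using Suc(2) by (simp add: inv_count_id)
  qed
  then obtain i where i: "u (i + 1) < u i" by blast
  have k: "k = inv_count (u \<circ> s i)" using inv_count_s_down[OF Suc(3) i] Suc(2) by linarith
  obtain "is" where "is": "length is = inv_count (u \<circ> s i)" "word_elt n is = u \<circ> s i"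
    using Suc(1)[OF k] Suc(3) by auto
  then show ?case using Suc(2) k
    by (intro exI[of _ "is @ [i]"]) (simp add: word_append)
qed

lemma len_inv_count: assumes "u \<in> W" shows "len u = inv_count u"
  unfolding aff_length_def
  by (rule Least_equality) (use word_exists[OF assms] word_inv_count in auto)

lemma reduced_exists: "u \<in> W \<Longrightarrow> \<exists>is. reduced_word n is u"
  using word_exists[of u] by (auto simp: reduced_word_def len_inv_count)

lemma len_word_le: "len (word_elt n is) \<le> length is"
  by (simp add: len_inv_count word_inv_count)

lemma len_id: "len id = 0" by (simp add: len_inv_count inv_count_id)

lemma len_s_up: "\<lbrakk>u \<in> W; u i < u (i + 1)\<rbrakk> \<Longrightarrow> len (u \<circ> s i) = Suc (len u)"
  by (simp add: len_inv_count inv_count_s_up)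
lemma len_s_down: "\<lbrakk>u \<in> W; u (i + 1) < u i\<rbrakk> \<Longrightarrow> len u = Suc (len (u \<circ> s i))"
  using inv_count_s_down[of u i] by (simp add: len_inv_count)

lemma inv_word: "inv (word_elt n is) = word_elt n (rev is)"
proof (induction "is")
  case Nil show ?case by (metis inv_id rev.simps(1) word_Nil)
next
  case (Cons i "is")
  have "inv (s i \<circ> word_elt n is) = word_elt n (rev is) \<circ> s i"
    using Cons by (simp add: inv_comp_W inv_s)
  moreover have "word_elt n (rev (i # is)) = word_elt n (rev is) \<circ> s i" by (simp add: word_append)
  ultimately have "inv (word_elt n (i # is)) = word_elt n (rev (i # is))" by simp
  then show ?case .
qed

lemma len_inv: assumes "u \<in> W" shows "len (inv u) = len u"
proof -
  have le: "len (inv u) \<le> len u" if u: "u \<in> W" for u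
  proof -
    obtain "is" where "word_elt n is = u" "length is = len u"
      using reduced_exists[OF u] by (auto simp: reduced_word_def)
    then show ?thesis using len_word_le[of "rev is"] inv_word[of "is"] by simp
  qed
  have "inv (inv u) = u" using assms W_bij inv_inv_eq by blast
  then show ?thesis using le[OF assms] le[OF inv_W[OF assms]] by simp
qed

text \<open>A left ascent, read off from positions. By \<open>len_s_asc\<close> and
  \<open>len_s_desc\<close> it decides whether left multiplication by \<open>s a\<close> lengthens
  u.\<close>

definition asc :: "int \<Rightarrow> (int \<Rightarrow> int) \<Rightarrow> bool" where "asc a u \<longleftrightarrow> pos u a < pos u (a + 1)"

lemma asc_ceq: assumes "u \<in> W" "a \<simeq> b" shows "asc a u \<longleftrightarrow> asc b u"
proof -
  obtain k where "a = b + k * int n" using assms(2) by (rule ceqE)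
  then show ?thesis using pos_shift[OF assms(1), of b k] pos_shift[OF assms(1), of "b + 1" k]
    by (simp add: asc_def algebra_simps)
qed

lemma asc_s: assumes "u \<in> W" shows "asc a (s a \<circ> u) \<longleftrightarrow> \<not> asc a u"
  using assms pos_inj[OF assms, of a "a + 1"] by (auto simp: asc_def pos_s)

lemma len_s_asc: assumes "u \<in> W" "asc a u" shows "len (s a \<circ> u) = Suc (len u)"
proof -
  have "len (inv u \<circ> s a) = Suc (len (inv u))"
    using assms by (intro len_s_up) (auto simp: asc_def)
  moreover have "inv (s a \<circ> u) = inv u \<circ> s a" using assms by (simp add: inv_comp_W inv_s)
  ultimately show ?thesis using len_inv assms by (metis comp_W s_W)
qed

lemma len_s_desc: assumes "u \<in> W" "\<not> asc a u" shows "len u = Suc (len (s a \<circ> u))"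
  using len_s_asc[of "s a \<circ> u" a] assms by (auto simp: asc_s)

text \<open>Write t_xy as s_x t' s_x with a shorter reflection t'. The inner factor lengthens by
  induction, and each outer factor changes the length by one; if u has a descent at x, the second
  outer factor regains what the first one lost.\<close>

lemma len_t_up: assumes "u \<in> W" "\<not> x \<simeq> y" "x < y" "u x < u y" shows "len u < len (u \<circ> t x y)"
  using assms
proof (induction "nat (y - x)" arbitrary: u x y rule: less_induct)
  case less
  note u = less.prems(1)
  show ?case
  proof (cases "y = x + 1")
    case True then show ?thesis using len_s_up[OF u, of x] less.prems by (simp add: s_eq_t)
  next
    case F: False
    have yx: "\<not> y \<simeq> x" using less.prems(2) cong_sym by blast
    have sy: "s x y = (if y \<simeq> x + 1 then y - 1 else y)"
      using yx by (auto simp: s_other s_eq_t t_right t_other not_ceq_Suc)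
    have x1: "\<not> x + 1 \<simeq> s x y"
      using W_ceq[OF s_W, of x x y] less.prems(2) by simp
    then have "x + 1 \<noteq> s x y" by (metis cong_refl)
    then have lt: "x + 1 < s x y" using F less.prems(3) sy
      by (cases "y \<simeq> x + 1") (auto split: if_splits)
    have le: "s x y \<le> y" using sy by auto
    let ?t' = "t (x + 1) (s x y)"
    have tt: "t x y = s x \<circ> ?t' \<circ> s x"
      using comp_t[OF s_W less.prems(2), of x] by (simp add: fun_eq_iff) (metis s_s)
    have t'W: "?t' \<in> W" using t_W'[OF x1] .
    have 1: "len (u \<circ> s x) < len (u \<circ> s x \<circ> ?t')"
      using less.hyps[of "s x y" "x + 1" "u \<circ> s x"] le lt x1 less.prems by auto
    have 2: "u \<circ> t x y \<circ> s x = u \<circ> s x \<circ> ?t'" by (simp add: tt fun_eq_iff)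
    have utW: "u \<circ> t x y \<in> W" using u t_W'[OF less.prems(2)] by blast
    show ?thesis
    proof (cases "u x < u (x + 1)")
      case True
      have "len (u \<circ> t x y \<circ> s x) \<le> Suc (len (u \<circ> t x y))"
        using inv_count_s_le[OF utW] utW by (simp add: len_inv_count)
      then show ?thesis using 1 2 len_s_up[OF u True] by simp
    next
      case False
      then have d: "u (x + 1) < u x" using W_inj[OF u, of x "x + 1"] by simp
      \<comment> \<open>Since position x carries u y after the exchange, this is a descent of the
        product at x. If x + 1 is a translate of y, it is a translate downwards.\<close>
      have "u (t x y (x + 1)) < u y"
      proof (cases "x + 1" rule: t_cases[OF less.prems(2)])
        case (1 k)
        have "x + 1 \<simeq> x" unfolding 1(1) ceq_shift by (rule cong_refl)
        then show ?thesis using not_ceq_Suc by blast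
      next
        case (2 k)
        then have "k * int n < 0" using F less.prems(3) by linarith
        then show ?thesis using 2 W_shift[OF u, of x k] less.prems(4) by simp
      next
        case 3 then show ?thesis using d less.prems(4) by simp
      qed
      then have "(u \<circ> t x y) (x + 1) < (u \<circ> t x y) x" by simp
      then have "len (u \<circ> t x y) = Suc (len (u \<circ> t x y \<circ> s x))" by (rule len_s_down[OF utW])
      then show ?thesis using 1 2 len_s_down[OF u d] by simp
    qed
  qed
qed

lemma len_t_down: assumes "u \<in> W" "\<not> x \<simeq> y" "x < y" "u y < u x" shows "len (u \<circ> t x y) < len u"
  using len_t_up[of "u \<circ> t x y" x y] assms t_W'[OF assms(2)] t_comp_t[OF assms(2)]
  by (auto simp: comp_assoc)

lemma cover_desc: assumes "u \<in> W" "\<not> x \<simeq> y" "x < y" "len u = Suc (len (u \<circ> t x y))"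
  shows "u y < u x"
  using len_t_up[OF assms(1-3)] assms W_inj[OF assms(1), of x y] by (cases "u x < u y") auto

text \<open>If the value at z lay strictly between, t_xy = t_xz t_zy t_xz would be a product of
  three reflections each of which shortens, a drop of at least three.\<close>

lemma cover_between:
  assumes u: "u \<in> W" and ne: "\<not> x \<simeq> y" and "x < y" and l: "len u = Suc (len (u \<circ> t x y))"
    and z: "x < z" "z < y"
  shows "\<not> (u y < u z \<and> u z < u x)"
proof
  assume uz: "u y < u z \<and> u z < u x"
  have zx: "\<not> x \<simeq> z"
  proof
    assume "x \<simeq> z" then obtain k where k: "z = x + k * int n" using ceqE cong_sym by metis
    then show False using z uz W_shift[OF u, of x k] by simp
  qed
  have zy: "\<not> z \<simeq> y"
  proof
    assume "z \<simeq> y" then obtain k where k: "z = y + k * int n" using ceqE by metis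
    then show False using z uz W_shift[OF u, of y k] by simp
  qed
  have yx: "\<not> y \<simeq> x" "\<not> y \<simeq> z" using ne zy cong_sym by blast+
  have tt: "t x z \<circ> t z y = t x y \<circ> t x z"
    using comp_t[OF t_W'[OF zx] zy] zx yx by (simp add: t_other)
  let ?u1 = "u \<circ> t x z" let ?u2 = "?u1 \<circ> t z y"
  have u1: "?u1 \<in> W" and u2: "?u2 \<in> W" using u t_W' zx zy by blast+
  have a: "len ?u1 < len u" using uz z zx u by (intro len_t_down) auto
  have b: "len ?u2 < len ?u1"
    using uz z zx zy yx u1 by (intro len_t_down) (auto simp: t_other)
  have xzy: "t z y x = x" using zx ne by (intro t_other) (auto simp: cong_sym_eq)
  have c: "len (?u2 \<circ> t x z) < len ?u2"
    using uz z zx zy yx u2 xzy by (intro len_t_down) (auto simp: t_other)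
  have "?u2 \<circ> t x z = u \<circ> t x y"
    using tt t_t[OF zx] by (simp add: fun_eq_iff)
  then show False using a b c l by simp
qed

text \<open>\<open>?y1\<close> and \<open>?y2\<close> are translates of y, the first within one
  period after x, the second before x, and t_xy is the product of the reflections of x with
  \<open>?y1\<close>, \<open>?y2\<close> and \<open>?y1\<close>. When the inversion is wider than a
  period and at least as deep as wide, all three factors shorten, so there is no cover.\<close>

lemma cover_wrap_aux:
  assumes u: "u \<in> W" and ne: "\<not> x \<simeq> y" and l: "len u = Suc (len (u \<circ> t x y))"
    and w: "x + int n < y" and e: "y - x \<le> u x - u y"
  shows False
proof -
  define k where "k = (y - x) div int n"
  let ?N = "int n"
  have dm: "y - x = k * ?N + (y - x) mod ?N" unfolding k_def by simp
  have mp: "0 \<le> (y - x) mod ?N" "(y - x) mod ?N < ?N" using n2 by simp_all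
  have "(y - x) mod ?N \<noteq> 0"
    using ne by (simp add: cong_iff_dvd_diff dvd_eq_mod_eq_0[symmetric] dvd_diff_commute)
  then have k: "k * ?N < y - x" "y - x < k * ?N + ?N" using dm mp by linarith+
  have k1: "?N \<le> k * ?N"
  proof -
    have "k \<ge> 1"
      using w n2 unfolding k_def by (simp add: pos_imp_zdiv_pos_iff int_one_le_iff_zero_less)
    then show ?thesis using n2 by (simp add: mult_le_cancel_right1)
  qed
  let ?y1 = "y + (- k) * ?N" let ?y2 = "y + (- 2 * k) * ?N"
  have ne1: "\<not> x \<simeq> ?y1" "\<not> x \<simeq> ?y2" using ne by (simp_all only: ceq_shift not_False_eq_True)
  let ?u1 = "u \<circ> t x ?y1" let ?u2 = "?u1 \<circ> t x ?y2"
  have u1: "?u1 \<in> W" and u2: "?u2 \<in> W" using u t_W' ne1 by blast+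
  have uy: "u (y + j * ?N) = u y + j * ?N" "u (x + j * ?N) = u x + j * ?N" for j
    using W_shift[OF u] by blast+
  have t1y: "t x ?y1 (y + j * ?N) = x + (j + k) * ?N" for j
    using t_jk[OF ne1(1), of "j + k"] by (simp add: algebra_simps)
  have t2y: "t x ?y2 (y + j * ?N) = x + (j + 2 * k) * ?N" for j
    using t_jk[OF ne1(2), of "j + 2 * k"] by (simp add: algebra_simps)
  have a: "len ?u1 < len u"
  proof (rule len_t_down[OF u ne1(1)])
    show "x < ?y1" using k by simp
    have "u ?y1 = u y - k * ?N" using uy(1)[of "-k"] by simp
    then show "u ?y1 < u x" using e k1 w n2 by linarith
  qed
  have b: "len ?u2 < len ?u1"
  proof -
    have "len (?u1 \<circ> t ?y2 x) < len ?u1"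
    proof (rule len_t_down[OF u1])
      show "\<not> ?y2 \<simeq> x" using ne1 cong_sym by blast
      have "?y2 = y - 2 * (k * ?N)" by simp
      then show "?y2 < x" using k k1 by linarith
      have "?u1 ?y2 = u x - k * ?N" using t1y[of "- 2 * k"] uy(2)[of "-k"] by simp
      moreover have "?u1 x = u y - k * ?N" using uy(1)[of "-k"] by simp
      ultimately show "?u1 x < ?u1 ?y2" using e w n2 by linarith
    qed
    then show ?thesis using t_sym[OF ne1(2)] by simp
  qed
  have c: "len (?u2 \<circ> t x ?y1) < len ?u2"
  proof (rule len_t_down[OF u2 ne1(1)])
    show "x < ?y1" using k by simp
    have "?u2 ?y1 = u (t x ?y1 (x + k * ?N))" using t2y[of "-k"] by simp
    also have "t x ?y1 (x + k * ?N) = y" using t_ik[of x ?y1 k] by (simp add: algebra_simps)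
    finally have A: "?u2 ?y1 = u y" .
    have "?u2 x = u (t x ?y1 ?y2)" by simp
    also have "t x ?y1 ?y2 = x + (-k) * ?N" using t1y[of "-2*k"] by simp
    finally have "?u2 x = u x - k * ?N" using uy(2)[of "-k"] by simp
    then show "?u2 ?y1 < ?u2 x" using A e k by linarith
  qed
  have "?u2 \<circ> t x ?y1 = u \<circ> t x y"
  proof -
    have "t x ?y1 \<circ> t x ?y2 = t (t x ?y1 x) (t x ?y1 ?y2) \<circ> t x ?y1"
      by (rule comp_t[OF t_W'[OF ne1(1)] ne1(2)])
    also have "t (t x ?y1 x) (t x ?y1 ?y2) = t ?y1 (x + (-k) * ?N)" using t1y[of "-2*k"] by simp
    also have "\<dots> = t y x" using t_add_shift[of y x "-k"] ne cong_sym by blast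
    also have "\<dots> = t x y" using t_sym[OF ne] by simp
    finally show ?thesis using t_t[OF ne1(1)] by (simp add: fun_eq_iff)
  qed
  then show False using a b c l by simp
qed

text \<open>A cover cannot exceed a period both in positions and in values. If the gap in values
  dominates, \<open>cover_wrap_aux\<close> applies; otherwise it applies to the inverse, where
  positions and values change roles.\<close>

lemma cover_wrap:
  assumes u: "u \<in> W" and ne: "\<not> x \<simeq> y" and xy: "x < y" and l: "len u = Suc (len (u \<circ> t x y))"
  shows "y < x + int n \<or> u x < u y + int n"
proof (rule ccontr)
  assume "\<not> ?thesis"
  moreover have "y \<noteq> x + int n" "u x \<noteq> u y + int n"
    using ne ceq_shift(2)[of x x 1] W_ceq[OF u, of x y] ceq_shift(1)[of "u y" 1 "u y"] by auto
  ultimately have w: "x + int n < y" "u y + int n < u x" by linarith+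
  show False
  proof (cases "y - x \<le> u x - u y")
    case True then show False using cover_wrap_aux[OF u ne l w(1)] by blast
  next
    case False
    have ne': "\<not> u y \<simeq> u x" using W_ceq[OF u] ne cong_sym by blast
    have utW: "u \<circ> t x y \<in> W" using u t_W'[OF ne] by blast
    have "inv u \<circ> t (u y) (u x) = inv (u \<circ> t x y)"
    proof -
      have "u \<circ> t x y = t (u y) (u x) \<circ> u" using comp_t[OF u ne] t_sym[OF ne'] by simp
      moreover have "inv (t (u y) (u x)) = t (u y) (u x)"
        using ne' by (intro inv_unique_comp t_comp_t)
      ultimately show ?thesis using u t_W'[OF ne'] by (simp add: inv_comp_W)
    qed
    then have "len (inv u) = Suc (len (inv u \<circ> t (u y) (u x)))"
      using l len_inv[OF u] len_inv[OF utW] by simp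
    from cover_wrap_aux[OF inv_W[OF u] ne' this w(2)] show False using False W_pos(2)[OF u] by simp
  qed
qed

end

section \<open>Marked covers\<close>

locale strips = affine_symmetric +
  fixes l :: int
begin

definition Ncov :: "int \<Rightarrow> (int \<Rightarrow> int) \<Rightarrow> (int \<Rightarrow> int) set" where
  "Ncov a u = {v. marked_cover n l u a v}"

lemma mult_n_cases: "k * int n \<le> - int n \<or> k * int n = 0 \<or> int n \<le> k * int n"
proof -
  consider "k \<le> -1" | "k = 0" | "1 \<le> k" by linarith
  then show ?thesis
  proof cases
    case 1 then have "k * int n \<le> (-1) * int n" by (intro mult_right_mono) auto
    then show ?thesis by simp
  next
    case 3 then have "1 * int n \<le> k * int n" by (intro mult_right_mono) auto
    then show ?thesis by simp
  qed simp
qed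

lemma comp_t_s: assumes "u \<in> W" "u i = c + 1" "u j = c"
  shows "\<not> i \<simeq> j" "u \<circ> t i j = s c \<circ> u"
proof -
  show ne: "\<not> i \<simeq> j" using W_ceq[OF assms(1), of i j] assms not_ceq_Suc by simp
  show "u \<circ> t i j = s c \<circ> u"
    using comp_t[OF assms(1) ne] t_sym[OF not_ceq_Suc(2), of c] assms by (simp add: s_eq_t)
qed

lemma Ncov_iff: "v \<in> Ncov a u \<longleftrightarrow> u \<in> W \<and>
  (\<exists>i j. i \<le> l \<and> l < j \<and> \<not> i \<simeq> j \<and> v = u \<circ> t i j \<and> u j = a \<and> len u = Suc (len v))"
proof
  assume "v \<in> Ncov a u"
  then have m: "marked_cover n l u a v" by (simp add: Ncov_def)
  then obtain i j where ij: "i \<le> l" "l < j" "\<not> i \<simeq> j" "u = v \<circ> t i j" "a = u j"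
    unfolding marked_cover_def by blast
  have "v = u \<circ> t i j" using ij(3,4) by (simp add: fun_eq_iff)
  moreover have "u \<in> W" "bruhat_cover n v u" using m unfolding marked_cover_def by blast+
  moreover from this(2) have "len u = Suc (len v)" by (simp add: bruhat_cover_def)
  ultimately show "u \<in> W \<and> (\<exists>i j. i \<le> l \<and> l < j \<and> \<not> i \<simeq> j \<and> v = u \<circ> t i j \<and> u j = a \<and>
      len u = Suc (len v))"
    using ij by blast
next
  assume "u \<in> W \<and> (\<exists>i j. i \<le> l \<and> l < j \<and> \<not> i \<simeq> j \<and> v = u \<circ> t i j \<and> u j = a \<and> len u = Suc (len v))"
  then obtain i j where u: "u \<in> W"
    and ij: "i \<le> l" "l < j" "\<not> i \<simeq> j" "v = u \<circ> t i j" "u j = a" "len u = Suc (len v)"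
    by blast
  have v: "v \<in> W" using u ij(4) t_W'[OF ij(3)] by simp
  have uv: "u = v \<circ> t i j" using ij(3,4) by (simp add: fun_eq_iff)
  have "i < j" using ij by simp
  then have "bruhat_step n v u" unfolding bruhat_step_def using v uv ij(3,6)
    by (metis lessI)
  then have "bruhat_cover n v u" using ij(6) unfolding bruhat_cover_def bruhat_less_def
    by (metis Suc_eq_plus1 tranclp.r_into_trancl)
  moreover have "v i = a" using ij by simp
  ultimately show "v \<in> Ncov a u"
    unfolding Ncov_def marked_cover_def mem_Collect_eq using u v uv ij(1-3,5) by metis
qed

lemma NcovE:
  assumes "v \<in> Ncov a u"
  obtains i j where "i \<le> l" "l < j" "\<not> i \<simeq> j" "v = u \<circ> t i j" "u j = a" "len u = Suc (len v)"
    "u \<in> W" "v \<in> W" "a < u i" "\<forall>z. i < z \<and> z < j \<longrightarrow> \<not> (a < u z \<and> u z < u i)"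
    "j < i + int n \<or> u i < a + int n" "pos u a = j" "pos v a = i"
proof -
  obtain i j where u: "u \<in> W"
    and ij: "i \<le> l" "l < j" "\<not> i \<simeq> j" "v = u \<circ> t i j" "u j = a" "len u = Suc (len v)"
    using assms Ncov_iff by blast
  have v: "v \<in> W" using u ij(4) t_W'[OF ij(3)] by simp
  have lt: "i < j" using ij by simp
  note h = u ij(3) lt ij(6)[unfolded ij(4)]
  have p: "pos u a = j" using W_pos_eq[OF u] ij by simp
  have p': "pos v a = i" using pos_t[OF u ij(3), of a] ij p by simp
  show thesis
  proof (rule that[OF ij u v _ _ _ p p'])
    show "a < u i" using cover_desc[OF h] ij(5) by simp
    show "\<forall>z. i < z \<and> z < j \<longrightarrow> \<not> (a < u z \<and> u z < u i)"
      using cover_between[OF h] ij(5) by blast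
    show "j < i + int n \<or> u i < a + int n" using cover_wrap[OF h] ij(5) by simp
  qed
qed

lemma Ncov_W: assumes "v \<in> Ncov a u" shows "v \<in> W" "u \<in> W" "len u = Suc (len v)"
  by (rule NcovE[OF assms], assumption)+

lemma Ncov_pos: assumes "v \<in> Ncov a u" shows "pos v a \<le> l" "l < pos u a"
proof -
  obtain i j where "i \<le> l" "l < j" "pos u a = j" "pos v a = i"
    using assms by (rule NcovE) (rule that; assumption)
  then show "pos v a \<le> l" "l < pos u a" by simp_all
qed

text \<open>The marking determines the right position. Bounded displacement confines the left one,
  because the value there exceeds a.\<close>

lemma finite_Ncov: "finite (Ncov a u)"
proof (cases "u \<in> W")
  case True
  obtain B where B: "\<And>x. \<bar>u x - x\<bar> \<le> B" using W_bounded[OF True] by blast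
  have "Ncov a u \<subseteq> (\<lambda>i. u \<circ> t i (pos u a)) ` {a - B..l}"
  proof
    fix v assume "v \<in> Ncov a u"
    then obtain i j where "i \<le> l" "v = u \<circ> t i j" "a < u i" "pos u a = j"
      by (rule NcovE) (rule that; assumption)
    moreover have "a - B \<le> i" using B[of i] \<open>a < u i\<close> by linarith
    ultimately show "v \<in> (\<lambda>i. u \<circ> t i (pos u a)) ` {a - B..l}" by auto
  qed
  then show ?thesis by (rule finite_subset) auto
next
  case False
  then have "Ncov a u = {}" using Ncov_W by blast
  then show ?thesis by simp
qed

text \<open>Lifting property: a cover that turns the left descent a into an ascent exchanges a and a
  + 1 themselves. Any other exchange with this effect would have an intermediate value strictly
  inside it, contrary to \<open>cover_between\<close>, or would exceed a period in both directions,
  contrary to \<open>cover_wrap\<close>.\<close>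

lemma cover_lift_eq:
  assumes U: "U \<in> W" and d: "\<not> asc a U" and xy: "x < y" "\<not> x \<simeq> y"
    and c: "len U = Suc (len (U \<circ> t x y))" and V: "asc a (U \<circ> t x y)"
  shows "U \<circ> t x y = s a \<circ> U"
proof -
  define p q where "p = pos U a" and "q = pos U (a + 1)"
  have Up: "U p = a" "U q = a + 1" using W_pos[OF U] by (auto simp: p_def q_def)
  have "p \<noteq> q" using Up by auto
  then have qp: "q < p" using d by (simp add: asc_def p_def q_def)
  \<comment> \<open>The value a stands at the right end of the exchange; a translate of the right
    end is reduced to this case by shifting x and y.\<close>
  have goal_y: "U \<circ> t x y = s a \<circ> U"
    if xy: "x < y" "\<not> x \<simeq> y" and c: "len U = Suc (len (U \<circ> t x y))" and tt: "t x y p < t x y q"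
      and py: "p = y" for x y
  proof (cases "U x = a + 1")
    case True then show ?thesis using comp_t_s[OF U] Up py by blast
  next
    case False
    have b: "a + 1 < U x" using cover_desc[OF U xy(2,1) c] Up py False by simp
    have tp: "t x y p = x" using py xy by simp
    show ?thesis
    proof (cases q rule: t_cases[OF xy(2)])
      case (1 k)
      then have "U x = a + 1 - k * int n" using Up(2) W_shift[OF U, of x k] by simp
      then have "k * int n \<le> - int n" using b mult_n_cases[of k] by linarith
      moreover have "x < y + k * int n" using tt tp 1 by simp
      moreover have "U y = a" using Up py by simp
      ultimately have "False"
        using cover_wrap[OF U xy(2,1) c] \<open>U x = a + 1 - k * int n\<close> by linarith
      then show ?thesis ..
    next
      case (2 k)
      then have "k * int n = 1" using Up py W_shift[OF U, of y k] by simp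
      then show ?thesis using mult_n_cases[of k] n2 by linarith
    next
      case 3
      then show ?thesis using cover_between[OF U xy(2,1) c, of q] tt tp qp py Up b by simp
    qed
  qed
  have tt: "t x y p < t x y q" using V pos_t[OF U xy(2)] by (simp add: asc_def p_def q_def)
  show ?thesis
  proof (cases p rule: t_cases[OF xy(2)])
    case (1 k)
    show ?thesis
    proof (cases q rule: t_cases[OF xy(2)])
      case (1 k')
      then have "U q \<simeq> U p" using W_ceq[OF U] \<open>p = x + k * int n\<close> by simp
      then show ?thesis using Up not_ceq_Suc by simp
    next
      case (2 k')
      then show ?thesis using tt 1 xy qp mult_n_cases[of "k' - k"] by (simp add: algebra_simps)
    next
      case 3 then show ?thesis using tt 1 xy qp by simp
    qed
  next
    case (2 k)
    have eq: "t (x + k * int n) (y + k * int n) = t x y" by (rule t_add_shift[OF xy(2)])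
    show ?thesis using goal_y[of "x + k * int n" "y + k * int n"] eq xy c tt 2 by simp
  next
    case 3
    show ?thesis
    proof (cases q rule: t_cases[OF xy(2)])
      case (1 k)
      have Uz: "U (p - k * int n) = a - k * int n" using W_shift[OF U, of p "-k"] Up by simp
      have Ux: "U x = a + 1 - k * int n" using W_shift[OF U, of x k] Up 1 by simp
      have lt: "x < p - k * int n" "p - k * int n < y" using tt qp 1 3 by simp_all
      have "U y \<noteq> U (p - k * int n)" using W_inj[OF U] lt by simp
      then show ?thesis using cover_between[OF U xy(2,1) c lt] cover_desc[OF U xy(2,1) c] Uz Ux
        by simp
    next
      case (2 k) then show ?thesis using tt 3 xy qp by simp
    next
      assume "\<not> q \<simeq> x" "\<not> q \<simeq> y" "t x y q = q"
      then show ?thesis using tt 3 qp by simp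
    qed
  qed
qed

section \<open>Marked covers under left multiplication by a simple reflection\<close>

lemma s_gt: assumes "c < s a c" shows "c \<simeq> a" "s a c = c + 1"
proof -
  have "c \<simeq> a \<and> s a c = c + 1"
    by (cases c a rule: s_cases) (use assms in auto)
  then show "c \<simeq> a" "s a c = c + 1" by auto
qed

lemma Ncov_lift:
  assumes "U \<in> W" "\<not> asc a U" "V \<in> Ncov c U" "asc a V"
  shows "V = s a \<circ> U" "c \<simeq> a" "pos U (c + 1) \<le> l" "l < pos U c" "pos V c \<le> l" "l < pos V (c + 1)"
proof -
  obtain i j where ij: "i \<le> l" "l < j" "\<not> i \<simeq> j" "V = U \<circ> t i j" "U j = c" "len U = Suc (len V)"
    "c < U i" using assms(3) by (rule NcovE) (rule that; assumption)
  have V: "V \<in> W" using assms Ncov_W by blast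
  have lt: "i < j" using ij by simp
  show eq: "V = s a \<circ> U"
    using cover_lift_eq[OF assms(1,2) lt ij(3)] ij assms(4) by simp
  have "V i = c" using ij(4,5) by simp
  then have "s a (U i) = c" using fun_cong[OF eq, of i] by simp
  then have Ui: "U i = s a c" by (metis s_s)
  then show "c \<simeq> a" using ij s_gt by simp
  have c1: "U i = c + 1" using Ui ij s_gt(2) by simp
  show "pos U (c + 1) \<le> l" "l < pos U c" "pos V c \<le> l" "l < pos V (c + 1)"
    using c1 ij W_pos_eq[OF assms(1), of _ _] W_pos_eq[OF V, of _ _]
    by (metis W_pos(2) assms(1), metis W_pos(2) assms(1),
        metis V W_pos(2) comp_apply t_i, metis V W_pos(2) comp_apply t_j)
qed

lemma Ncov_simple:
  assumes U: "U \<in> W" and d: "\<not> asc a U" and c: "c \<simeq> a" "pos U (c + 1) \<le> l" "l < pos U c"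
  shows "s a \<circ> U \<in> Ncov c U"
proof -
  have "s a = s c" using s_ceq[OF c(1)] by simp
  moreover have "U \<circ> t (pos U (c + 1)) (pos U c) = s c \<circ> U" "\<not> pos U (c + 1) \<simeq> pos U c"
    using comp_t_s[OF U] W_pos(1)[OF U] by auto
  moreover have "len U = Suc (len (s a \<circ> U))" using len_s_desc[OF U d] .
  ultimately show ?thesis unfolding Ncov_iff using U c W_pos(1)[OF U] by metis
qed

lemma Ncov_s_mono:
  assumes "v \<in> Ncov c u" "len (s a \<circ> u) + len v = len (s a \<circ> v) + len u"
  shows "s a \<circ> v \<in> Ncov (s a c) (s a \<circ> u)"
proof -
  obtain i j where ij: "i \<le> l" "l < j" "\<not> i \<simeq> j" "v = u \<circ> t i j" "u j = c" "len u = Suc (len v)"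
    "u \<in> W" using assms(1) by (rule NcovE) (rule that; assumption)
  have "len (s a \<circ> u) = Suc (len (s a \<circ> v))" using ij(6) assms(2) by linarith
  moreover have "s a \<circ> v = s a \<circ> u \<circ> t i j" using ij(4) by (simp add: comp_assoc)
  ultimately show ?thesis unfolding Ncov_iff using ij by auto
qed

text \<open>A cover of \<open>s a \<circ> u\<close> that keeps the descent at a comes from a cover
  of u by left multiplication. One that loses it is u itself by the lifting property, and u is a
  marked cover only if l separates the two values exchanged.\<close>

lemma Ncov_s_asc:
  assumes u: "u \<in> W" and a: "asc a u"
  shows "Ncov c (s a \<circ> u) = (\<lambda>v. s a \<circ> v) ` {v \<in> Ncov (s a c) u. asc a v} \<union>
    (if c \<simeq> a \<and> pos u c \<le> l \<and> l < pos u (c + 1) then {u} else {})" (is "?A = ?B \<union> ?C")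
proof -
  have U: "s a \<circ> u \<in> W" "\<not> asc a (s a \<circ> u)" using u a by (simp_all add: asc_s)
  have 1: "s a \<circ> v \<in> ?A" if "v \<in> Ncov (s a c) u" "asc a v" for v
    using Ncov_s_mono[OF that(1), of a] len_s_asc[OF u a] len_s_asc[of v a] Ncov_W(1)[OF that(1)]
      that by simp
  have 2: "u \<in> ?A" if c: "c \<simeq> a" "pos u c \<le> l" "l < pos u (c + 1)"
  proof -
    have "s a c = c + 1" "s a (c + 1) = c" using s_ceq[OF c(1)] by (metis s_i)+
    then show ?thesis using Ncov_simple[OF U c(1)] c(2,3) u by (simp add: pos_s)
  qed
  have 3: "V \<in> ?B \<union> ?C" if V: "V \<in> ?A" for V
  proof (cases "asc a V")
    case True
    have "V = u" using Ncov_lift(1)[OF U V True] by simp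
    moreover have "c \<simeq> a \<and> pos V c \<le> l \<and> l < pos V (c + 1)"
      using Ncov_lift(2,5,6)[OF U V True] by simp
    ultimately show ?thesis by simp
  next
    case False
    have VW: "V \<in> W" using V Ncov_W by blast
    have "s a \<circ> V \<in> Ncov (s a c) (s a \<circ> (s a \<circ> u))"
      using Ncov_s_mono[OF V, of a] len_s_asc[OF u a] len_s_desc[OF VW False] by simp
    then have "s a \<circ> V \<in> {v \<in> Ncov (s a c) u. asc a v}" using VW False by (simp add: asc_s)
    then have "s a \<circ> (s a \<circ> V) \<in> ?B" by (rule imageI)
    then show ?thesis by simp
  qed
  show ?thesis
  proof (intro equalityI subsetI)
    fix V assume "V \<in> ?B \<union> ?C"
    then consider "V \<in> ?B" | "V = u" "c \<simeq> a \<and> pos u c \<le> l \<and> l < pos u (c + 1)"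
      by (auto split: if_splits)
    then show "V \<in> ?A" using 1 2 by cases blast+
  qed (rule 3)
qed

lemma Ncov_desc:
  assumes u: "u \<in> W" and a: "\<not> asc a u"
  shows "{v \<in> Ncov c u. asc a v} = (if c \<simeq> a \<and> pos u (c + 1) \<le> l \<and>
      l < pos u c then {s a \<circ> u} else {})"
proof -
  have "asc a (s a \<circ> u)" using u a by (simp add: asc_s)
  then show ?thesis using Ncov_lift(1-4)[OF u a] Ncov_simple[OF u a] by (auto split: if_splits)
qed

definition N :: "int \<Rightarrow> ((int \<Rightarrow> int) \<Rightarrow> 'r::comm_ring_1) \<Rightarrow> (int \<Rightarrow> int) \<Rightarrow> 'r" where
  "N a f u = (\<Sum>v\<in>Ncov a u. f v)"

text \<open>The index shift by left multiplication: \<open>A\<^sub>a A\<^sub>u\<close> is \<open>A\<^sub>v\<close> with \<open>v = s\<^sub>a u\<close>, or \<open>0\<close>.\<close>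

definition L :: "int \<Rightarrow> ((int \<Rightarrow> int) \<Rightarrow> 'r::comm_ring_1) \<Rightarrow> (int \<Rightarrow> int) \<Rightarrow> 'r" where
  "L a f u = (if asc a u then f (s a \<circ> u) else 0)"

definition theta :: "int \<Rightarrow> (int \<Rightarrow> int) \<Rightarrow> 'r::comm_ring_1" where
  "theta a u = of_bool (pos u a \<le> l)"

lemma N_L: "N c (L a f) u = (\<Sum>v\<in>{v \<in> Ncov c u. asc a v}. f (s a \<circ> v))"
  unfolding N_def L_def by (rule sum.mono_neutral_cong_right) (auto simp: finite_Ncov)

text \<open>Left multiplication turns the marking c into \<open>s a c\<close>. The corrections come
  from the simple cover between u and \<open>s a \<circ> u\<close>: it has to be added when a is an
  ascent of u, and to be removed when a is a descent.\<close>

lemma L_N: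
  assumes u: "u \<in> W"
  shows "L a (N c f) u = N (s a c) (L a f) u
    + (if c \<simeq> a \<and> pos u c \<le> l \<and> l < pos u (c + 1) then f u else 0)
    - (if c \<simeq> a + 1 \<and> pos u c \<le> l \<and> l < pos u (c - 1) then f u else 0)"
proof (cases "asc a u")
  case True
  have z: "\<not> (c \<simeq> a + 1 \<and> pos u c \<le> l \<and> l < pos u (c - 1))"
  proof
    assume h: "c \<simeq> a + 1 \<and> pos u c \<le> l \<and> l < pos u (c - 1)"
    then have "asc (c - 1) u"
      using asc_ceq[OF u, of "c - 1" a] ceq_Suc_iff[of "c - 1" a] True by simp
    then show False using h by (simp add: asc_def)
  qed
  let ?B = "{v \<in> Ncov (s a c) u. asc a v}"
  have inj: "inj_on (\<lambda>v. s a \<circ> v) ?B"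
    by (rule inj_onI) (metis s_comp_s(2))
  have nin: "u \<notin> (\<lambda>v. s a \<circ> v) ` ?B"
  proof
    assume "u \<in> (\<lambda>v. s a \<circ> v) ` ?B"
    then obtain v where "v \<in> ?B" "u = s a \<circ> v" by blast
    then show False using asc_s[of v a] Ncov_W(1)[of v "s a c" u] True by simp
  qed
  have fin: "finite ((\<lambda>v. s a \<circ> v) ` ?B)" using finite_Ncov by simp
  have "L a (N c f) u = (\<Sum>v\<in>Ncov c (s a \<circ> u). f v)" using True by (simp add: L_def N_def)
  also have "\<dots> = (\<Sum>v\<in>(\<lambda>v. s a \<circ> v) ` ?B. f v) + (if c \<simeq> a \<and> pos u c \<le> l \<and>
      l < pos u (c + 1) then f u else 0)"
    unfolding Ncov_s_asc[OF u True] using fin nin by (simp add: add.commute)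
  also have "(\<Sum>v\<in>(\<lambda>v. s a \<circ> v) ` ?B. f v) = N (s a c) (L a f) u"
    unfolding N_L by (simp add: sum.reindex[OF inj] comp_def[of f])
  finally show ?thesis unfolding if_not_P[OF z] by simp
next
  case False
  have z: "\<not> (c \<simeq> a \<and> pos u c \<le> l \<and> l < pos u (c + 1))"
  proof
    assume h: "c \<simeq> a \<and> pos u c \<le> l \<and> l < pos u (c + 1)"
    then have "\<not> asc c u" using asc_ceq[OF u, of c a] False by simp
    then show False using h by (simp add: asc_def)
  qed
  \<comment> \<open>On the right the marking is \<open>s a c\<close>. It is congruent to a exactly
    if c is congruent to a + 1, and then it equals c - 1.\<close>
  have e: "(s a c \<simeq> a \<and> pos u (s a c + 1) \<le> l \<and> l < pos u (s a c)) \<longleftrightarrow>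
      (c \<simeq> a + 1 \<and> pos u c \<le> l \<and> l < pos u (c - 1))"
  proof (cases "c \<simeq> a + 1")
    case True
    then have "c - 1 \<simeq> a" using ceq_Suc_iff[of "c - 1" a] by simp
    then have "s a c = c - 1" using s_ceq[of "c - 1" a] s_i(2)[of "c - 1"] by simp
    then show ?thesis using True \<open>c - 1 \<simeq> a\<close> by simp
  next
    case F: False
    have "s a c \<simeq> a \<longleftrightarrow> c \<simeq> a + 1" using W_ceq[OF s_W[of a], of c "a + 1"] by simp
    then show ?thesis using F by simp
  qed
  have "N (s a c) (L a f) u = (if c \<simeq> a + 1 \<and> pos u c \<le> l \<and> l < pos u (c - 1) then f u else 0)"
    unfolding N_L Ncov_desc[OF u False] e by simp
  then show ?thesis using False unfolding if_not_P[OF z] by (simp add: L_def)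
qed

section \<open>Relations between covers marked a and a + 1\<close>

lemma theta_N: "theta a u * N a f u = 0"
  unfolding N_def theta_def using Ncov_pos(2)[of _ a u]
    by (cases "pos u a \<le> l") (auto intro: sum.neutral)

text \<open>The value a + 1 moves only if it stands at a translate of the left position i. At i
  itself, the cover is \<open>s a \<circ> u\<close>; at an earlier translate,
  \<open>cover_wrap\<close> keeps both its old and its new position at most l.\<close>

lemma Ncov_pos_Suc:
  assumes "v \<in> Ncov a u"
  shows "v = s a \<circ> u \<and> pos u (a + 1) \<le> l \<and> l < pos v (a + 1) \<or>
    v \<noteq> s a \<circ> u \<and> (pos v (a + 1) \<le> l \<longleftrightarrow> pos u (a + 1) \<le> l)"
proof -
  obtain i j where ij: "i \<le> l" "l < j" "\<not> i \<simeq> j" "v = u \<circ> t i j" "u j = a"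
    and u: "u \<in> W" and v: "v \<in> W" and gt: "a < u i" and wrap: "j < i + int n \<or> u i < a + int n"
    and pj: "pos u a = j"
    using assms by (rule NcovE) (rule that; assumption)
  define p where "p = pos u (a + 1)"
  have up: "u p = a + 1" using W_pos(1)[OF u] by (simp add: p_def)
  have pv: "pos v (a + 1) = t i j p" using pos_t[OF u ij(3)] ij(4) by (simp add: p_def)
  have ps: "pos (s a \<circ> u) (a + 1) = j" using pj u by (simp add: pos_s)
  show ?thesis
  proof (cases p rule: t_cases[OF ij(3)])
    case (1 k)
    then have ui: "u i = a + 1 - k * int n" using up W_shift[OF u, of i k] by simp
    consider "k * int n = 0" | "k * int n \<le> - int n" using mult_n_cases[of k] ui gt n2 by linarith
    then show ?thesis
    proof cases
      case A: 1
      then have "u i = a + 1" using ui by linarith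
      then have "v = s a \<circ> u" using comp_t_s(2)[OF u _ ij(5), of i] ij(4) by simp
      moreover have "p = i" "pos v (a + 1) = j" using A 1 pv by auto
      ultimately show ?thesis using ij p_def by simp
    next
      case 2
      then have "p \<le> l" "pos v (a + 1) \<le> l" using 1 pv wrap ui ij by linarith+
      then show ?thesis using ps ij p_def by auto
    qed
  next
    case (2 k)
    then have "k * int n = 1" using up ij W_shift[OF u, of j k] by simp
    then show ?thesis using mult_n_cases[of k] n2 by linarith
  next
    case 3
    have "p \<noteq> j" using up ij by auto
    then have "v \<noteq> s a \<circ> u" using ps pv 3 by auto
    then show ?thesis using pv 3 p_def by simp
  qed
qed

lemma N_theta_Suc:
  assumes u: "u \<in> W"
  shows "N a (\<lambda>v. theta (a + 1) v * L a f v) u = theta (a + 1) u * N a (L a f) u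
    - (if pos u (a + 1) \<le> l \<and> l < pos u a then f u else 0)"
proof (cases "pos u (a + 1) \<le> l \<and> l < pos u a")
  case True
  then have d: "\<not> asc a u" by (simp add: asc_def)
  have m: "s a \<circ> u \<in> Ncov a u" using Ncov_simple[OF u d] True by simp
  have Lf: "L a f (s a \<circ> u) = f u" using d u by (simp add: L_def asc_s)
  have "pos (s a \<circ> u) (a + 1) = pos u a" using u by (simp add: pos_s)
  then have t0: "theta (a + 1) (s a \<circ> u) = (0::'a)" using True by (simp add: theta_def)
  have "(\<Sum>v\<in>Ncov a u - {s a \<circ> u}. theta (a + 1) v * L a f v) =
      (\<Sum>v\<in>Ncov a u - {s a \<circ> u}. theta (a + 1) u * L a f v)"
    by (rule sum.cong) (use Ncov_pos_Suc in \<open>auto simp: theta_def\<close>)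
  then have "N a (\<lambda>v. theta (a + 1) v * L a f v) u =
      theta (a + 1) u * (\<Sum>v\<in>Ncov a u - {s a \<circ> u}. L a f v)"
    using t0 by (simp add: N_def sum.remove[OF finite_Ncov m] sum_distrib_left)
  moreover have "N a (L a f) u = f u + (\<Sum>v\<in>Ncov a u - {s a \<circ> u}. L a f v)"
    using Lf by (simp add: N_def sum.remove[OF finite_Ncov m])
  moreover have "theta (a + 1) u = (1::'a)" using True by (simp add: theta_def)
  ultimately show ?thesis using True by simp
next
  case False
  have "v \<noteq> s a \<circ> u" if "v \<in> Ncov a u" for v
    using that Ncov_pos_Suc[OF that] Ncov_pos[OF that] False by auto
  then have "theta (a + 1) v = (theta (a + 1) u :: 'a)" if "v \<in> Ncov a u" for v
    using that Ncov_pos_Suc[OF that] by (auto simp: theta_def)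
  then show ?thesis unfolding if_not_P[OF False] by (simp add: N_def sum_distrib_left)
qed

text \<open>L leaves only covers v with ascent a. In them the value a stands before the marked value
  a + 1, hence at most at l, and it already did so in u.\<close>

lemma N_Suc_theta:
  "N (a + 1) (\<lambda>v. theta a v * L a f v) u = theta a u * N (a + 1) (L a f) u"
proof -
  have "theta a v * L a f v = theta a u * L a f v" if v: "v \<in> Ncov (a + 1) u" for v
  proof (cases "asc a v")
    case True
    obtain i j where ij: "i \<le> l" "l < j" "\<not> i \<simeq> j" "v = u \<circ> t i j" "u j = a + 1"
      and u: "u \<in> W" and pv: "pos v (a + 1) = i"
      using v by (rule NcovE) (rule that; assumption)
    have le: "pos v a \<le> l" using True pv ij by (simp add: asc_def)
    define p where "p = pos u a"
    have pva: "pos v a = t i j p" using pos_t[OF u ij(3)] ij(4) by (simp add: p_def)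
    have "p \<le> l"
    proof (cases p rule: t_cases[OF ij(3)])
      case (1 k) then show ?thesis using pva le ij by simp
    next
      case (2 k)
      then have "u p = a + 1 + k * int n" using W_shift[OF u, of j k] ij by simp
      then have "k * int n = - 1" using W_pos(1)[OF u, of a] p_def by simp
      then show ?thesis using mult_n_cases[of k] n2 by linarith
    next
      case 3 then show ?thesis using pva le by simp
    qed
    then show ?thesis using le by (simp add: theta_def p_def)
  qed (simp add: L_def)
  then show ?thesis by (simp add: N_def sum_distrib_left)
qed

text \<open>After a cover marked a + 1, with an ascent at a, left multiplication puts a + 1 in the
  place of a, at most at l, where it cannot be marked again.\<close>

lemma N_Suc_L_N_Suc: "N (a + 1) (L a (N (a + 1) f)) u = 0"
proof -
  have "L a (N (a + 1) f) v = 0" if v: "v \<in> Ncov (a + 1) u" for v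
  proof (cases "asc a v")
    case True
    then have "pos v a \<le> l" using Ncov_pos(1)[OF v] by (simp add: asc_def)
    then have "pos (s a \<circ> v) (a + 1) \<le> l" using Ncov_W(1)[OF v] by (simp add: pos_s)
    then have "Ncov (a + 1) (s a \<circ> v) = {}" using Ncov_pos(2) by fastforce
    then show ?thesis by (simp add: L_def N_def)
  qed (simp add: L_def)
  then show ?thesis by (simp add: N_def)
qed

text \<open>The second cover must use the same left position i. A position further left would pass
  over the value a + 1, now at i. At one further right, the first cover forces a value above b and
  the second a value below \<open>s a b\<close>; this would require \<open>s a\<close> to reverse
  the order, hence b to be a translate of a, which puts i to the right of j. Translates of i and j
  are excluded by \<open>wrap\<close>.\<close>

lemma Ncov_return:
  assumes v: "v \<in> Ncov a u" and l: "l < pos u (a + 1)" and w: "w \<in> Ncov a (s a \<circ> v)"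
  shows "w = v"
proof -
  obtain i j where ij: "i \<le> l" "l < j" "\<not> i \<simeq> j" "v = u \<circ> t i j" "u j = a"
    and u: "u \<in> W" and vW: "v \<in> W" and gt: "a < u i"
    and btw: "\<forall>z. i < z \<and> z < j \<longrightarrow> \<not> (a < u z \<and> u z < u i)"
    and wrap: "j < i + int n \<or> u i < a + int n" and pj: "pos u a = j" and pv: "pos v a = i"
    using v by (rule NcovE) (rule that; assumption)
  let ?U = "s a \<circ> v"
  obtain i2 q where iq: "i2 \<le> l" "l < q" "\<not> i2 \<simeq> q" "w = ?U \<circ> t i2 q" "?U q = a"
    and U: "?U \<in> W" and gt2: "a < ?U i2"
    and btw2: "\<forall>z. i2 < z \<and> z < q \<longrightarrow> \<not> (a < ?U z \<and> ?U z < ?U i2)"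
    and pq: "pos ?U a = q"
    using w by (rule NcovE) (rule that; assumption)
  define b where "b = u i"
  define p where "p = pos u (a + 1)"
  have up: "u p = a + 1" using W_pos(1)[OF u] by (simp add: p_def)
  have pl: "l < p" using l by (simp add: p_def)
  have b: "a + 1 < b"
  proof -
    have "b \<noteq> a + 1" using up pl ij W_inj[OF u, of i p] by (auto simp: b_def)
    then show ?thesis using gt by (simp add: b_def)
  qed
  have Ui: "?U i = a + 1" using ij by simp
  have Uj: "?U j = s a b" using ij by (simp add: b_def)
  have sb: "s a b \<le> b + 1" "b - 1 \<le> s a b" by (cases b a rule: s_cases, auto)+
  have "t i j p = p"
  proof (cases p rule: t_cases[OF ij(3)])
    case (1 k)
    then have "b = a + 1 - k * int n" using W_shift[OF u, of i k] up by (simp add: b_def)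
    then have "k * int n \<le> 0" using b by linarith
    then show ?thesis using 1 pl ij by linarith
  next
    case (2 k)
    then have "k * int n = 1" using up ij W_shift[OF u, of j k] by simp
    then show ?thesis using mult_n_cases[of k] n2 by linarith
  qed
  then have "pos v (a + 1) = p" using pos_t[OF u ij(3)] ij(4) by (simp add: p_def)
  then have qp: "q = p" using pq vW by (simp add: pos_s)
  have jq: "j < q"
    using spec[OF btw, of p] pl ij up b qp W_inj[OF u, of j p]
      by (cases "p < j"; cases "p = j") (auto simp: b_def)
  show ?thesis
  proof (cases i2 i rule: linorder_cases)
    case equal
    then have "w = ?U \<circ> t i q" using iq(4) by simp
    also have "\<dots> = s a \<circ> ?U" by (rule comp_t_s(2)[OF U Ui iq(5)])
    finally show ?thesis by (simp only: s_comp_s(2))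
  next
    case less
    then have "?U i2 \<le> a + 1" using spec[OF btw2, of i] ij iq Ui by force
    then have "?U i2 = ?U i" using gt2 Ui by simp
    then show ?thesis using W_inj[OF U] less by simp
  next
    case greater
    have "?U i2 \<noteq> ?U i" "?U i2 \<noteq> ?U j" unfolding W_inj[OF U] using greater ij(2) iq(1) by linarith+
    then have b2: "a + 1 < ?U i2" and ne: "?U i2 \<noteq> s a b" using gt2 Ui Uj by auto
    have "\<not> (a < s a b \<and> s a b < ?U i2)" using spec[OF btw2, of j] ij iq jq Uj by simp
    then have less: "?U i2 < s a b" using ne sb b by linarith
    have "False"
    proof (cases i2 rule: t_cases[OF ij(3)])
      case (1 k)
      then have "int n \<le> k * int n" using greater mult_n_cases[of k] n2 by linarith
      then have "b < a + int n" using wrap 1 ij iq by (simp add: b_def)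
      moreover have "?U i2 = a + 1 + k * int n" using 1 W_shift[OF U, of i k] Ui by simp
      ultimately show False using less sb \<open>int n \<le> k * int n\<close> by linarith
    next
      case (2 k)
      then have kn: "k * int n \<le> - int n" using ij iq mult_n_cases[of k] n2 by linarith
      then have "b < a + int n" using wrap 2 greater by (simp add: b_def)
      moreover have "?U i2 = s a b + k * int n" using 2 W_shift[OF U, of j k] Uj by simp
      ultimately show False using b2 sb kn by linarith
    next
      case 3
      then have Ui2: "?U i2 = s a (u i2)" using ij by simp
      have "s a (u i2) \<le> u i2 + 1" by (cases "u i2" a rule: s_cases) auto
      then have "a < u i2" using b2 Ui2 by linarith
      then have "b \<le> u i2" using spec[OF btw, of i2] greater ij iq by (simp add: b_def)
      moreover have "b \<noteq> u i2" using W_inj[OF u] greater by (auto simp: b_def)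
      ultimately have "b < u i2" by simp
      moreover have "\<not> s a b < s a (u i2)" using less Ui2 by simp
      ultimately have "b \<simeq> a" using s_mono[of b "u i2" a] by blast
      then obtain k where k: "b = a + k * int n" by (rule ceqE)
      then have "u i = u (j + k * int n)" using W_shift[OF u, of j k] ij by (simp add: b_def)
      then have "i = j + k * int n" using W_inj[OF u] by blast
      then show False using k b ij by linarith
    qed
    then show ?thesis ..
  qed
qed

text \<open>If a + 1 stands at most at l, every cover other than \<open>s a \<circ> u\<close> leaves
  it there, and left multiplication then puts a where it cannot be marked. If a + 1 stands beyond l,
  each cover v contributes only the return to v itself.\<close>

lemma N_L_N: assumes u: "u \<in> W" shows "N a (L a (N a f)) u = N a f u"
proof (cases "pos u (a + 1) \<le> l")
  case le: True
  have emp: "Ncov a (s a \<circ> v) = {}" if "pos v (a + 1) \<le> l" "v \<in> W" for v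
    using that Ncov_pos(2)[of _ a "s a \<circ> v"] by (fastforce simp: pos_s)
  show ?thesis
  proof (cases "pos u a \<le> l")
    case True
    then have "Ncov a u = {}" using Ncov_pos(2) by fastforce
    then show ?thesis by (simp add: N_def)
  next
    case False
    then have d: "\<not> asc a u" using le by (simp add: asc_def)
    have m: "s a \<circ> u \<in> Ncov a u" using Ncov_simple[OF u d] le False by simp
    have "L a (N a f) v = 0" if "v \<in> Ncov a u" "v \<noteq> s a \<circ> u" for v
      using that Ncov_pos_Suc[OF that(1)] le emp[of v] Ncov_W(1)[OF that(1)]
        by (auto simp: L_def N_def)
    then have "N a (L a (N a f)) u = L a (N a f) (s a \<circ> u)"
      unfolding N_def[of a "L a (N a f)"] by (simp add: sum.remove[OF finite_Ncov m])
    then show ?thesis using d u by (simp add: L_def asc_s)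
  qed
next
  case False
  have "L a (N a f) v = f v" if v: "v \<in> Ncov a u" for v
  proof -
    have vW: "v \<in> W" using Ncov_W(1)[OF v] .
    have l: "l < pos v (a + 1)" using Ncov_pos_Suc[OF v] False by auto
    then have as: "asc a v" using Ncov_pos(1)[OF v] by (simp add: asc_def)
    have d: "\<not> asc a (s a \<circ> v)" using as vW by (simp add: asc_s)
    have "s a \<circ> (s a \<circ> v) \<in> Ncov a (s a \<circ> v)"
      using Ncov_simple[OF _ d, of a] vW l Ncov_pos(1)[OF v] by (simp add: pos_s)
    then have "Ncov a (s a \<circ> v) = {v}" using Ncov_return[OF v] False by auto
    then show ?thesis using as by (simp add: L_def N_def)
  qed
  then show ?thesis by (simp add: N_def)
qed

text \<open>On a box only the markings in \<^term>\<open>{lo..<hi}\<close> matter, which makes the infinite products over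
  all integers finite.\<close>

definition box :: "int \<Rightarrow> int \<Rightarrow> (int \<Rightarrow> int) set" where
  "box lo hi = {u \<in> W. (\<forall>x\<le>l. u x < hi) \<and> (\<forall>x>l. lo \<le> u x)}"

lemma box_pos: assumes "u \<in> box lo hi" shows "a < lo \<Longrightarrow> pos u a \<le> l" "hi \<le> a \<Longrightarrow> l < pos u a"
proof -
  have u: "u \<in> W" using assms by (simp add: box_def)
  show "a < lo \<Longrightarrow> pos u a \<le> l" "hi \<le> a \<Longrightarrow> l < pos u a"
    using assms W_pos(1)[OF u, of a] by (auto simp: box_def not_le[symmetric])
qed

text \<open>At positions up to l the exchange puts smaller values or values from further left,
  beyond l larger values or values from further right.\<close>

lemma box_Ncov: assumes "u \<in> box lo hi" "v \<in> Ncov c u" shows "v \<in> box lo hi" "lo \<le> c" "c < hi"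
proof -
  obtain i j where ij: "i \<le> l" "l < j" "\<not> i \<simeq> j" "v = u \<circ> t i j" "u j = c"
    and u: "u \<in> W" and v: "v \<in> W" and gt: "c < u i"
    using assms(2) by (rule NcovE) (rule that; assumption)
  show "lo \<le> c" "c < hi" using assms ij gt by (force simp: box_def)+
  have sh: "u (i + k * int n) = u i + k * int n" "u (j + k * int n) = c + k * int n" for k
    using W_shift[OF u] ij by auto
  have 1: "v x < hi" if "x \<le> l" for x
  proof (cases x rule: t_cases[OF ij(3)])
    case (1 k)
    have "u x < hi" using assms(1) that by (simp add: box_def)
    then show ?thesis using 1 ij(4) sh[of k] gt by simp
  next
    case (2 k)
    have "i + k * int n \<le> l" using 2 that ij by linarith
    then have "u (i + k * int n) < hi" using assms(1) by (simp add: box_def)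
    then show ?thesis using 2 ij(4) by simp
  next
    case 3 then show ?thesis using assms(1) that ij by (simp add: box_def)
  qed
  have 2: "lo \<le> v x" if "l < x" for x
  proof (cases x rule: t_cases[OF ij(3)])
    case (1 k)
    have "l < j + k * int n" using 1 that ij by linarith
    then have "lo \<le> u (j + k * int n)" using assms(1) by (simp add: box_def)
    then show ?thesis using 1 ij(4) by simp
  next
    case (2 k)
    have "lo \<le> u x" using assms(1) that by (simp add: box_def)
    then show ?thesis using 2 ij(4) sh[of k] gt by simp
  next
    case 3 then show ?thesis using assms(1) that ij by (simp add: box_def)
  qed
  show "v \<in> box lo hi" using v 1 2 by (simp add: box_def)
qed

lemma box_exists: assumes "finite S" "S \<subseteq> W" shows "\<exists>lo hi. S \<subseteq> box lo hi"
proof -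
  have "\<forall>u\<in>S. \<exists>B. \<forall>x. \<bar>u x - x\<bar> \<le> B" using W_bounded assms by blast
  then obtain B where B: "\<And>u x. u \<in> S \<Longrightarrow> \<bar>u x - x\<bar> \<le> B u" by metis
  define M where "M = Max (insert 0 (B ` S))"
  have M: "\<bar>u x - x\<bar> \<le> M" if "u \<in> S" for u x
  proof -
    have "B u \<le> M" unfolding M_def using assms(1) that by (intro Max_ge) auto
    then show ?thesis using B[OF that, of x] by linarith
  qed
  have "S \<subseteq> box (l - M) (l + M + 1)"
  proof
    fix u assume u: "u \<in> S"
    have "u x < l + M + 1" if "x \<le> l" for x using M[OF u, of x] that by linarith
    moreover have "l - M \<le> u x" if "l < x" for x using M[OF u, of x] that by linarith
    ultimately show "u \<in> box (l - M) (l + M + 1)" using u assms by (auto simp: box_def)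
  qed
  then show ?thesis by blast
qed

lemma box_mono: "lo' \<le> lo \<Longrightarrow> hi \<le> hi' \<Longrightarrow> box lo hi \<subseteq> box lo' hi'"
  by (force simp: box_def)

end

section \<open>Products of marking operators\<close>

text \<open>In the application \<open>\<tau>\<close> is the formal variable, \<open>e\<close> the weights \<open>e\<^sub>j\<close>, and \<open>\<sigma>\<close> the action of
  the simple reflections on the coefficients.\<close>

locale strip_algebra = strips +
  fixes \<tau> :: "'r::comm_ring_1" and e g root_inv :: "int \<Rightarrow> 'r" and \<sigma> :: "int \<Rightarrow> 'r \<Rightarrow> 'r"
  assumes e_ceq: "x \<simeq> y \<Longrightarrow> e x = e y"
    and \<sigma>_ceq: "x \<simeq> y \<Longrightarrow> \<sigma> x = \<sigma> y"
    and root_inv: "root_inv i * (e i - e (i + 1)) = 1"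
    and g: "g j * (1 - \<tau> * e j) = 1"
    and \<sigma>_add: "\<sigma> i (p + q) = \<sigma> i p + \<sigma> i q"
    and \<sigma>_mult: "\<sigma> i (p * q) = \<sigma> i p * \<sigma> i q"
    and \<sigma>_1: "\<sigma> i 1 = 1"
    and \<sigma>_\<tau>: "\<sigma> i \<tau> = \<tau>"
    and \<sigma>_e: "\<sigma> i (e j) = e (s i j)"
begin

lemma inv_unique: "p * q = 1 \<Longrightarrow> r * q = 1 \<Longrightarrow> p = (r :: 'r)"
  by (metis mult.assoc mult.commute mult.right_neutral)

lemma \<sigma>_0: "\<sigma> i 0 = 0"
  using \<sigma>_add[of i 0 0] by simp

lemma \<sigma>_diff: "\<sigma> i (p - q) = \<sigma> i p - \<sigma> i q"
  using \<sigma>_add[of i "p - q" q] by (simp add: algebra_simps)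

lemma \<sigma>_sum: "\<sigma> i (\<Sum>v\<in>S. h v) = (\<Sum>v\<in>S. \<sigma> i (h v))"
  by (induction S rule: infinite_finite_induct) (auto simp: \<sigma>_0 \<sigma>_add)

lemma \<sigma>_prod: "\<sigma> i (\<Prod>v\<in>S. h v) = (\<Prod>v\<in>S. \<sigma> i (h v))"
  by (induction S rule: infinite_finite_induct) (auto simp: \<sigma>_1 \<sigma>_mult)

lemma root_inv_ceq: assumes "x \<simeq> y" shows "root_inv x = root_inv y"
proof -
  have "x + 1 \<simeq> y + 1" using assms ceq_Suc_iff by simp
  then show ?thesis using root_inv[of x] root_inv[of y] e_ceq assms by (metis inv_unique)
qed

lemma \<sigma>_g: "\<sigma> i (g j) = g (s i j)"
proof (rule inv_unique)
  show "\<sigma> i (g j) * (1 - \<tau> * e (s i j)) = 1"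
    using arg_cong[OF g[of j], of "\<sigma> i"] by (simp add: \<sigma>_mult \<sigma>_diff \<sigma>_1 \<sigma>_\<tau> \<sigma>_e)
qed (rule g)

text \<open>Left multiplication by A_a on coefficient functions of the twisted group algebra;
  \<open>divdiff\<close> is its scalar analogue, and \<open>A_mult\<close> the twisted Leibniz
  rule.\<close>

definition A :: "int \<Rightarrow> ((int \<Rightarrow> int) \<Rightarrow> 'r) \<Rightarrow> (int \<Rightarrow> int) \<Rightarrow> 'r" where
  "A a y x = root_inv a * (y x - \<sigma> a (y (s a \<circ> x)))"

definition divdiff :: "int \<Rightarrow> 'r \<Rightarrow> 'r" where
  "divdiff a q = root_inv a * (q - \<sigma> a q)"

lemma A_mult: "A a (\<lambda>x. q * y x) x = \<sigma> a q * A a y x + divdiff a q * y x"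
  by (simp add: A_def divdiff_def \<sigma>_mult algebra_simps)

lemma A_add: "A a (\<lambda>x. y x + z x) x = A a y x + A a z x"
  by (simp add: A_def \<sigma>_add algebra_simps)

lemma A_N: "A a (\<lambda>x. N c (\<lambda>v. f v x) u) x = N c (\<lambda>v. A a (f v) x) u"
  by (simp add: A_def N_def \<sigma>_sum sum_distrib_left[symmetric] sum_subtractf)

text \<open>The coefficients \<open>f u x\<close> of \<open>x\<close> in \<open>A\<^sub>u\<close> satisfy this for every \<open>a\<close>.\<close>

definition equivariant :: "int \<Rightarrow> ((int \<Rightarrow> int) \<Rightarrow> (int \<Rightarrow> int) \<Rightarrow> 'r) \<Rightarrow> bool" where
  "equivariant a f \<longleftrightarrow> (\<forall>u\<in>W. \<forall>x\<in>W. A a (f u) x = L a (\<lambda>v. f v x) u)"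

text \<open>As 1 + \<tau> g_a e_a = g_a, the diagonal entry is \<open>g a\<close> if the value a
  stands at most at l, and 1 otherwise.\<close>

definition K :: "int \<Rightarrow> ((int \<Rightarrow> int) \<Rightarrow> (int \<Rightarrow> int) \<Rightarrow> 'r) \<Rightarrow> (int \<Rightarrow> int) \<Rightarrow> (int \<Rightarrow> int) \<Rightarrow> 'r" where
  "K a f u x = (1 + \<tau> * g a * e a * theta a u) * f u x + \<tau> * g a * N a (\<lambda>v. f v x) u"

lemma N_add: "N c (\<lambda>v. p v + q v) u = N c p u + N c q u"
  by (simp add: N_def sum.distrib)
lemma N_mult: "N c (\<lambda>v. k * p v) u = k * N c p u"
  by (simp add: N_def sum_distrib_left)
lemma L_add: "L c (\<lambda>v. p v + q v) u = L c p u + L c q u"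
  by (simp add: L_def)
lemma L_mult: "L c (\<lambda>v. k * p v) u = k * L c p u"
  by (simp add: L_def)
lemma L_theta: "u \<in> W \<Longrightarrow> L a (\<lambda>v. theta c v * p v) u = theta (s a c) u * L a p u"
  by (simp add: L_def theta_def pos_s)
lemma N_cong: "(\<And>v. v \<in> Ncov c u \<Longrightarrow> p v = q v) \<Longrightarrow> N c p u = N c q u"
  by (simp add: N_def)

lemma equivD: "equivariant a f \<Longrightarrow> u \<in> W \<Longrightarrow> x \<in> W \<Longrightarrow> A a (f u) x = L a (\<lambda>v. f v x) u"
  by (simp add: equivariant_def)

lemma equivariant_N:
  assumes "equivariant a f" "x \<in> W"
  shows "A a (\<lambda>x. N c (\<lambda>v. f v x) u) x = N c (L a (\<lambda>v. f v x)) u"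
  unfolding A_N by (rule N_cong) (use assms equivD Ncov_W(1) in blast)

text \<open>Here \<open>s a\<close> fixes c, so the coefficients of K are invariant, their divided
  differences vanish, and \<open>L_N\<close> has no corrections.\<close>

lemma equivariant_K:
  assumes f: "equivariant a f" and c: "\<not> c \<simeq> a" "\<not> c \<simeq> a + 1"
  shows "equivariant a (K c f)"
  unfolding equivariant_def
proof (intro ballI)
  fix u x assume u: "u \<in> W" and x: "x \<in> W"
  let ?F = "\<lambda>v. f v x"
  have sc: "s a c = c" using c by (rule s_other)
  let ?p = "1 + \<tau> * g c * e c * theta c u" and ?q = "\<tau> * g c"
  have \<sigma>: "\<sigma> a ?p = ?p" "\<sigma> a ?q = ?q" 
    by (simp_all add: \<sigma>_add \<sigma>_mult \<sigma>_1 \<sigma>_\<tau> \<sigma>_e \<sigma>_g sc theta_def \<sigma>_0)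
  then have divdiff: "divdiff a ?p = 0" "divdiff a ?q = 0" by (simp_all add: divdiff_def)
  have "A a (K c f u) x = A a (\<lambda>x. ?p * f u x + ?q * N c (\<lambda>v. f v x) u) x"
    by (simp add: K_def[abs_def])
  also have "\<dots> = ?p * L a ?F u + ?q * N c (L a ?F) u"
    unfolding A_add A_mult \<sigma> divdiff equivD[OF f u x] equivariant_N[OF f x] by simp
  also have "\<dots> = L a (\<lambda>v. K c f v x) u"
  proof -
    have "L a (\<lambda>v. K c f v x) u =
        L a (\<lambda>v. ?F v + (?q * e c * (theta c v * ?F v) + ?q * N c ?F v)) u"
      by (simp add: K_def algebra_simps)
    also have "\<dots> = L a ?F u + (?q * e c * (theta c u * L a ?F u) + ?q * N c (L a ?F) u)"
      unfolding L_add L_mult L_theta[OF u] sc using L_N[OF u, of a c ?F] c sc by simp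
    finally show ?thesis by (simp add: algebra_simps)
  qed
  finally show "A a (K c f u) x = L a (\<lambda>v. K c f v x) u" .
qed

text \<open>The product K_{a+1} K_a expands into five terms. Applying \<open>A a\<close> produces
  divided differences of their coefficients, applying L the corrections of \<open>L_N\<close>; the
  relations between covers marked a and a + 1 make the two agree in each of the four cases for the
  sides of a and a + 1.\<close>

lemma equivariant_K_K:
  assumes f: "equivariant a f"
  shows "equivariant a (K (a + 1) (K a f))"
  unfolding equivariant_def
proof (intro ballI)
  fix u x assume u: "u \<in> W" and x: "x \<in> W"
  let ?F = "\<lambda>v. f v x"
  define y z G H where "y = e a" and "z = e (a + 1)" and "G = g a" and "H = g (a + 1)"
  note defs = y_def z_def G_def H_def
  have G: "G * (1 - \<tau> * y) = 1" and H: "H * (1 - \<tau> * z) = 1" and I: "root_inv a * (y - z) = 1"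
    using g root_inv by (simp_all add: defs)
  have G1: "1 + \<tau> * G * y = G" and H1: "1 + \<tau> * H * z = H"
    using G H by (simp_all add: algebra_simps)
  have \<sigma>s: "\<sigma> a y = z" "\<sigma> a z = y" "\<sigma> a G = H" "\<sigma> a H = G"
    by (simp_all add: defs \<sigma>_e \<sigma>_g)
  \<comment> \<open>The scalar identity behind the cancellation: the divided difference of one
    geometric factor is the product of both factors, with a factor \<tau>.\<close>
  have GH: "root_inv a * (G - H) = \<tau> * G * H"
  proof -
    have "G - H = \<tau> * G * H * (y - z)"
    proof -
      have "G - H = G * (H * (1 - \<tau> * z)) - H * (G * (1 - \<tau> * y))" by (simp only: G H mult_1_right)
      also have "\<dots> = \<tau> * G * H * (y - z)" by (simp add: algebra_simps)
      finally show ?thesis .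
    qed
    then have "root_inv a * (G - H) = root_inv a * (\<tau> * G * H * (y - z))" by (rule arg_cong)
    also have "\<dots> = \<tau> * G * H * (root_inv a * (y - z))" by (simp only: mult.assoc mult.left_commute)
    finally have "root_inv a * (G - H) = \<tau> * G * H * (root_inv a * (y - z))" .
    then show ?thesis by (simp only: I mult_1_right)
  qed
  let ?k = "\<tau> * G" and ?k' = "\<tau> * H"
  define \<theta> \<theta>' :: 'r where "\<theta> = theta a u" and "\<theta>' = theta (a + 1) u"
  \<comment> \<open>The coefficients, in the expansion \<open>exp\<close>, of f, N_a f, N_{a+1} f,
    N_{a+1} \<theta>_a f and N_{a+1} N_a f.\<close>
  let ?c1 = "(1 + ?k' * z * \<theta>') * (1 + ?k * y * \<theta>)" and ?c2 = "(1 + ?k' * z * \<theta>') * ?k"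
    and ?c3 = "?k'" and ?c4 = "?k' * ?k * y" and ?c5 = "?k' * ?k"
  define P Q n1 n2 n3 n4 m1 m2 where "P = ?F u" and "Q = L a ?F u" and "n1 = N a ?F u"
    and "n2 = N (a + 1) ?F u"
    and "n3 = N (a + 1) (\<lambda>v. theta a v * ?F v) u" and "n4 = N (a + 1) (N a ?F) u"
    and "m1 = N a (L a ?F) u" and "m2 = N (a + 1) (L a ?F) u"
  note ndefs = P_def Q_def n1_def n2_def n3_def n4_def m1_def m2_def \<theta>_def \<theta>'_def
  have exp: "K (a + 1) (K a f) v x =
      (1 + ?k' * z * theta (a + 1) v) * (1 + ?k * y * theta a v) * f v x
     + (1 + ?k' * z * theta (a + 1) v) * ?k * N a (\<lambda>v. f v x) v + ?k' * N (a + 1) (\<lambda>v. f v x) v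
     + ?k' * ?k * y * N (a + 1) (\<lambda>v. theta a v * f v x) v + ?k' * ?k * N (a + 1) (\<lambda>w. N a (\<lambda>v. f v
       x) w) v" for v x
  proof -
    have "N (a + 1) (\<lambda>v. K a f v x) v =
        N (a + 1) (\<lambda>v. f v x + (?k * y * (theta a v * f v x) + ?k * N a (\<lambda>v. f v x) v)) v"
      by (rule N_cong) (simp add: K_def defs algebra_simps)
    also have "\<dots> = N (a + 1) (\<lambda>v. f v x) v +
        (?k * y * N (a + 1) (\<lambda>v. theta a v * f v x) v + ?k * N (a + 1) (\<lambda>w. N a (\<lambda>v. f v x) w) v)"
      unfolding N_add N_mult ..
    finally show ?thesis unfolding K_def[of "a + 1"] K_def[of a f v x] defs[symmetric]
      by (simp add: algebra_simps)
  qed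
  \<comment> \<open>Indicators of the two corrections in \<open>L_N\<close>: l separates a from a +
    1, in one order or the other.\<close>
  define \<epsilon> \<epsilon>' :: 'r where "\<epsilon> = (if pos u a \<le> l \<and> l < pos u (a + 1) then 1 else 0)"
    and "\<epsilon>' = (if pos u (a + 1) \<le> l \<and> l < pos u a then 1 else 0)"
  have Suc_ne: "\<not> a \<simeq> a + 1" "\<not> a + 1 \<simeq> a" by (rule not_ceq_Suc)+
  have LN: "L a (N a h) w = N (a + 1) (L a h) w + (if pos w a \<le> l \<and>
      l < pos w (a + 1) then h w else 0)"
    if "w \<in> W" for h :: "(int \<Rightarrow> int) \<Rightarrow> 'r" and w
    using L_N[OF that, of a a h] Suc_ne by simp
  have LN': "L a (N (a + 1) h) w = N a (L a h) w - (if pos w (a + 1) \<le> l \<and>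
      l < pos w a then h w else 0)"
    if "w \<in> W" for h :: "(int \<Rightarrow> int) \<Rightarrow> 'r" and w
    using L_N[OF that, of a "a + 1" h] Suc_ne by simp
  have r1: "L a (N a ?F) u = m2 + \<epsilon> * P" using LN[OF u, of ?F] by (simp add: ndefs \<epsilon>_def)
  have r2: "L a (N (a + 1) ?F) u = m1 - \<epsilon>' * P" using LN'[OF u, of ?F] by (simp add: ndefs \<epsilon>'_def)
  have r3: "L a (N (a + 1) (\<lambda>v. theta a v * ?F v)) u = \<theta>' * m1 - \<epsilon>' * P"
  proof -
    have "N a (L a (\<lambda>v. theta a v * ?F v)) u = N a (\<lambda>v. theta (a + 1) v * L a ?F v) u"
      by (rule N_cong) (simp add: L_theta Ncov_W(1))
    also have "\<dots> = \<theta>' * m1 - \<epsilon>' * P" using N_theta_Suc[OF u, of a ?F] by (simp add: ndefs \<epsilon>'_def)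
    finally show ?thesis using LN'[OF u, of "\<lambda>v. theta a v * ?F v"] by (auto simp: theta_def)
  qed
  have r4: "L a (N (a + 1) (N a ?F)) u = n1 - \<epsilon>' * n1"
    using LN'[OF u, of "N a ?F"] N_L_N[OF u, of a ?F] by (simp add: ndefs \<epsilon>'_def)
  \<comment> \<open>Passing N_a through L costs the correction of \<open>L_N\<close> at v. After a
    cover marked a + 1 this value already stands at most at l, so the correction only tests the side
    of a.\<close>
  have r5: "N (a + 1) (N a (L a ?F)) u = n2 - n3"
  proof -
    have "N a (L a ?F) v = L a (N (a + 1) ?F) v + (?F v - theta a v * ?F v)"
      if v: "v \<in> Ncov (a + 1) u" for v
      using LN'[OF Ncov_W(1)[OF v], of ?F] Ncov_pos(1)[OF v] by (simp add: theta_def)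
    then have "N (a + 1) (N a (L a ?F)) u =
        N (a + 1) (\<lambda>v. L a (N (a + 1) ?F) v + (?F v + (-1) * (theta a v * ?F v))) u"
      by (intro N_cong) simp
    also have "\<dots> = n2 - n3" unfolding N_add N_mult N_Suc_L_N_Suc by (simp add: ndefs)
    finally show ?thesis .
  qed
  have r6: "N (a + 1) (\<lambda>v. theta a v * L a ?F v) u = \<theta> * m2"
    using N_Suc_theta[of a ?F u] by (simp add: ndefs)
  have z1: "\<theta> * n1 = 0" "\<theta> * m1 = 0" "\<theta>' * n2 = 0" "\<theta>' * n3 = 0" "\<theta>' * n4 = 0" "\<theta>' * m2 = 0"
    unfolding ndefs by (rule theta_N)+
  have LT: "L a (\<lambda>v. K (a + 1) (K a f) v x) u =
    (1 + ?k' * z * \<theta>) * (1 + ?k * y * \<theta>') * Q + (1 + ?k' * z * \<theta>) * ?k * (m2 + \<epsilon> * P)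
    + ?k' * (m1 - \<epsilon>' * P) + ?k' * ?k * y * (\<theta>' * m1 - \<epsilon>' * P) + ?k' * ?k * (n1 - \<epsilon>' * n1)"
  proof -
    have "L a (\<lambda>v. (1 + ?k' * z * theta (a + 1) v) * (1 + ?k * y * theta a v) * f v x) u =
        (1 + ?k' * z * \<theta>) * (1 + ?k * y * \<theta>') * Q"
      "L a (\<lambda>v. (1 + ?k' * z * theta (a + 1) v) * ?k * N a ?F v) u =
          (1 + ?k' * z * \<theta>) * ?k * L a (N a ?F) u"
      using u by (simp_all add: L_def ndefs theta_def pos_s)
    then show ?thesis unfolding exp L_add L_mult r2 r3 r4 r1 by (simp only: r1[symmetric])
  qed
  have AT: "A a (K (a + 1) (K a f) u) x =
      \<sigma> a ?c1 * Q + divdiff a ?c1 * P + (\<sigma> a ?c2 * m1 + divdiff a ?c2 * n1)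
     + (\<sigma> a ?c3 * m2 + divdiff a ?c3 * n2) + (\<sigma> a ?c4 * (\<theta> * m2) + divdiff a ?c4 * n3) + (\<sigma> a ?c5 *
       (n2 - n3) + divdiff a ?c5 * n4)"
  proof -
    have e4: "A a (\<lambda>x. N (a + 1) (\<lambda>v. theta a v * f v x) u) x = \<theta> * m2"
    proof -
      have "A a (\<lambda>x. N (a + 1) (\<lambda>v. theta a v * f v x) u) x =
          N (a + 1) (\<lambda>v. A a (\<lambda>x. theta a v * f v x) x) u"
        by (rule A_N)
      also have "\<dots> = N (a + 1) (\<lambda>v. theta a v * L a ?F v) u"
      proof (rule N_cong)
        fix v assume "v \<in> Ncov (a + 1) u"
        then have v: "v \<in> W" by (rule Ncov_W)
        have "\<sigma> a (theta a v) = theta a v" "divdiff a (theta a v) = 0"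
          by (auto simp: theta_def \<sigma>_0 \<sigma>_1 divdiff_def)
        then show "A a (\<lambda>x. theta a v * f v x) x = theta a v * L a ?F v"
          unfolding A_mult equivD[OF f v x] by simp
      qed
      finally show ?thesis using r6 by simp
    qed
    have e5: "A a (\<lambda>x. N (a + 1) (\<lambda>w. N a (\<lambda>v. f v x) w) u) x = n2 - n3"
      unfolding A_N[of a "a + 1" "\<lambda>w x. N a (\<lambda>v. f v x) w"] equivariant_N[OF f x] using r5 .
    have "A a (K (a + 1) (K a f) u) x =
        A a (\<lambda>x. ?c1 * f u x + ?c2 * N a (\<lambda>v. f v x) u + ?c3 * N (a + 1) (\<lambda>v. f v x) u
       + ?c4 * N (a + 1) (\<lambda>v. theta a v * f v x) u + ?c5 * N (a + 1) (\<lambda>w. N a (\<lambda>v. f v x) w) u) x"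
      unfolding \<theta>_def \<theta>'_def exp[symmetric] ..
    also have "\<dots> = \<sigma> a ?c1 * Q + divdiff a ?c1 * P + (\<sigma> a ?c2 * m1 + divdiff a ?c2 * n1)
     + (\<sigma> a ?c3 * m2 + divdiff a ?c3 * n2) + (\<sigma> a ?c4 * (\<theta> * m2) + divdiff a ?c4 * n3) + (\<sigma> a ?c5 *
       (n2 - n3) + divdiff a ?c5 * n4)"
      unfolding A_add A_mult e4 e5 equivD[OF f u x] equivariant_N[OF f x] by (simp only: ndefs)
    finally show ?thesis .
  qed
  have \<sigma>c: "\<sigma> a ?k = ?k'" "\<sigma> a ?k' = ?k" by (simp_all add: \<sigma>_mult \<sigma>s \<sigma>_\<tau>)
  have \<sigma>4: "\<sigma> a ?c4 = ?k * ?k' * z" and \<sigma>5: "\<sigma> a ?c5 = ?k * ?k'" by (simp_all add: \<sigma>_mult \<sigma>s \<sigma>_\<tau>)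
  have d3: "divdiff a ?c3 = - (?k * ?k')"
  proof -
    have "divdiff a ?c3 = - \<tau> * (root_inv a * (G - H))"
      unfolding divdiff_def \<sigma>c by (simp add: algebra_simps)
    then show ?thesis unfolding GH by (simp add: algebra_simps)
  qed
  have dk: "divdiff a ?k = ?k * ?k'"
  proof -
    have "divdiff a ?k = \<tau> * (root_inv a * (G - H))"
      unfolding divdiff_def \<sigma>c by (simp add: algebra_simps)
    then show ?thesis unfolding GH by (simp add: algebra_simps)
  qed
  have d4: "divdiff a ?c4 = ?k * ?k'"
  proof -
    have "divdiff a ?c4 = ?k * ?k' * (root_inv a * (y - z))"
      unfolding divdiff_def \<sigma>4 by (simp add: algebra_simps)
    then show ?thesis unfolding I by simp
  qed
  have d5: "divdiff a ?c5 = 0" unfolding divdiff_def \<sigma>5 by (simp add: algebra_simps)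
  have dG: "divdiff a G = \<tau> * G * H" "divdiff a H = - (\<tau> * G * H)" "divdiff a (H * G) = 0"
    "divdiff a 1 = 0" "divdiff a (H * ?k) = 0"
    using GH unfolding divdiff_def \<sigma>_mult \<sigma>s \<sigma>_1 \<sigma>_\<tau> by (simp_all add: algebra_simps)
  have HG1: "1 + ?k' * z = H" "1 + ?k * y = G" using H1 G1 by (simp_all add: algebra_simps)
  have kz: "?k * ?k' * z = ?k * (H - 1)" "?k' * ?k * y = ?k' * (G - 1)"
    using HG1 by (metis add_diff_cancel_left' mult.assoc)+
  consider "\<theta> = 0" "\<theta>' = 0" "\<epsilon> = 0" "\<epsilon>' = 0" | "\<theta> = 1" "\<theta>' = 0" "\<epsilon> = 1" "\<epsilon>' = 0"
    | "\<theta> = 0" "\<theta>' = 1" "\<epsilon> = 0" "\<epsilon>' = 1" | "\<theta> = 1" "\<theta>' = 1" "\<epsilon> = 0" "\<epsilon>' = 0"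
    unfolding \<theta>_def \<theta>'_def \<epsilon>_def \<epsilon>'_def theta_def
      by (cases "pos u a \<le> l"; cases "pos u (a + 1) \<le> l") auto
  then show "A a (K (a + 1) (K a f) u) x = L a (\<lambda>v. K (a + 1) (K a f) v x) u"
  proof cases
    case 1
    show ?thesis unfolding AT LT \<sigma>4 \<sigma>5 d3 d4 d5 unfolding 1
      by (simp only: mult_zero_right mult_zero_left add_0_right add_0_left mult_1_left mult_1_right
        diff_zero diff_0_right \<sigma>_1 dG dk \<sigma>c) (simp add: algebra_simps)
  next
    case 2
    have zz: "n1 = 0" "m1 = 0" using z1 2 by simp_all
    show ?thesis unfolding AT LT \<sigma>4 \<sigma>5 d3 d4 d5 unfolding kz zz unfolding 2
      by (simp only: mult_zero_right mult_zero_left add_0_right add_0_left mult_1_left mult_1_right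
        diff_zero diff_0_right HG1 \<sigma>s dG \<sigma>c \<sigma>_mult \<sigma>_\<tau>) (simp add: algebra_simps)
  next
    case 3
    have zz: "n2 = 0" "n3 = 0" "n4 = 0" "m2 = 0" using z1 3 by simp_all
    show ?thesis unfolding AT LT \<sigma>4 \<sigma>5 d3 d4 d5 unfolding kz zz unfolding 3
      by (simp only: mult_zero_right mult_zero_left add_0_right add_0_left mult_1_left mult_1_right
        diff_zero diff_0_right HG1 \<sigma>s dG \<sigma>c \<sigma>_mult \<sigma>_\<tau>) (simp add: algebra_simps)
  next
    case 4
    have zz: "n1 = 0" "m1 = 0" "n2 = 0" "n3 = 0" "n4 = 0" "m2 = 0" using z1 4 by simp_all
    show ?thesis unfolding AT LT zz unfolding 4
      by (simp only: mult_zero_right mult_zero_left add_0_right add_0_left mult_1_left mult_1_right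
        diff_zero diff_0_right HG1 \<sigma>s dG \<sigma>c \<sigma>_mult \<sigma>_\<tau>) (simp add: algebra_simps)
  qed
qed


text \<open>The largest marking is applied last, since it marks the first cover of a strip.\<close>

fun K_prod :: "int \<Rightarrow> nat \<Rightarrow> ((int \<Rightarrow> int) \<Rightarrow> (int \<Rightarrow> int) \<Rightarrow> 'r) \<Rightarrow> (int \<Rightarrow> int) \<Rightarrow> (int \<Rightarrow> int) \<Rightarrow> 'r" where
  "K_prod lo 0 f = f"
| "K_prod lo (Suc k) f = K (lo + int k) (K_prod lo k f)"

lemma K_prod_add: "K_prod lo (k + j) f = K_prod (lo + int k) j (K_prod lo k f)"
  by (induction j) (simp_all add: add.assoc)

lemma equivariant_ceq: assumes "a \<simeq> b" shows "equivariant a f \<longleftrightarrow> equivariant b f"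
proof -
  have "A a = A b"
    by (intro ext) (simp add: A_def root_inv_ceq[OF assms] \<sigma>_ceq[OF assms] s_ceq[OF assms])
  moreover have "L a h u = L b h u" if "u \<in> W" for h :: "(int \<Rightarrow> int) \<Rightarrow> 'r" and u
    by (simp add: L_def asc_ceq[OF that assms] s_ceq[OF assms])
  ultimately show ?thesis by (simp add: equivariant_def)
qed

text \<open>Of n consecutive markings only the first two have the residues of lo and lo + 1. They
  form a pair, and the others pass one at a time.\<close>

lemma equivariant_period: assumes "equivariant lo f" shows "equivariant lo (K_prod lo n f)"
proof -
  have "equivariant lo (K_prod lo (m + 2) f)" if "m + 2 \<le> n" for m
    using that
  proof (induction m)
    case 0
    have "K_prod lo (0 + 2) f = K (lo + 1) (K lo f)" by (simp add: numeral_2_eq_2)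
    then show ?case using equivariant_K_K[OF assms] by simp
  next
    case (Suc m)
    have "\<not> lo + int (m + 2) \<simeq> lo" "\<not> lo + int (m + 2) \<simeq> lo + 1"
      using ceq_less[of lo "lo + int (m + 2)"] ceq_less[of "lo + 1" "lo + int (m + 2)"] Suc.prems
      by (auto dest: cong_sym)
    then have "equivariant lo (K (lo + int (m + 2)) (K_prod lo (m + 2) f))"
      using Suc equivariant_K by simp
    then show ?case by (simp only: add_Suc K_prod.simps(2))
  qed
  note this[of "n - 2"]
  moreover have m: "n - 2 + 2 = n" using n2 by simp
  ultimately show ?thesis unfolding m by simp
qed

text \<open>Whole periods that start at the residue of a never separate a marking congruent to a
  from its successor.\<close>

lemma equivariant_K_prod: assumes "equivariant a f" "lo \<simeq> a"
  shows "equivariant a (K_prod lo (q * n) f)"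
proof (induction q)
  case (Suc q)
  let ?lo = "lo + int (q * n)"
  have c: "?lo \<simeq> a" using assms(2) by simp
  have "equivariant ?lo (K_prod lo (q * n) f)" using Suc equivariant_ceq[OF c] by simp
  from equivariant_period[OF this] have "equivariant a (K_prod ?lo n (K_prod lo (q * n) f))"
    using equivariant_ceq[OF c] by simp
  then show ?case using K_prod_add[of lo "q * n" n f] by (simp add: add.commute)
qed (use assms in simp)

text \<open>The diagonal of \<open>K_prod\<close>, and by \<open>G_window_G\<close> the value of the
  class G at x up to a factor that does not depend on x.\<close>

definition G_window :: "int \<Rightarrow> nat \<Rightarrow> (int \<Rightarrow> int) \<Rightarrow> 'r" where
  "G_window lo k x = (\<Prod>b\<in>{b \<in> {lo..<lo + int k}. pos x b \<le> l}. g b)"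

text \<open>A window of whole periods starting at the residue of a is preserved by
  \<open>s a\<close>, which permutes the factors.\<close>

lemma G_window_equivariant:
  assumes x: "x \<in> W" and lo: "lo \<simeq> a"
  shows "\<sigma> a (G_window lo (q * n) (s a \<circ> x)) = G_window lo (q * n) x"
proof -
  have win: "s a b \<in> {lo..<lo + int (q * n)}" if "b \<in> {lo..<lo + int (q * n)}" for b
  proof (cases b a rule: s_cases)
    case (left k)
    have "lo + int (q * n) \<simeq> b" using lo left by (simp add: cong_sym_eq)
    then have "b + int n \<le> lo + int (q * n)"
      using ceq_less[of b "lo + int (q * n)"] that cong_sym by auto
    then show ?thesis using that left n2 by auto
  next
    case (right k)
    have "b \<simeq> lo + 1" using right lo ceq_Suc_iff[of a lo] by (simp add: cong_sym_eq)
    then have "b \<noteq> lo" using not_ceq_Suc by auto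
    then show ?thesis using that right by auto
  qed (use that in simp)
  have "\<sigma> a (G_window lo (q * n) (s a \<circ> x)) =
      (\<Prod>b\<in>{b \<in> {lo..<lo + int (q * n)}. pos x (s a b) \<le> l}. g (s a b))"
    unfolding G_window_def \<sigma>_prod \<sigma>_g pos_s[OF x] ..
  also have "\<dots> = G_window lo (q * n) x"
    unfolding G_window_def
    by (rule prod.reindex_bij_witness[where i = "s a" and j = "s a"]) (use win in auto)
  finally show ?thesis .
qed

section \<open>Enlarging the window beyond the box\<close>

lemma K_above: assumes "u \<in> box lo hi" "hi \<le> c" shows "K c f u x = f u x"
proof -
  have "Ncov c u = {}" using box_Ncov(3)[OF assms(1)] assms(2) by force
  then show ?thesis using box_pos(2)[OF assms] by (simp add: K_def N_def theta_def)
qed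

lemma K_below: assumes "u \<in> box lo hi" "c < lo" shows "K c f u x = g c * f u x"
proof -
  have "Ncov c u = {}" using box_Ncov(2)[OF assms(1)] assms(2) by force
  moreover have "1 + \<tau> * g c * e c = g c" using g[of c] by (simp add: algebra_simps)
  ultimately show ?thesis using box_pos(1)[OF assms] by (simp add: K_def N_def theta_def)
qed

lemma K_prod_above: assumes "u \<in> box lo (lo + int k)"
  shows "K_prod lo (k + j) f u x = K_prod lo k f u x"
  by (induction j) (simp_all add: K_above[OF assms])

lemma K_prod_below: assumes "u \<in> box lo hi"
  shows "K_prod (lo - int j) (j + k) f u x = (\<Prod>b\<in>{lo - int j..<lo}. g b) * K_prod lo k f u x"
  using assms
proof (induction k arbitrary: u)
  case 0
  have "K_prod (lo - int j) i f u x = (\<Prod>b\<in>{lo - int j..<lo - int j + int i}. g b) * f u x"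
    if "i \<le> j" for i
    using that
  proof (induction i)
    case (Suc i)
    have "{lo - int j..<lo - int j + int (Suc i)} =
        insert (lo - int j + int i) {lo - int j..<lo - int j + int i}"
      by auto
    then show ?case using Suc K_below[OF 0, of "lo - int j + int i"] by (simp add: mult.assoc)
  qed simp
  from this[of j] show ?case by simp
next
  case (Suc k)
  have "N (lo + int k) (\<lambda>v. K_prod (lo - int j) (j + k) f v x) u
     = N (lo + int k) (\<lambda>v. (\<Prod>b\<in>{lo - int j..<lo}. g b) * K_prod lo k f v x) u"
    by (rule N_cong) (use Suc box_Ncov(1) in blast)
  then show ?case using Suc by (simp add: K_def N_mult algebra_simps)
qed

lemma G_window_above: assumes "x \<in> box lo (lo + int k)"
  shows "G_window lo (k + j) x = G_window lo k x"
proof -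
  have "{b \<in> {lo..<lo + int (k + j)}. pos x b \<le> l} = {b \<in> {lo..<lo + int k}. pos x b \<le> l}"
  proof -
    have "b < lo + int k" if "pos x b \<le> l" for b using box_pos(2)[OF assms, of b] that by linarith
    then have "(b \<in> {lo..<lo + int (k + j)} \<and> pos x b \<le> l) = (b \<in> {lo..<lo + int k} \<and> pos x b \<le> l)"
      for b
      by (cases "pos x b \<le> l") (fastforce, simp)
    then show ?thesis by simp
  qed
  then show ?thesis by (simp only: G_window_def)
qed

lemma G_window_below: assumes "x \<in> box lo hi"
  shows "G_window (lo - int j) (j + k) x = (\<Prod>b\<in>{lo - int j..<lo}. g b) * G_window lo k x"
proof -
  have "{b \<in> {lo - int j..<lo - int j + int (j + k)}. pos x b \<le> l} =
     {lo - int j..<lo} \<union> {b \<in> {lo..<lo + int k}. pos x b \<le> l}"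
  proof (rule set_eqI)
    fix b show "b \<in> {b \<in> {lo - int j..<lo - int j + int (j + k)}. pos x b \<le> l} \<longleftrightarrow>
      b \<in> {lo - int j..<lo} \<union> {b \<in> {lo..<lo + int k}. pos x b \<le> l}"
      using box_pos(1)[OF assms, of b] by (cases "b < lo") auto
  qed
  note eq = this
  have "finite {b \<in> {lo..<lo + int k}. pos x b \<le> l}" by (rule finite_Collect_conjI) simp
  moreover have "{lo - int j..<lo} \<inter> {b \<in> {lo..<lo + int k}. pos x b \<le> l} = {}" by auto
  ultimately show ?thesis unfolding G_window_def eq by (intro prod.union_disjoint) simp_all
qed

lemma prod_g_cancel: "(\<Prod>b\<in>S. g b) * p = (\<Prod>b\<in>S. g b) * q \<longleftrightarrow> p = q"
proof
  assume h: "(\<Prod>b\<in>S. g b) * p = (\<Prod>b\<in>S. g b) * q"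
  have "(\<Prod>b\<in>S. 1 - \<tau> * e b) * (\<Prod>b\<in>S. g b) = 1"
    unfolding prod.distrib[symmetric] using g by (simp add: mult.commute)
  then show "p = q" using arg_cong[OF h, of "\<lambda>z. (\<Prod>b\<in>S. 1 - \<tau> * e b) * z"]
    by (simp add: mult.assoc[symmetric])
qed simp

lemma desc_exists: assumes u: "u \<in> W" and "u \<noteq> id" shows "\<exists>a. \<not> asc a u"
proof -
  obtain "is" where "is": "word_elt n is = u" "length is = len u"
    using reduced_exists[OF u] by (auto simp: reduced_word_def)
  then obtain i js where js: "is = i # js" using assms(2) by (cases "is") auto
  have "s i \<circ> u = word_elt n js" using "is" js by auto
  then have "len (s i \<circ> u) \<le> length js" using len_word_le by simp
  then have "\<not> asc i u" using len_s_asc[OF u] "is" js by force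
  then show ?thesis ..
qed

text \<open>Induction on the length of u = s_a v: both sides arise from those for v by the same
  operator \<open>A a\<close>, on the left by invariance of \<open>G_window\<close>, on the right by
  \<open>equivariant_K_prod\<close>. This needs a window adapted to a, so the claim is moved to a
  larger window and back.\<close>

theorem strip_expansion:
  assumes F: "\<And>a. equivariant a F"
    and Fid: "\<And>x. F id x = (if x = id then 1 else 0)"
    and Ffin: "\<And>u. u \<in> W \<Longrightarrow> finite {x. F u x \<noteq> 0}" and FW: "\<And>u x. u \<in> W \<Longrightarrow> F u x \<noteq> 0 \<Longrightarrow> x \<in> W"
    and u: "u \<in> W" and box: "insert u {x. F u x \<noteq> 0} \<subseteq> box lo (lo + int k)"
  shows "\<forall>x\<in>W. G_window lo k x * F u x = K_prod lo k F u x"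
proof -
  define claim where "claim lo k u \<longleftrightarrow> (\<forall>x\<in>W. G_window lo k x * F u x = K_prod lo k F u x)" for lo k u
  define ok where "ok lo hi u \<longleftrightarrow> insert u {x. F u x \<noteq> 0} \<subseteq> box lo hi" for lo hi u
  \<comment> \<open>Extending the window downwards multiplies both sides by the same unit, extending
    it upwards changes neither; so the claim does not depend on the window.\<close>
  have ext: "claim (lo - int j) (j + k + i) u \<longleftrightarrow> claim lo k u" if ok: "ok lo (lo + int k) u"
    for lo k j i u
  proof -
    have b: "box lo (lo + int k) \<subseteq> box (lo - int j) (lo - int j + int (j + k))"
      by (rule box_mono) auto
    have ub: "u \<in> box lo (lo + int k)" using ok by (simp add: ok_def)
    have PE: "K_prod (lo - int j) (j + k + i) F u x =
        (\<Prod>b\<in>{lo - int j..<lo}. g b) * K_prod lo k F u x" for x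
      using K_prod_above[OF subsetD[OF b ub], of i F x] K_prod_below[OF ub, of j k F x]
        by (rule trans)
    have "G_window (lo - int j) (j + k + i) x * F u x = K_prod (lo - int j) (j + k + i) F u x \<longleftrightarrow>
        G_window lo k x * F u x = K_prod lo k F u x" for x
    proof (cases "F u x = 0")
      case True
      then show ?thesis using prod_g_cancel[of "{lo - int j..<lo}" 0 "K_prod lo k F u x"]
        unfolding PE by simp
    next
      case False
      then have xb: "x \<in> box lo (lo + int k)" using ok by (auto simp: ok_def)
      have GE: "G_window (lo - int j) (j + k + i) x = (\<Prod>b\<in>{lo - int j..<lo}. g b) * G_window lo k x"
        using G_window_above[OF subsetD[OF b xb], of i] G_window_below[OF xb, of j k]
          by (rule trans)
      show ?thesis unfolding PE GE mult.assoc prod_g_cancel ..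
    qed
    then show ?thesis by (simp add: claim_def)
  qed
  have step: "claim lo k u" if "u \<in> W" "ok lo (lo + int k) u" for u lo k
    using that
  proof (induction "len u" arbitrary: u lo k rule: less_induct)
    case less
    note u = less.prems(1) and ok = less.prems(2)
    show ?case
    proof (cases "u = id")
      case True
      \<comment> \<open>For the identity the empty window at l + 1 suffices, and there both sides
        are \<open>F id x\<close>.\<close>
      have ok0: "ok (l + 1) (l + 1 + int 0) u"
        unfolding ok_def by (auto simp: True Fid box_def)
      have c0: "claim (l + 1) 0 u" by (simp add: claim_def G_window_def)
      have "u \<in> box lo (lo + int k)" using ok by (simp add: ok_def)
      then have lo: "lo \<le> l + 1" "l + 1 \<le> lo + int k" using True by (auto simp: box_def)
      define j where "j = nat (l + 1 - lo)"
      have j: "lo = l + 1 - int j" using lo by (simp add: j_def)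
      define i where "i = k - j"
      have i: "k = j + 0 + i" using lo j by (simp add: i_def)
      show ?thesis using ext[OF ok0, of j i] c0 j i by simp
    next
      case False
      then obtain a where d: "\<not> asc a u" using desc_exists[OF u] by blast
      define v where "v = s a \<circ> u"
      have v: "v \<in> W" "asc a v" "u = s a \<circ> v" using u d by (auto simp: v_def asc_s)
      have lt: "len v < len u" using len_s_desc[OF u d] by (simp add: v_def)
      have "finite (insert v {x. F v x \<noteq> 0})" "insert v {x. F v x \<noteq> 0} \<subseteq> W"
        using Ffin FW v(1) by auto
      then obtain lo1 hi1 where b1: "insert v {x. F v x \<noteq> 0} \<subseteq> box lo1 hi1"
        using box_exists by blast
      \<comment> \<open>\<open>j\<close> leads below both boxes and on to the residue of a,
        \<open>i0\<close> leads past both at the top, and \<open>i\<close> pads the total length to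
        a multiple of n.\<close>
      define j where "j = nat (lo - min lo lo1) + nat ((min lo lo1 - a) mod int n)"
      define i0 where "i0 = nat (max (lo + int k) hi1 - (lo + int k))"
      define i where "i = i0 + (n - 1) * (j + k + i0)"
      have jk: "j + k + i = (j + k + i0) * n" using n2 by (cases n) (auto simp: i_def algebra_simps)
      have lj: "lo - int j = min lo lo1 - (min lo lo1 - a) mod int n"
        using n2 by (simp add: j_def)
      have al: "lo - int j \<simeq> a" unfolding lj
        by (simp add: cong_def mod_diff_right_eq)
      have le: "lo - int j \<le> lo1"
        unfolding lj using n2 pos_mod_sign[of "int n" "min lo lo1 - a"] by linarith
      have "i0 \<le> i" "hi1 \<le> lo + int k + int i0" by (simp_all add: i_def i0_def)
      then have hi: "hi1 \<le> lo - int j + int (j + k + i)" by simp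
      have okv: "ok (lo - int j) (lo - int j + int (j + k + i)) v"
        unfolding ok_def using b1 box_mono[OF le hi] by blast
      have cv: "claim (lo - int j) (j + k + i) v"
        by (rule less.hyps[OF lt v(1) okv])
      have "claim (lo - int j) (j + k + i) u"
        unfolding claim_def
      proof
        fix x assume x: "x \<in> W"
        let ?G = "G_window (lo - int j) (j + k + i)" and ?P = "K_prod (lo - int j) (j + k + i) F"
        have cl: "?G x * F v x = ?P v x" if "x \<in> W" for x using cv that by (simp add: claim_def)
        have sx: "s a \<circ> x \<in> W" using x by simp
        have \<sigma>G: "\<sigma> a (?G (s a \<circ> x)) = ?G x" unfolding jk by (rule G_window_equivariant[OF x al])
        have eP: "equivariant a ?P" unfolding jk by (rule equivariant_K_prod[OF F al])
        have "?G x * F u x = ?G x * A a (F v) x"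
          using equivD[OF F v(1) x, of a] v(2,3) by (simp add: L_def)
        also have "\<dots> = root_inv a * (?G x * F v x - \<sigma> a (?G (s a \<circ> x) * F v (s a \<circ> x)))"
          unfolding A_def \<sigma>_mult \<sigma>G by (simp add: algebra_simps)
        also have "\<dots> = A a (?P v) x" unfolding cl[OF x] cl[OF sx] A_def ..
        also have "\<dots> = ?P u x" using equivD[OF eP v(1) x] v(2,3) by (simp add: L_def)
        finally show "?G x * F u x = ?P u x" .
      qed
      then show ?thesis using ext[OF ok, of j i] by simp
    qed
  qed
  show ?thesis using step[OF u] box by (simp add: ok_def claim_def)
qed

end

section \<open>The level zero action\<close>

abbreviation Fr :: "mpol \<Rightarrow> mpol \<Rightarrow> mpol fract" where "Fr \<equiv> Fraction_Field.Fract"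

text \<open>Evaluation of a monomial. The additive extension \<open>psubst\<close> is the
  substitution homomorphism sending X_r to h r, of which \<open>act_sym\<close> and
  \<open>poly_act\<close> are instances.\<close>

definition mon_subst :: "(nat \<Rightarrow> mpol) \<Rightarrow> (nat \<Rightarrow>\<^sub>0 nat) \<Rightarrow> mpol" where
  "mon_subst h \<mu> = (\<Prod>r\<in>Poly_Mapping.keys \<mu>. h r ^ Poly_Mapping.lookup \<mu> r)"

definition psubst :: "(nat \<Rightarrow> mpol) \<Rightarrow> mpol \<Rightarrow> mpol" where
  "psubst h = frag_extend (mon_subst h)"

lemma mon_subst_superset:
  assumes "finite S" "Poly_Mapping.keys \<mu> \<subseteq> S"
  shows "mon_subst h \<mu> = (\<Prod>r\<in>S. h r ^ Poly_Mapping.lookup \<mu> r)"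
  unfolding mon_subst_def
  by (rule prod.mono_neutral_left) (use assms in \<open>auto simp: in_keys_iff\<close>)

lemma mon_subst_add: "mon_subst h (\<mu> + \<nu>) = mon_subst h \<mu> * mon_subst h \<nu>"
proof -
  let ?S = "Poly_Mapping.keys \<mu> \<union> Poly_Mapping.keys \<nu>"
  have "mon_subst h (\<mu> + \<nu>) = (\<Prod>r\<in>?S. h r ^ Poly_Mapping.lookup (\<mu> + \<nu>) r)"
    by (rule mon_subst_superset) (auto simp: keys_add)
  also have "\<dots> = (\<Prod>r\<in>?S. h r ^ Poly_Mapping.lookup \<mu> r) * (\<Prod>r\<in>?S. h r ^ Poly_Mapping.lookup \<nu> r)"
    by (simp add: lookup_add power_add prod.distrib)
  also have "\<dots> = mon_subst h \<mu> * mon_subst h \<nu>"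
    by (simp add: mon_subst_superset[of ?S])
  finally show ?thesis .
qed

lemma mpol_induct [case_names zero mono diff]:
  fixes p :: mpol
  assumes "P 0" "\<And>\<mu>. P (frag_of \<mu>)" "\<And>a b. P a \<Longrightarrow> P b \<Longrightarrow> P (a - b)"
  shows "P p"
  using subset_UNIV by (rule frag_induction) (use assms in auto)

lemma psubst_of [simp]: "psubst h (frag_of \<mu>) = mon_subst h \<mu>" by (simp add: psubst_def)
lemma psubst_0 [simp]: "psubst h 0 = 0" by (simp add: psubst_def)
lemma psubst_diff: "psubst h (p - q) = psubst h p - psubst h q"
  by (simp add: psubst_def frag_extend_diff)
lemma psubst_add: "psubst h (p + q) = psubst h p + psubst h q"
  by (simp add: psubst_def frag_extend_add)
lemma psubst_mult: "psubst h (p * q) = psubst h p * psubst h q"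
proof (induction p rule: mpol_induct)
  case (mono \<mu>)
  show ?case
  proof (induction q rule: mpol_induct)
    case (mono \<nu>)
    then show ?case by (simp add: mult_single mon_subst_add)
  qed (simp_all add: right_diff_distrib psubst_diff)
qed (simp_all add: left_diff_distrib psubst_diff)

lemma psubst_1 [simp]: "psubst h 1 = 1"
proof -
  have "(1 :: mpol) = frag_of 0" by simp
  then have "psubst h 1 = mon_subst h 0" using psubst_of by metis
  then show ?thesis by (simp add: mon_subst_def)
qed

lemma psubst_power: "psubst h (p ^ k) = psubst h p ^ k"
  by (induction k) (simp_all add: psubst_mult)

lemma psubst_prod: "psubst h (\<Prod>i\<in>I. p i) = (\<Prod>i\<in>I. psubst h (p i))"
  by (induction I rule: infinite_finite_induct) (auto simp: psubst_mult)

lemma psubst_mvar [simp]: "psubst h (mvar r) = h r"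
  by (simp add: mvar_def mon_subst_def)

lemma psubst_psubst: "psubst h (psubst k p) = psubst (\<lambda>r. psubst h (k r)) p"
  by (induction p rule: mpol_induct) (simp_all add: psubst_diff mon_subst_def psubst_prod
    psubst_power)

lemma mvar_power: "mvar r ^ k = frag_of (Poly_Mapping.single r k)"
proof (induction k)
  case (Suc k)
  have "Poly_Mapping.single r (Suc k) = Poly_Mapping.single r 1 + Poly_Mapping.single r k"
    by (subst single_add[symmetric]) simp
  then show ?case using Suc by (simp add: mvar_def mult_single)
qed simp

lemma mon_subst_mvar: "mon_subst mvar \<mu> = frag_of \<mu>"
proof -
  have sum_of: "(\<Prod>r\<in>S. frag_of (h r)) = (frag_of (\<Sum>r\<in>S. h r) :: mpol)"
    for S and h :: "nat \<Rightarrow> nat \<Rightarrow>\<^sub>0 nat"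
    by (induction S rule: infinite_finite_induct) (simp_all add: mult_single)
  have "(\<Sum>r\<in>Poly_Mapping.keys \<mu>. Poly_Mapping.single r (Poly_Mapping.lookup \<mu> r)) = \<mu>"
    by (rule poly_mapping_eqI) (simp add: lookup_sum lookup_single when_def sum.delta in_keys_iff)
  then show ?thesis by (simp add: mon_subst_def mvar_power sum_of)
qed

lemma psubst_id: "psubst mvar p = p"
  by (induction p rule: mpol_induct) (simp_all add: psubst_diff mon_subst_mvar)

lemma psubst_cong_sym:
  assumes "p \<in> sym_wt n" "\<And>r. r < n - 1 \<Longrightarrow> h r = k r"
  shows "psubst h p = psubst k p"
  unfolding psubst_def
proof (rule frag_extend_eq)
  fix \<mu> assume "\<mu> \<in> Poly_Mapping.keys p"
  then have "Poly_Mapping.keys \<mu> \<subseteq> {..<n - 1}" using assms(1) by (simp add: sym_wt_def)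
  then show "mon_subst h \<mu> = mon_subst k \<mu>"
    unfolding mon_subst_def by (intro prod.cong) (auto simp: assms(2))
qed

text \<open>Exponents are natural numbers, so a product of two monomials is 1 only if both are. This
  multiplicativity lets identities between series be reduced to constant terms.\<close>

lemma lookup_0_mult: "Poly_Mapping.lookup (p * q) 0 =
    Poly_Mapping.lookup p 0 * Poly_Mapping.lookup (q :: mpol) 0"
proof (induction p rule: mpol_induct)
  case (mono \<mu>)
  show ?case
  proof (induction q rule: mpol_induct)
    case (mono \<nu>)
    have "\<mu> + \<nu> = 0 \<longleftrightarrow> \<mu> = 0 \<and> \<nu> = 0"
      by (metis add_is_0 lookup_add lookup_zero poly_mapping_eqI add.right_neutral)
    then show ?case by (auto simp: mult_single lookup_single when_def)
  qed (simp_all add: right_diff_distrib lookup_minus)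
qed (simp_all add: left_diff_distrib lookup_minus)

section \<open>The subring Sym P and its weights\<close>

lemma sym_wt_0 [simp]: "0 \<in> sym_wt n" by (simp add: sym_wt_def)
lemma sym_wt_diff [intro]: "p \<in> sym_wt n \<Longrightarrow> q \<in> sym_wt n \<Longrightarrow> p - q \<in> sym_wt n"
  using keys_diff[of p q] by (auto simp: sym_wt_def)
lemma sym_wt_minus [intro]: "p \<in> sym_wt n \<Longrightarrow> - p \<in> sym_wt n"
  by (simp add: sym_wt_def)
lemma sym_wt_add [intro]: "p \<in> sym_wt n \<Longrightarrow> q \<in> sym_wt n \<Longrightarrow> p + q \<in> sym_wt n"
  using keys_add[of p q] by (auto simp: sym_wt_def)
lemma sym_wt_1 [simp]: "1 \<in> sym_wt n"
  by (simp add: sym_wt_def)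
lemma sym_wt_mult [intro]: assumes "p \<in> sym_wt n" "q \<in> sym_wt n" shows "p * q \<in> sym_wt n"
  unfolding sym_wt_def
proof (intro CollectI ballI)
  fix \<mu> assume "\<mu> \<in> Poly_Mapping.keys (p * q)"
  then obtain a b where "\<mu> = a + b" "a \<in> Poly_Mapping.keys p" "b \<in> Poly_Mapping.keys q"
    using keys_mult[of p q] by blast
  then show "Poly_Mapping.keys \<mu> \<subseteq> {..<n - 1}"
    using assms keys_add[of a b] unfolding sym_wt_def by blast
qed
lemma sym_wt_sum [intro]: "(\<And>i. i \<in> I \<Longrightarrow> p i \<in> sym_wt n) \<Longrightarrow> (\<Sum>i\<in>I. p i) \<in> sym_wt n"
  by (induction I rule: infinite_finite_induct) auto
lemma sym_wt_prod [intro]: "(\<And>i. i \<in> I \<Longrightarrow> p i \<in> sym_wt n) \<Longrightarrow> (\<Prod>i\<in>I. p i) \<in> sym_wt n"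
  by (induction I rule: infinite_finite_induct) auto
lemma sym_wt_power [intro]: "p \<in> sym_wt n \<Longrightarrow> p ^ k \<in> sym_wt n"
  by (induction k) auto
lemma sym_wt_mvar: "r < n - 1 \<Longrightarrow> mvar r \<in> sym_wt n"
  by (simp add: sym_wt_def mvar_def)
lemma sym_wt_e_wt [simp, intro]: "e_wt n j \<in> sym_wt n"
  by (auto simp: e_wt_def Let_def simp del: One_nat_def intro!: sym_wt_mvar sym_wt_minus sym_wt_sum)

lemma sym_wt_psubst:
  assumes "p \<in> sym_wt n" "\<And>r. r < n - 1 \<Longrightarrow> h r \<in> sym_wt n"
  shows "psubst h p \<in> sym_wt n"
proof -
  have "Poly_Mapping.keys p \<subseteq> {\<mu>. Poly_Mapping.keys \<mu> \<subseteq> {..<n - 1}}"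
    using assms(1) by (auto simp: sym_wt_def)
  then show ?thesis
  proof (induction p rule: frag_induction)
    case (one \<mu>) then show ?case using assms(2) by (auto simp: mon_subst_def)
  qed (auto simp: psubst_diff)
qed

lemma lookup_e_wt: assumes "k < n - 1"
  shows "Poly_Mapping.lookup (e_wt n j) (Poly_Mapping.single k 1) =
    (if nat ((j - 1) mod int n) < n - 1 then (if k = nat ((j - 1) mod int n) then 1 else 0) else -
      1)"
proof -
  have s: "Poly_Mapping.single r (Suc 0) = Poly_Mapping.single k (Suc 0) \<longleftrightarrow> r = k" for r k :: nat
    by (metis lookup_single_eq lookup_single_not_eq nat.distinct(1))
  have m: "Poly_Mapping.lookup (mvar r) (Poly_Mapping.single k 1) = (if r = k then 1 else 0)" for r
    by (auto simp: mvar_def lookup_single when_def s)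
  show ?thesis
  proof (cases "nat ((j - 1) mod int n) < n - 1")
    case True
    then have "e_wt n j = mvar (nat ((j - 1) mod int n))" by (simp only: e_wt_def Let_def if_True)
    then show ?thesis using True m[of "nat ((j - 1) mod int n)"] by auto
  next
    case False
    then have "e_wt n j = - (\<Sum>r<n - 1. mvar r)" by (simp only: e_wt_def Let_def if_False)
    moreover have "(\<Sum>r<n - 1. Poly_Mapping.lookup (mvar r) (Poly_Mapping.single k 1)) = 1"
      unfolding m using assms by (simp add: sum.delta)
    ultimately show ?thesis using False by (simp only: lookup_uminus lookup_sum if_False)
  qed
qed

lemma lookup_0_e_wt: "Poly_Mapping.lookup (e_wt n j) 0 = 0"
proof -
  have "Poly_Mapping.single r (Suc 0) \<noteq> 0" for r :: nat
    by (metis lookup_single_eq lookup_zero nat.distinct(1))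
  then have "Poly_Mapping.lookup (mvar r) 0 = 0" for r
    by (simp add: mvar_def lookup_single when_def)
  then show ?thesis by (simp add: e_wt_def Let_def lookup_sum)
qed

context affine_symmetric begin

text \<open>The variable X_k has coefficient 1 in one weight and 0 or -1 in the other. This also
  separates e_1 from e_2 = - e_1 when n = 2.\<close>

lemma e_wt_neq:
  assumes "nat ((i - 1) mod int n) = k" "nat ((j - 1) mod int n) \<noteq> k" "k < n - 1"
  shows "e_wt n i \<noteq> e_wt n j"
proof -
  have "Poly_Mapping.lookup (e_wt n i) (Poly_Mapping.single k 1) = 1"
    unfolding lookup_e_wt[OF assms(3)] assms(1) using assms(3) by (simp only: if_True refl)
  moreover have "Poly_Mapping.lookup (e_wt n j) (Poly_Mapping.single k 1) \<noteq> 1"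
    unfolding lookup_e_wt[OF assms(3)] using assms(2) by simp
  ultimately show ?thesis by (intro notI) simp
qed

lemma e_wt_inj: assumes "e_wt n i = e_wt n j" shows "i \<simeq> j"
proof -
  define r r' where "r = nat ((i - 1) mod int n)" and "r' = nat ((j - 1) mod int n)"
  have lt: "r < n" "r' < n" using n2 by (auto simp: r_def r'_def nat_less_iff)
  have "r = r'"
  proof (rule ccontr)
    assume ne: "r \<noteq> r'"
    then consider "r < n - 1" | "r' < n - 1" using lt by linarith
    then show False
    proof cases
      case 1
      show ?thesis
        by (rule notE[OF e_wt_neq[OF r_def[symmetric] _ 1] assms]) (use ne in \<open>simp add: r'_def\<close>)
    next
      case 2
      show ?thesis
        by (rule notE[OF e_wt_neq[OF r'_def[symmetric] _ 2] assms[symmetric]]) (use ne in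
          \<open>simp add: r_def\<close>)
    qed
  qed
  have "0 \<le> (i - 1) mod int n" "0 \<le> (j - 1) mod int n" using n2 by simp_all
  from iffD1[OF eq_nat_nat_iff[OF this]] \<open>r = r'\<close> have "(i - 1) mod int n = (j - 1) mod int n"
    unfolding r_def r'_def .
  then have "i - 1 \<simeq> j - 1" by (simp add: cong_def)
  then have "i - 1 + 1 \<simeq> j - 1 + 1" by (simp only: ceq_Suc_iff)
  then show ?thesis by simp
qed

text \<open>\<^const>\<open>act_sym\<close> is invertible only on \<^term>\<open>sym_wt n\<close>; fixing the surplus variables instead of
  substituting for them gives automorphisms of the whole polynomial ring.\<close>

definition poly_act :: "(int \<Rightarrow> int) \<Rightarrow> mpol \<Rightarrow> mpol" where
  "poly_act w = psubst (\<lambda>r. if r < n - 1 then e_wt n (w (int r + 1)) else mvar r)"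

lemma act_sym_psubst: "act_sym n w = psubst (\<lambda>r. e_wt n (w (int r + 1)))"
  by (simp add: act_sym_def psubst_def mon_subst_def[abs_def])

lemma poly_act_act_sym: "p \<in> sym_wt n \<Longrightarrow> poly_act w p = act_sym n w p"
  unfolding poly_act_def act_sym_psubst by (rule psubst_cong_sym) auto

lemma poly_act_e_wt: "w \<in> W \<Longrightarrow> poly_act w (e_wt n j) = e_wt n (w j)"
  using poly_act_act_sym[OF sym_wt_e_wt] act_sym_e_wt[of n w j] n2 by simp

lemma poly_act_comp: assumes "v \<in> W" shows "poly_act v (poly_act w p) = poly_act (v \<circ> w) p"
proof -
  have h: "(\<lambda>r. poly_act v (if r < n - 1 then e_wt n (w (int r + 1)) else mvar r)) =
     (\<lambda>r. if r < n - 1 then e_wt n ((v \<circ> w) (int r + 1)) else mvar r)"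
    using poly_act_e_wt[OF assms] by (auto simp: poly_act_def fun_eq_iff)
  show ?thesis unfolding poly_act_def[of w] poly_act_def[of "v \<circ> w"] h[symmetric]
    unfolding poly_act_def psubst_psubst ..
qed

lemma poly_act_id: "poly_act id p = p"
proof -
  have "(\<lambda>r. if r < n - 1 then e_wt n (id (int r + 1)) else mvar r) = mvar"
    using e_wt_of_nat[of _ n] by (auto simp: fun_eq_iff)
  then show ?thesis unfolding poly_act_def by (simp only: psubst_id)
qed

lemma poly_act_eq_0_iff: assumes "w \<in> W" shows "poly_act w p = 0 \<longleftrightarrow> p = 0"
proof
  assume "poly_act w p = 0"
  then have "poly_act (inv w) (poly_act w p) = 0" by (simp add: poly_act_def)
  moreover have "inv w \<circ> w = id" using W_pos(2)[OF assms] by (simp add: fun_eq_iff)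
  ultimately show "p = 0" using poly_act_comp[of "inv w" w p] assms poly_act_id by simp
qed (simp add: poly_act_def)

lemma poly_act_mult: "poly_act w (p * q) = poly_act w p * poly_act w q"
  and poly_act_add: "poly_act w (p + q) = poly_act w p + poly_act w q"
  and poly_act_1: "poly_act w 1 = 1"
  by (simp_all add: poly_act_def psubst_mult psubst_add)

lemma poly_act_sym: "p \<in> sym_wt n \<Longrightarrow> poly_act w p \<in> sym_wt n"
  unfolding poly_act_def by (rule sym_wt_psubst) auto

text \<open>Unlike \<open>act_frac\<close>, this acts on the fraction field of the whole polynomial
  ring, with homomorphism laws free of membership conditions; \<open>act_frac_frac_act\<close> gives
  the agreement on \<open>frac_wt n\<close>.\<close>

definition frac_act :: "(int \<Rightarrow> int) \<Rightarrow> mpol fract \<Rightarrow> mpol fract" where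
  "frac_act w q = (SOME r. \<exists>a b. b \<noteq> 0 \<and> q = Fr a b \<and> r = Fr (poly_act w a) (poly_act w b))"

lemma frac_act_Fract: assumes w: "w \<in> W" and b: "b \<noteq> 0"
  shows "frac_act w (Fr a b) = Fr (poly_act w a) (poly_act w b)"
  unfolding frac_act_def
proof (rule some_equality)
  show "\<exists>a' b'. b' \<noteq> 0 \<and> Fr a b = Fr a' b' \<and>
      Fr (poly_act w a) (poly_act w b) = Fr (poly_act w a') (poly_act w b')"
    using b by blast
  fix r assume "\<exists>a' b'. b' \<noteq> 0 \<and> Fr a b = Fr a' b' \<and> r = Fr (poly_act w a') (poly_act w b')"
  then obtain a' b' where h: "b' \<noteq> 0" "Fr a b = Fr a' b'" "r = Fr (poly_act w a') (poly_act w b')"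
    by blast
  then have "poly_act w a * poly_act w b' = poly_act w a' * poly_act w b"
    using b by (simp add: eq_fract poly_act_mult[symmetric])
  then show "r = Fr (poly_act w a) (poly_act w b)"
    using h b w by (simp add: eq_fract poly_act_eq_0_iff)
qed

lemma frac_act_add: assumes "w \<in> W" shows "frac_act w (p + q) = frac_act w p + frac_act w q"
  by (cases p; cases q) (simp add: frac_act_Fract assms poly_act_eq_0_iff poly_act_mult
    poly_act_add)

lemma frac_act_mult: assumes "w \<in> W" shows "frac_act w (p * q) = frac_act w p * frac_act w q"
  by (cases p; cases q) (simp add: frac_act_Fract assms poly_act_mult)

lemma frac_act_1: "w \<in> W \<Longrightarrow> frac_act w 1 = 1"
  by (simp add: One_fract_def frac_act_Fract poly_act_1)

lemma frac_act_0: "w \<in> W \<Longrightarrow> frac_act w 0 = 0"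
  using frac_act_add[of w 0 0] by (simp only: add_0_right add_cancel_right_right)

lemma frac_act_diff: assumes "w \<in> W" shows "frac_act w (p - q) = frac_act w p - frac_act w q"
  using frac_act_add[OF assms, of "p - q" q] by (simp add: algebra_simps)

lemma frac_act_inverse: assumes "w \<in> W" shows "frac_act w (inverse q) = inverse (frac_act w q)"
proof (cases "q = 0")
  case False
  then have "frac_act w q * frac_act w (inverse q) = 1"
    using frac_act_mult[OF assms, of q "inverse q"] assms by (simp add: frac_act_1)
  then show ?thesis by (rule inverse_unique[symmetric])
qed (use assms in \<open>simp add: frac_act_0\<close>)

lemma frac_act_comp: assumes "v \<in> W" "w \<in> W" shows "frac_act v (frac_act w q) = frac_act (v \<circ> w) q"
  by (cases q) (use assms in \<open>simp add: frac_act_Fract poly_act_eq_0_iff poly_act_comp\<close>)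

section \<open>The fraction field of Sym P\<close>

definition Fw :: "mpol fract set" where "Fw = frac_wt n"

lemma FwI: "a \<in> sym_wt n \<Longrightarrow> b \<in> sym_wt n \<Longrightarrow> b \<noteq> 0 \<Longrightarrow> Fr a b \<in> Fw"
  unfolding Fw_def frac_wt_def by blast

lemma FwE: assumes "q \<in> Fw" obtains a b where "q = Fr a b" "a \<in> sym_wt n" "b \<in> sym_wt n" "b \<noteq> 0"
  using assms unfolding Fw_def frac_wt_def by blast

lemma Fw_sym [intro]: "a \<in> sym_wt n \<Longrightarrow> Fr a 1 \<in> Fw"
  by (rule FwI) auto

lemma Fw_0 [simp]: "0 \<in> Fw" and Fw_1 [simp]: "1 \<in> Fw"
  using Fw_sym[of 0] Fw_sym[of 1] by (simp_all add: Zero_fract_def One_fract_def)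

lemma Fw_add [intro]: assumes "p \<in> Fw" "q \<in> Fw" shows "p + q \<in> Fw"
proof -
  obtain a b where 1: "p = Fr a b" "a \<in> sym_wt n" "b \<in> sym_wt n" "b \<noteq> 0"
    using assms(1) by (rule FwE)
  obtain c d where 2: "q = Fr c d" "c \<in> sym_wt n" "d \<in> sym_wt n" "d \<noteq> 0"
    using assms(2) by (rule FwE)
  have "b * d \<noteq> 0" using 1 2 by simp
  then show ?thesis using 1 2 by (simp add: FwI sym_wt_mult sym_wt_add)
qed

lemma Fw_mult [intro]: assumes "p \<in> Fw" "q \<in> Fw" shows "p * q \<in> Fw"
proof -
  obtain a b where 1: "p = Fr a b" "a \<in> sym_wt n" "b \<in> sym_wt n" "b \<noteq> 0"
    using assms(1) by (rule FwE)
  obtain c d where 2: "q = Fr c d" "c \<in> sym_wt n" "d \<in> sym_wt n" "d \<noteq> 0"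
    using assms(2) by (rule FwE)
  have "b * d \<noteq> 0" using 1 2 by simp
  then show ?thesis using 1 2 by (simp add: FwI sym_wt_mult sym_wt_add)
qed

lemma Fw_minus [intro]: assumes "p \<in> Fw" shows "- p \<in> Fw"
  using assms by (rule FwE) (auto intro!: FwI)

lemma Fw_diff [intro]: "p \<in> Fw \<Longrightarrow> q \<in> Fw \<Longrightarrow> p - q \<in> Fw"
  using Fw_add[of p "- q"] Fw_minus[of q] by simp

lemma Fw_inverse [intro]: assumes "p \<in> Fw" shows "inverse p \<in> Fw"
  using assms
proof (rule FwE)
  fix a b assume h: "p = Fr a b" "a \<in> sym_wt n" "b \<in> sym_wt n" "b \<noteq> 0"
  show ?thesis
  proof (cases "a = 0")
    case True then have "p = 0" using h by (simp add: eq_fract Zero_fract_def)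
    then show ?thesis by simp
  qed (use h in \<open>auto intro!: FwI\<close>)
qed

lemma Fw_sum [intro]: "(\<And>i. i \<in> I \<Longrightarrow> p i \<in> Fw) \<Longrightarrow> (\<Sum>i\<in>I. p i) \<in> Fw"
  by (induction I rule: infinite_finite_induct) auto

lemma Fw_frac_act: assumes "w \<in> W" "q \<in> Fw" shows "frac_act w q \<in> Fw"
  using assms(2)
  by (rule FwE) (auto simp: frac_act_Fract assms(1) poly_act_eq_0_iff intro!: FwI poly_act_sym)

lemma act_frac_frac_act: assumes w: "w \<in> W" and q: "q \<in> Fw" shows "act_frac n w q = frac_act w q"
  unfolding act_frac_def
proof (rule the_equality)
  show "\<forall>a\<in>sym_wt n. \<forall>b\<in>sym_wt n. b \<noteq> 0 \<longrightarrow> q = Fr a b \<longrightarrow>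
      frac_act w q = Fr (act_sym n w a) (act_sym n w b)"
    using w by (auto simp: frac_act_Fract poly_act_act_sym)
  fix r assume h: "\<forall>a\<in>sym_wt n. \<forall>b\<in>sym_wt n. b \<noteq> 0 \<longrightarrow> q = Fr a b \<longrightarrow>
      r = Fr (act_sym n w a) (act_sym n w b)"
  obtain a b where ab: "q = Fr a b" "a \<in> sym_wt n" "b \<in> sym_wt n" "b \<noteq> 0" using q by (rule FwE)
  then show "r = frac_act w q" using h w by (auto simp: frac_act_Fract poly_act_act_sym)
qed

definition E :: "int \<Rightarrow> mpol fract" where "E j = Fr (e_wt n j) 1"

lemma E_Fw [simp, intro]: "E j \<in> Fw" unfolding E_def by (rule Fw_sym[OF sym_wt_e_wt])
lemma E_ceq: "i \<simeq> j \<Longrightarrow> E i = E j" by (simp add: E_def e_wt_cong)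
lemma E_eq_iff: "E i = E j \<longleftrightarrow> i \<simeq> j"
proof
  assume "E i = E j"
  then have "e_wt n i = e_wt n j" by (simp add: E_def eq_fract)
  then show "i \<simeq> j" by (rule e_wt_inj)
qed (rule E_ceq)
lemma frac_act_E: "w \<in> W \<Longrightarrow> frac_act w (E j) = E (w j)"
  by (simp add: E_def frac_act_Fract poly_act_1 poly_act_e_wt)

lemma alpha_E: "Fr (alpha n i) 1 = E i - E (i + 1)"
  by (simp add: E_def alpha_def)

end

section \<open>The twisted group algebra\<close>

context affine_symmetric begin

lemma frac_act_id: "frac_act id q = q"
  by (cases q) (simp add: frac_act_Fract poly_act_id)

abbreviation sg :: "int \<Rightarrow> mpol fract \<Rightarrow> mpol fract" where "sg i \<equiv> frac_act (s i)"

lemma sg_sg [simp]: "sg i (sg i q) = q"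
  using frac_act_comp[OF s_W s_W, of i i q] by (simp add: frac_act_id)

lemmas sg_hom = frac_act_mult[OF s_W] frac_act_diff[OF s_W] frac_act_add[OF s_W] frac_act_0[OF s_W]
  frac_act_1[OF s_W] frac_act_inverse[OF s_W] frac_act_E[OF s_W]

definition alpha_inv :: "int \<Rightarrow> mpol fract" where "alpha_inv i = inverse (E i - E (i + 1))"

lemma alpha_inv_ceq: "i \<simeq> j \<Longrightarrow> alpha_inv i = alpha_inv j"
  using E_ceq[of i j] E_ceq[of "i + 1" "j + 1"] ceq_Suc_iff[of i j] by (simp add: alpha_inv_def)

lemma E_Suc: "E i - E (i + 1) \<noteq> 0"
  using E_eq_iff not_ceq_Suc by simp

lemma alpha_inv_nz: "alpha_inv i \<noteq> 0" using E_Suc by (simp add: alpha_inv_def)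
lemma alpha_inv_Fw [intro, simp]: "alpha_inv i \<in> Fw"
  unfolding alpha_inv_def by (intro Fw_inverse Fw_diff E_Fw)

text \<open>Left multiplication by the group element \<open>s i\<close> on coefficient functions;
  \<open>Aop\<close> is left multiplication by A_i.\<close>

definition Sop :: "int \<Rightarrow> ((int \<Rightarrow> int) \<Rightarrow> mpol fract) \<Rightarrow> (int \<Rightarrow> int) \<Rightarrow> mpol fract" where
  "Sop i f x = sg i (f (s i \<circ> x))"

definition Aop :: "int \<Rightarrow> ((int \<Rightarrow> int) \<Rightarrow> mpol fract) \<Rightarrow> (int \<Rightarrow> int) \<Rightarrow> mpol fract" where
  "Aop i f x = alpha_inv i * (f x - Sop i f x)"

abbreviation A_val :: "int list \<Rightarrow> (int \<Rightarrow> int) \<Rightarrow> mpol fract" where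
  "A_val is \<equiv> Poly_Mapping.lookup (A_word n is)"

lemma A_val_Nil: "A_val [] x = (if x = id then 1 else 0)"
  by (auto simp: A_word_def lookup_single when_def)

lemma s_neq_id: "s i \<noteq> id"
proof
  assume "s i = id"
  then have "s i i = id i" by (rule fun_cong)
  then show False by simp
qed

lemma A_gen_alpha_inv: "A_gen n i =
    Poly_Mapping.single id (alpha_inv i) - Poly_Mapping.single (s i) (alpha_inv i)"
  by (simp add: A_gen_def Let_def alpha_E alpha_inv_def)

lemma lookup_tw_mult_A_gen:
  assumes "\<And>x. Poly_Mapping.lookup f x \<in> Fw"
  shows "Poly_Mapping.lookup (tw_mult n (A_gen n i) f) x = Aop i (Poly_Mapping.lookup f) x"
proof -
  let ?f = "Poly_Mapping.lookup f"
  let ?A = "Poly_Mapping.lookup (A_gen n i)"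
  have A: "?A id = alpha_inv i" "?A (s i) = - alpha_inv i" "\<And>v. v \<noteq> id \<Longrightarrow> v \<noteq> s i \<Longrightarrow> ?A v = 0"
    using s_neq_id[of i] by (auto simp: A_gen_alpha_inv lookup_minus lookup_single when_def)
  \<comment> \<open>Used for the involutions id and \<open>s i\<close>, so that the coefficient of x
    in the product comes from w = v x.\<close>
  have inner:
    "(\<Sum>w\<in>Poly_Mapping.keys f. Poly_Mapping.lookup
      (Poly_Mapping.single (v \<circ> w) (?A v * act_frac n v (?f w))) x)
     = ?A v * frac_act v (?f (v \<circ> x))" if v: "v \<in> W" "v \<circ> v = id" for v
  proof -
    have eq: "v \<circ> w = x \<longleftrightarrow> w = v \<circ> x" for w
    proof
      assume "v \<circ> w = x"
      then have "v \<circ> v \<circ> w = v \<circ> x" by (simp add: comp_assoc)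
      then show "w = v \<circ> x" unfolding v(2) by simp
    next
      assume "w = v \<circ> x"
      then have "v \<circ> w = v \<circ> v \<circ> x" by (simp add: comp_assoc)
      then show "v \<circ> w = x" unfolding v(2) by simp
    qed
    have "(\<Sum>w\<in>Poly_Mapping.keys f. Poly_Mapping.lookup
        (Poly_Mapping.single (v \<circ> w) (?A v * act_frac n v (?f w))) x)
      = (\<Sum>w\<in>Poly_Mapping.keys f. if w = v \<circ> x then ?A v * frac_act v (?f w) else 0)"
      using act_frac_frac_act[OF v(1) assms]
        by (intro sum.cong) (auto simp: lookup_single when_def eq)
    also have "\<dots> = ?A v * frac_act v (?f (v \<circ> x))"
      by (simp add: sum.delta' in_keys_iff frac_act_0[OF v(1)])
    finally show ?thesis .
  qed
  have two: "(\<Sum>v\<in>{id, s i}. h v) = h id + h (s i)" for h :: "(int \<Rightarrow> int) \<Rightarrow> twisted"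
    using s_neq_id[of i] by (subst sum.insert) auto
  have "tw_mult n (A_gen n i) f = (\<Sum>v\<in>{id, s i}. \<Sum>w\<in>Poly_Mapping.keys f.
     Poly_Mapping.single (v \<circ> w) (?A v * act_frac n v (?f w)))"
    unfolding tw_mult_def
    by (rule sum.mono_neutral_left) (use A(3) in \<open>auto simp: in_keys_iff\<close>)
  also have "\<dots> =
      (\<Sum>w\<in>Poly_Mapping.keys f. Poly_Mapping.single (id \<circ> w) (?A id * act_frac n id (?f w)))
     + (\<Sum>w\<in>Poly_Mapping.keys f. Poly_Mapping.single (s i \<circ> w) (?A (s i) * act_frac n (s i) (?f w)))"
    by (rule two)
  finally have eq: "tw_mult n (A_gen n i) f =
      (\<Sum>w\<in>Poly_Mapping.keys f. Poly_Mapping.single (id \<circ> w) (?A id * act_frac n id (?f w)))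
     + (\<Sum>w\<in>Poly_Mapping.keys f. Poly_Mapping.single (s i \<circ> w) (?A (s i) * act_frac n (s i) (?f
       w)))" .
  have "Poly_Mapping.lookup (tw_mult n (A_gen n i) f) x =
      ?A id * frac_act id (?f (id \<circ> x)) + ?A (s i) * frac_act (s i) (?f (s i \<circ> x))"
    unfolding eq lookup_add lookup_sum inner[OF id_W id_o] inner[OF s_W s_comp_s(1)] ..
  then show ?thesis unfolding A by (simp add: Aop_def Sop_def frac_act_id algebra_simps)
qed

lemma Aop_Fw: "(\<And>x. f x \<in> Fw) \<Longrightarrow> Aop i f x \<in> Fw"
  unfolding Aop_def Sop_def by (intro Fw_mult Fw_diff alpha_inv_Fw Fw_frac_act s_W)

text \<open>Membership in \<open>Fw\<close> and the recursion are proved together, since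
  \<open>act_frac\<close> is known to agree with \<open>frac_act\<close> only on that field.\<close>

lemma A_val_Cons_Fw: "(\<forall>x. A_val is x \<in> Fw) \<and> (\<forall>i. A_val (i # is) = Aop i (A_val is))"
proof (induction "is")
  case Nil
  have "A_val [] x \<in> Fw" for x by (simp add: A_val_Nil)
  moreover from this have "A_val [i] = Aop i (A_val [])" for i
    by (intro ext) (simp add: A_word_def lookup_tw_mult_A_gen)
  ultimately show ?case by blast
next
  case (Cons j "is")
  then have "A_val (j # is) x \<in> Fw" for x using Aop_Fw by simp
  moreover from this have "A_val (i # j # is) = Aop i (A_val (j # is))" for i
    using lookup_tw_mult_A_gen[of "A_word n (j # is)" i] by (intro ext) (simp add: A_word_def)
  ultimately show ?case by blast
qed

lemma A_val_Fw [simp]: "A_val is x \<in> Fw" and A_val_Cons: "A_val (i # is) = Aop i (A_val is)"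
  using A_val_Cons_Fw by blast+

section \<open>Nilpotence, commutation and braid relations\<close>

lemma Aop_ceq: assumes "i \<simeq> j" shows "Aop i = Aop j"
  by (intro ext) (simp add: Aop_def Sop_def alpha_inv_ceq[OF assms] s_ceq[OF assms])

lemma Sop_mult: "Sop i (\<lambda>x. q * f x) = (\<lambda>x. sg i q * Sop i f x)"
  by (simp add: Sop_def sg_hom fun_eq_iff)
lemma Sop_diff: "Sop i (\<lambda>x. f x - h x) = (\<lambda>x. Sop i f x - Sop i h x)"
  by (simp add: Sop_def sg_hom fun_eq_iff)
lemma Sop_Sop: "Sop i (Sop i f) = f"
  by (simp add: Sop_def fun_eq_iff)

lemma Aop_expand: "Aop i f = (\<lambda>x. alpha_inv i * (f x - Sop i f x))"
  by (simp add: Aop_def fun_eq_iff)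

lemma sg_alpha_inv: "sg i (alpha_inv j) = inverse (E (s i j) - E (s i (j + 1)))"
  by (simp add: alpha_inv_def sg_hom)

lemma sg_alpha_inv_same: "sg i (alpha_inv i) = - alpha_inv i"
proof -
  have "E (i + 1) - E i = - (E i - E (i + 1))" by simp
  then have "inverse (E (i + 1) - E i) = - alpha_inv i"
    unfolding alpha_inv_def by (simp only: inverse_minus_eq)
  then show ?thesis unfolding sg_alpha_inv s_i .
qed

lemma Aop_Aop: "Aop i (Aop i f) = (\<lambda>x. 0)"
  unfolding Aop_expand Sop_mult Sop_diff Sop_Sop sg_alpha_inv_same by (simp add: algebra_simps)

lemma s_s_far:
  assumes "\<not> i \<simeq> j" "\<not> i \<simeq> j + 1" "\<not> j \<simeq> i + 1"
  shows "s i j = j" "s i (j + 1) = j + 1" "s i \<circ> s j = s j \<circ> s i"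
proof -
  have "\<not> j \<simeq> i" "\<not> j + 1 \<simeq> i" "\<not> j + 1 \<simeq> i + 1" using assms cong_sym ceq_Suc_iff by blast+
  then show "s i j = j" "s i (j + 1) = j + 1" using assms by (auto intro!: s_other)
  then show "s i \<circ> s j = s j \<circ> s i"
    using comp_t[OF s_W not_ceq_Suc(1), of i j] by (simp add: s_eq_t)
qed

lemma Sop_comm:
  assumes "s i \<circ> s j = s j \<circ> s i" shows "Sop i (Sop j f) = Sop j (Sop i f)"
proof
  fix x :: "int \<Rightarrow> int"
  have "s j \<circ> (s i \<circ> x) = s i \<circ> (s j \<circ> x)" unfolding comp_assoc[symmetric] assms ..
  then show "Sop i (Sop j f) x = Sop j (Sop i f) x"
    unfolding Sop_def by (simp only: frac_act_comp[OF s_W s_W] assms)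
qed

lemma Aop_far:
  assumes "\<not> i \<simeq> j" "\<not> i \<simeq> j + 1" "\<not> j \<simeq> i + 1"
  shows "Aop i (Aop j f) = Aop j (Aop i f)"
proof -
  have ji: "\<not> j \<simeq> i" using assms cong_sym by blast
  have "sg i (alpha_inv j) = alpha_inv j" "sg j (alpha_inv i) = alpha_inv i"
    unfolding sg_alpha_inv s_s_far(1,2)[OF assms] s_s_far(1,2)[OF ji assms(3,2)]
      by (simp_all add: alpha_inv_def)
  then show ?thesis
    unfolding Aop_expand Sop_mult Sop_diff Sop_comm[OF s_s_far(3)[OF assms]]
      by (simp add: algebra_simps)
qed

lemma s_braid:
  assumes "n \<ge> 3"
  shows "s i (i + 2) = i + 2" "s (i + 1) i = i"
    "s i \<circ> s (i + 1) \<circ> s i = s (i + 1) \<circ> s i \<circ> s (i + 1)"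
proof -
  have ne: "\<not> i + 2 \<simeq> i" "\<not> i + 2 \<simeq> i + 1" "\<not> i \<simeq> i + 1" "\<not> i \<simeq> i + 2"
    using assms not_ceq_Suc[of i] not_ceq_Suc[of "i +
        1", unfolded add.assoc one_add_one] ceq_less[of i "i + 2"] by (auto dest: cong_sym)
  have ne': "\<not> i + 1 \<simeq> i + 2" using ne cong_sym by blast
  show 1: "s i (i + 2) = i + 2" using ne by (intro s_other)
  show 2: "s (i + 1) i = i"
    by (rule s_other) (use ne in \<open>simp_all only: add.assoc one_add_one not_False_eq_True\<close>)
  have "s i \<circ> t (i + 1) (i + 2) = t i (i + 2) \<circ> s i"
    using comp_t[OF s_W ne', of i] 1 by simp
  moreover have "s (i + 1) = t (i + 1) (i + 2)"
    using s_eq_t[of "i + 1"] by (simp only: add.assoc one_add_one)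
  ultimately have "s i \<circ> s (i + 1) \<circ> s i = t i (i + 2) \<circ> s i \<circ> s i"
    by (simp only:)
  also have "\<dots> = t i (i + 2)" by (simp only: comp_assoc s_comp_s(1) comp_id)
  also have "\<dots> = t i (i + 2) \<circ> s (i + 1) \<circ> s (i + 1)" by (simp only: comp_assoc s_comp_s(1) comp_id)
  also have "t i (i + 2) \<circ> s (i + 1) = s (i + 1) \<circ> t i (i + 1)"
    using comp_t[OF s_W ne(3), of "i + 1"] 2 s_i(1)[of "i + 1", unfolded add.assoc one_add_one]
    by (simp only:)
  finally show "s i \<circ> s (i + 1) \<circ> s i = s (i + 1) \<circ> s i \<circ> s (i + 1)"
    by (simp only: s_eq_t[of i, symmetric])
qed

text \<open>\<open>a\<close>, \<open>b\<close> and \<open>c\<close> are the inverses of the positive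
  roots \<alpha>, \<beta> and \<alpha> + \<beta> of a subsystem of type A2, permuted up to sign by
  the two reflections. Both identities \<open>r\<close> are the partial fractions of 1 / (\<alpha>
  \<beta>); after them the two sides have equal expansions.\<close>

lemma Aop_braid:
  assumes n3: "n \<ge> 3"
  shows "Aop i (Aop (i + 1) (Aop i f)) = Aop (i + 1) (Aop i (Aop (i + 1) f))"
proof
  fix x :: "int \<Rightarrow> int"
  let ?j = "i + 1"
  define a b c where "a = alpha_inv i" and "b = alpha_inv ?j" and "c = inverse (E i - E (i + 2))"
  have ne: "\<not> i \<simeq> i + 2" using n3 ceq_less[of i "i + 2"] by auto
  have p: "E i - E ?j \<noteq> 0" "E ?j - E (i + 2) \<noteq> 0" "E i - E (i + 2) \<noteq> 0"
    using E_Suc[of i] E_Suc[of ?j, unfolded add.assoc one_add_one] ne E_eq_iff[of i "i + 2"] by auto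
  have abc: "a = inverse (E i - E ?j)" "b = inverse (E ?j - E (i + 2))"
    "c = inverse (E i - E (i + 2))"
    by (simp_all only: a_def b_def c_def alpha_inv_def add.assoc one_add_one)
  have r: "a * (b - c) = b * c" "b * (a - c) = a * c"
    unfolding abc using p by (simp_all add: field_simps)
  have sc: "sg i a = - a" "sg ?j b = - b" "sg i b = c" "sg ?j a = c" "sg i c = b" "sg ?j c = a"
  proof -
    show "sg i a = - a" "sg ?j b = - b" unfolding a_def b_def by (rule sg_alpha_inv_same)+
    show ib: "sg i b = c"
      unfolding b_def c_def sg_alpha_inv add.assoc one_add_one s_i(2) s_braid(1)[OF n3] ..
    show ja: "sg ?j a = c"
      unfolding a_def c_def sg_alpha_inv s_braid(2)[OF n3] s_i(1)[of ?j, unfolded add.assoc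
        one_add_one] ..
    show "sg i c = b" using sg_sg[of i b] unfolding ib .
    show "sg ?j c = a" using sg_sg[of ?j a] unfolding ja .
  qed
  let ?Si = "Sop i" and ?Sj = "Sop ?j"
  have SSS: "?Si (?Sj (?Si f)) = ?Sj (?Si (?Sj f))"
  proof
    fix x :: "int \<Rightarrow> int"
    have "s i \<circ> (s ?j \<circ> (s i \<circ> x)) = s ?j \<circ> (s i \<circ> (s ?j \<circ> x))"
      unfolding comp_assoc[symmetric] s_braid(3)[OF n3] ..
    moreover have "sg i (sg ?j (sg i q)) = sg ?j (sg i (sg ?j q))" for q
      by (simp only: frac_act_comp[OF s_W s_W] frac_act_comp[OF comp_W[OF s_W s_W] s_W]
        frac_act_comp[OF s_W comp_W[OF s_W s_W]]
          comp_assoc[symmetric] s_braid(3)[OF n3])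
    ultimately show "?Si (?Sj (?Si f)) x = ?Sj (?Si (?Sj f)) x" by (simp only: Sop_def)
  qed
  have L: "Aop i (Aop ?j (Aop i f)) x = a * (a * (b - c)) * (f x - ?Si f x)
     - a * (b * c) * (?Sj f x - ?Sj (?Si f) x - ?Si (?Sj f) x + ?Si (?Sj (?Si f)) x)"
    unfolding Aop_expand Sop_mult Sop_diff Sop_Sop a_def[symmetric] b_def[symmetric] sg_hom(1) sc
    by (simp add: algebra_simps)
  have R: "Aop ?j (Aop i (Aop ?j f)) x = b * (b * (a - c)) * (f x - ?Sj f x)
     - b * (a * c) * (?Si f x - ?Si (?Sj f) x - ?Sj (?Si f) x + ?Sj (?Si (?Sj f)) x)"
    unfolding Aop_expand Sop_mult Sop_diff Sop_Sop a_def[symmetric] b_def[symmetric] sg_hom(1) sc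
    by (simp add: algebra_simps)
  show "Aop i (Aop ?j (Aop i f)) x = Aop ?j (Aop i (Aop ?j f)) x"
    unfolding L R r SSS by (simp add: algebra_simps)
qed

section \<open>Independence of the reduced word, and triangularity\<close>

lemma reduced_Nil_iff: "reduced_word n [] u \<longleftrightarrow> u = id"
  by (auto simp: reduced_word_def len_id)

lemma reduced_W: "reduced_word n is u \<Longrightarrow> u \<in> W"
  by (auto simp: reduced_word_def)

lemma reduced_tail:
  assumes "reduced_word n (i # is) u"
  shows "reduced_word n is (s i \<circ> u)" "\<not> asc i u"
proof -
  have u: "u \<in> W" "s i \<circ> word_elt n is = u" "Suc (length is) = len u"
    using assms reduced_W by (auto simp: reduced_word_def)
  have w: "word_elt n is = s i \<circ> u" unfolding u(2)[symmetric] by (simp only: s_comp_s(2))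
  have le: "len (s i \<circ> u) \<le> length is" using len_word_le[of "is"] w by simp
  show d: "\<not> asc i u" using len_s_asc[OF u(1), of i] le u(3) by linarith
  show "reduced_word n is (s i \<circ> u)"
    using w u(3) len_s_desc[OF u(1) d] by (simp add: reduced_word_def)
qed

lemma reduced_Cons:
  assumes "reduced_word n is v" "asc i v" shows "reduced_word n (i # is) (s i \<circ> v)"
  using assms len_s_asc[OF reduced_W[OF assms(1)] assms(2)] by (simp add: reduced_word_def)

lemma asc_Suc: "asc (a + 1) u \<longleftrightarrow> pos u (a + 1) < pos u (a + 2)"
  unfolding asc_def add.assoc one_add_one ..

text \<open>Induction on the length. If the first letters are incongruent, both are descents of u,
  so u is the longest element of the subgroup generated by the two reflections times a shorter x.
  Reduced words through x begin with either letter, and the braid or commutation relation compares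
  them.\<close>

lemma A_val_reduced_unique:
  assumes "reduced_word n is u" "reduced_word n js u" shows "A_val is = A_val js"
  using assms
proof (induction "len u" arbitrary: u "is" js)
  case 0
  then have "is = []" "js = []" by (auto simp: reduced_word_def)
  then show ?case by simp
next
  case (Suc k)
  note u = reduced_W[OF Suc.prems(1)]
  obtain a is' b js' where ij: "is = a # is'" "js = b # js'"
    using Suc.prems Suc.hyps(2) by (cases "is"; cases js) (auto simp: reduced_word_def)
  note ra = reduced_tail[OF Suc.prems(1)[unfolded ij]]
    and rb = reduced_tail[OF Suc.prems(2)[unfolded ij]]
  have ka: "k = len (s a \<circ> u)" "k = len (s b \<circ> u)"
    using len_s_desc[OF u ra(2)] len_s_desc[OF u rb(2)] Suc.hyps(2) by simp_all
  note IHa = Suc.hyps(1)[OF ka(1) ra(1)] and IHb = Suc.hyps(1)[OF ka(2) rb(1)]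
  have braid: "Aop a (A_val is') = Aop (a + 1) (A_val js')"
    if d: "\<not> asc a u" "\<not> asc (a + 1) u"
      and root_inv: "\<And>xs. reduced_word n xs (s a \<circ> u) \<Longrightarrow> A_val is' = A_val xs"
      and ib: "\<And>xs. reduced_word n xs (s (a + 1) \<circ> u) \<Longrightarrow> A_val js' = A_val xs" for a is' js'
  proof -
    have gt: "pos u (a + 2) < pos u (a + 1)" "pos u (a + 1) < pos u a"
      using d pos_inj[OF u, of a "a + 1"] pos_inj[OF u, of "a + 1" "a + 2"]
      by (auto simp: asc_def[of a] asc_Suc)
    \<comment> \<open>For n = 2 two neighbouring letters generate an infinite dihedral group; both
      being descents would put a + 2, the translate of a by one period, before a.\<close>
    have n3: "n \<ge> 3"
    proof (rule ccontr)
      assume "\<not> ?thesis"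
      then have "n = 2" using n2 by simp
      then show False using gt pos_shift[OF u, of a 1] by simp
    qed
    let ?b = "a + 1"
    define x where "x = s a \<circ> (s ?b \<circ> (s a \<circ> u))"
    have x': "x = s ?b \<circ> (s a \<circ> (s ?b \<circ> u))"
      unfolding x_def comp_assoc[symmetric] s_braid(3)[OF n3] ..
    have xW: "x \<in> W" using u by (simp add: x_def)
    obtain xs where xs: "reduced_word n xs x" using reduced_exists[OF xW] by blast
    have ps: "s a (a + 2) = a + 2" "s ?b a = a" "s a a = a + 1" "s a (a + 1) = a" "s ?b ?b = a + 2"
      "s ?b (a + 2) = a + 1"
      using s_braid(1,2)[OF n3, of a] s_i[of a] s_i[of ?b, unfolded add.assoc one_add_one]
      by (simp_all only:)
    have "asc a x" "asc ?b x" "asc ?b (s a \<circ> x)" "asc a (s ?b \<circ> x)"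
      using gt by (simp_all only: asc_def[of a] asc_Suc x_def pos_s comp_W s_W u ps)
    then have "reduced_word n (?b # a # xs) (s ?b \<circ> (s a \<circ> x))"
      "reduced_word n (a # ?b # xs) (s a \<circ> (s ?b \<circ> x))"
      using xs by (simp_all add: reduced_Cons)
    moreover have "s ?b \<circ> (s a \<circ> x) = s a \<circ> u" by (simp only: x_def s_comp_s(2))
    moreover have "s a \<circ> (s ?b \<circ> x) = s ?b \<circ> u" by (simp only: x' s_comp_s(2))
    ultimately have "A_val is' = A_val (?b # a # xs)" "A_val js' = A_val (a # ?b # xs)"
      using root_inv ib by simp_all
    then show ?thesis by (simp only: A_val_Cons Aop_braid[OF n3])
  qed
  have "Aop a (A_val is') = Aop b (A_val js')"
  proof (cases "a \<simeq> b")
    case True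
    have "A_val is' = A_val js'" by (rule IHa) (use rb(1) s_ceq[OF True] in simp)
    then show ?thesis by (simp add: Aop_ceq[OF True])
  next
    case ab: False
    show ?thesis
    proof (cases "b \<simeq> a + 1")
      case True
      have "\<not> asc (a + 1) u" using asc_ceq[OF u True] rb(2) by simp
      then show ?thesis
        using braid[OF ra(2) _ IHa, of js'] IHb Aop_ceq[OF True] s_ceq[OF True] by simp
    next
      case ba1: False
      show ?thesis
      proof (cases "a \<simeq> b + 1")
        case True
        have "\<not> asc (b + 1) u" using asc_ceq[OF u True] ra(2) by simp
        then show ?thesis
          using braid[OF rb(2) _ IHb, of is'] IHa Aop_ceq[OF True] s_ceq[OF True] by simp
      next
        case ab1: False
        note far = s_s_far[OF ab ab1 ba1]
        have ba: "\<not> b \<simeq> a" using ab cong_sym by blast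
        note far' = s_s_far[OF ba ba1 ab1]
        define x where "x = s b \<circ> (s a \<circ> u)"
        have x': "x = s a \<circ> (s b \<circ> u)" unfolding x_def comp_assoc[symmetric] far(3) ..
        have xW: "x \<in> W" using u by (simp add: x_def)
        obtain xs where xs: "reduced_word n xs x" using reduced_exists[OF xW] by blast
        have da: "asc a x" "asc b x"
          using ra(2) rb(2) u pos_inj[OF u, of a "a + 1"] pos_inj[OF u, of b "b + 1"]
          by (auto simp: asc_def x_def pos_s far far' not_less)
        then have "reduced_word n (b # xs) (s b \<circ> x)" "reduced_word n (a # xs) (s a \<circ> x)"
          using xs by (simp_all add: reduced_Cons)
        moreover have "s b \<circ> x = s a \<circ> u" by (simp only: x_def s_comp_s(2))
        moreover have "s a \<circ> x = s b \<circ> u" by (simp only: x' s_comp_s(2))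
        ultimately have "A_val is' = A_val (b # xs)" "A_val js' = A_val (a # xs)"
          using IHa IHb by simp_all
        then show ?thesis using Aop_far[OF ab ab1 ba1] by (simp only: A_val_Cons)
      qed
    qed
  qed
  then show ?case by (simp only: ij A_val_Cons)
qed

definition A_coef :: "(int \<Rightarrow> int) \<Rightarrow> (int \<Rightarrow> int) \<Rightarrow> mpol fract" where
  "A_coef u = Poly_Mapping.lookup (A_elt n u)"

lemma A_coef_reduced: assumes "reduced_word n is u" shows "A_coef u = A_val is"
proof -
  have "reduced_word n (SOME is. reduced_word n is u) u" using assms by (rule someI)
  then show ?thesis unfolding A_coef_def A_elt_def by (rule A_val_reduced_unique[OF _ assms])
qed

lemma A_coef_Fw [simp]: "A_coef u x \<in> Fw" by (simp add: A_coef_def A_elt_def)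

lemma A_coef_id: "A_coef id x = (if x = id then 1 else 0)"
  using A_coef_reduced[of "[]" id] A_val_Nil by (simp add: reduced_Nil_iff)

lemma A_coef_asc: assumes "u \<in> W" "asc i u" shows "A_coef (s i \<circ> u) = Aop i (A_coef u)"
proof -
  obtain "is" where "is": "reduced_word n is u" using reduced_exists[OF assms(1)] by blast
  then show ?thesis using A_coef_reduced[OF "is"] A_coef_reduced[OF reduced_Cons[OF "is" assms(2)]]
    by (simp only: A_val_Cons)
qed

lemma A_coef_desc: assumes "u \<in> W" "\<not> asc i u" shows "Aop i (A_coef u) = (\<lambda>x. 0)"
proof -
  have "asc i (s i \<circ> u)" using assms by (simp add: asc_s)
  then have "A_coef u = Aop i (A_coef (s i \<circ> u))" using A_coef_asc[of "s i \<circ> u" i] assms(1) by simp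
  then show ?thesis by (simp only: Aop_Aop)
qed

text \<open>Each letter contributes the identity or its reflection, so only the full product of the
  word can reach the maximal length.\<close>

lemma A_val_support:
  "A_val is x \<noteq> 0 \<Longrightarrow> x \<in> W \<and> len x \<le> length is \<and> (len x = length is \<longrightarrow> x = word_elt n is)"
proof (induction "is" arbitrary: x)
  case Nil
  then have x: "x = id" by (simp add: A_val_Nil split: if_splits)
  have "id \<in> W \<and> len id \<le> length [] \<and> (len id = length [] \<longrightarrow> id = word_elt n [])"
    by (simp add: len_id)
  then show ?case by (simp only: x)
next
  case (Cons i "is")
  have "A_val is x \<noteq> 0 \<or> A_val is (s i \<circ> x) \<noteq> 0"
  proof (rule ccontr)
    assume "\<not> ?thesis"
    then show False using Cons.prems by (simp add: A_val_Cons Aop_def Sop_def sg_hom)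
  qed
  then show ?case
  proof
    assume "A_val is x \<noteq> 0"
    then show ?thesis using Cons.IH[of x] by auto
  next
    assume "A_val is (s i \<circ> x) \<noteq> 0"
    have h: "s i \<circ> x \<in> W \<and> len (s i \<circ> x) \<le> length is \<and>
        (len (s i \<circ> x) = length is \<longrightarrow> s i \<circ> x = word_elt n is)"
      by (rule Cons.IH) fact
    have xe: "x = s i \<circ> (s i \<circ> x)" by (simp only: s_comp_s(2))
    have x: "x \<in> W" using comp_W[OF s_W[of i] conjunct1[OF h]] by (simp only: s_comp_s(2))
    have "len x \<le> Suc (len (s i \<circ> x))"
      using len_s_asc[OF x, of i] len_s_desc[OF x, of i] by (cases "asc i x") linarith+
    then have le: "len x \<le> Suc (len (s i \<circ> x))" .
    have "x = word_elt n (i # is)" if "len x = Suc (length is)"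
    proof -
      have "len (s i \<circ> x) = length is" using le that h by linarith
      then have "s i \<circ> x = word_elt n is" using h by blast
      then show ?thesis using xe by (simp only: word_Cons)
    qed
    moreover have "len x \<le> Suc (length is)" using le h by linarith
    ultimately have "x \<in> W \<and> len x \<le> length (i # is) \<and>
        (len x = length (i # is) \<longrightarrow> x = word_elt n (i # is))"
      using x by (simp only: list.size(4) add_0_right add_Suc_right) blast
    then show ?thesis .
  qed
qed

lemma A_val_leading: "reduced_word n is u \<Longrightarrow> A_val is u \<noteq> 0"
proof (induction "is" arbitrary: u)
  case Nil
  then have "u = id" by (simp only: reduced_Nil_iff)
  then show ?case using A_val_Nil[of u] by (metis zero_neq_one)
next
  case (Cons i "is")
  note r = reduced_tail[OF Cons.prems]
  have "len u = Suc (length is)" using Cons.prems by (simp add: reduced_word_def)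
  then have 0: "A_val is u = 0" using A_val_support[of "is" u] by auto
  have "sg i (A_val is (s i \<circ> u)) \<noteq> 0"
    using Cons.IH[OF r(1)] sg_sg[of i "A_val is (s i \<circ> u)"] sg_hom(4)[of i] by metis
  then show ?case using 0 alpha_inv_nz by (simp add: A_val_Cons Aop_def Sop_def)
qed

lemma A_coef_support: assumes "u \<in> W" "A_coef u x \<noteq> 0"
  shows "x \<in> W" "len x \<le> len u" "len x = len u \<Longrightarrow> x = u"
proof -
  obtain "is" where "is": "reduced_word n is u" using reduced_exists[OF assms(1)] by blast
  then show "x \<in> W" "len x \<le> len u" "len x = len u \<Longrightarrow> x = u"
    using A_val_support[of "is" x] assms(2) A_coef_reduced[OF "is"] by (auto simp: reduced_word_def)
qed

lemma A_coef_leading: assumes "u \<in> W" shows "A_coef u u \<noteq> 0"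
  using reduced_exists[OF assms] A_val_leading A_coef_reduced by metis

end

section \<open>Localization and structure constants\<close>

context affine_symmetric begin

definition W_upto :: "nat \<Rightarrow> (int \<Rightarrow> int) set" where "W_upto N = {u \<in> W. len u \<le> N}"

lemma W_upto_iff: "u \<in> W_upto N \<longleftrightarrow> u \<in> W \<and> len u \<le> N" by (simp add: W_upto_def)

lemma word_mod: "word_elt n (map (\<lambda>i. i mod int n) is) = word_elt n is"
proof (induction "is")
  case (Cons i "is")
  have "s (i mod int n) = s i" by (rule s_ceq) (simp add: cong_def)
  then have "word_elt n (map (\<lambda>i. i mod int n) (i # is)) = word_elt n (i # is)" using Cons by simp
  then show ?case .
qed simp

lemma finite_W_upto: "finite (W_upto N)"
proof -
  have "W_upto N \<subseteq> word_elt n ` {is. set is \<subseteq> {0..<int n} \<and> length is \<le> N}"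
  proof
    fix u assume "u \<in> W_upto N"
    then obtain "is" where "is": "word_elt n is = u" "length is \<le> N"
      using reduced_exists by (force simp: W_upto_iff reduced_word_def)
    have "set (map (\<lambda>i. i mod int n) is) \<subseteq> {0..<int n}" using n2 by auto
    then show "u \<in> word_elt n ` {is. set is \<subseteq> {0..<int n} \<and> length is \<le> N}"
      using "is" word_mod[of "is"] by (intro image_eqI[of _ _ "map (\<lambda>i. i mod int n) is"]) simp_all
  qed
  moreover have "finite {is. set is \<subseteq> {0..<int n} \<and> length is \<le> N}"
    by (rule finite_lists_length_le) simp
  ultimately show ?thesis by (meson finite_imageI finite_subset)
qed

lemma W_upto_mono: "M \<le> N \<Longrightarrow> W_upto M \<subseteq> W_upto N" by (auto simp: W_upto_iff)

text \<open>The vector \<open>r\<close> consists of the coefficients of \<open>x\<close> in the basis \<open>A\<^sub>u\<close>.\<close>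

definition row :: "(int \<Rightarrow> int) \<Rightarrow> ((int \<Rightarrow> int) \<Rightarrow> mpol fract) \<Rightarrow> bool" where
  "row x r \<longleftrightarrow> (\<forall>u. r u \<in> Fw) \<and> (\<forall>u. r u \<noteq> 0 \<longrightarrow> u \<in> W_upto (len x)) \<and>
     (\<forall>y\<in>W. (\<Sum>u\<in>W_upto (len x). r u * A_coef u y) = of_bool (x = y))"

lemma row_sum:
  assumes "row x r" "y \<in> W" "len x \<le> N"
  shows "(\<Sum>u\<in>W_upto N. r u * A_coef u y) = of_bool (x = y)"
proof -
  have "(\<Sum>u\<in>W_upto N. r u * A_coef u y) = (\<Sum>u\<in>W_upto (len x). r u * A_coef u y)"
    by (rule sum.mono_neutral_right[OF finite_W_upto W_upto_mono[OF assms(3)]]) (use assms(1) in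
      \<open>auto simp: row_def\<close>)
  then show ?thesis using assms by (simp add: row_def)
qed

text \<open>The matrix \<open>A_coef\<close> is triangular for the length, with invertible diagonal,
  so it is inverted by recursion on the length.\<close>

lemma row_exists: "x \<in> W \<Longrightarrow> \<exists>r. row x r"
proof (induction "len x" arbitrary: x rule: less_induct)
  case less
  let ?S = "{y \<in> W. len y < len x}"
  have fS: "finite ?S"
    by (rule finite_subset[OF _ finite_W_upto[of "len x"]]) (auto simp: W_upto_iff)
  have "\<forall>y\<in>?S. \<exists>r. row y r" using less by auto
  then obtain R where R: "\<And>y. y \<in> ?S \<Longrightarrow> row y (R y)" by metis
  \<comment> \<open>This solves the expansion of A_x in group elements for x, the shorter elements
    being already expressed in the A_u.\<close>
  define r where "r u = inverse (A_coef x x) * (of_bool (u = x) - (\<Sum>y\<in>?S. A_coef x y * R y u))"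
    for u
  have xx: "A_coef x x \<noteq> 0" using A_coef_leading less.prems by simp
  have RF: "R y u \<in> Fw" if "y \<in> ?S" for y u using R[OF that] by (simp add: row_def)
  have "r u \<in> Fw" for u
    unfolding r_def by (intro Fw_mult Fw_inverse Fw_diff Fw_sum A_coef_Fw RF) auto
  moreover have "u \<in> W_upto (len x)" if "r u \<noteq> 0" for u
  proof (rule ccontr)
    assume n: "u \<notin> W_upto (len x)"
    then have "u \<noteq> x" using less.prems by (auto simp: W_upto_iff)
    moreover have "R y u = 0" if "y \<in> ?S" for y
      using R[OF that] n that W_upto_mono[of "len y" "len x"] by (force simp: row_def)
    ultimately show False using that by (simp add: r_def)
  qed
  moreover have "(\<Sum>u\<in>W_upto (len x). r u * A_coef u z) = of_bool (x = z)" if z: "z \<in> W" for z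
  proof -
    have "(\<Sum>u\<in>W_upto (len x). r u * A_coef u z) =
        (\<Sum>u\<in>W_upto (len x). inverse (A_coef x x) * (of_bool (u = x) * A_coef u z)
        - inverse (A_coef x x) * (\<Sum>y\<in>?S. A_coef x y * (R y u * A_coef u z)))"
      by (rule sum.cong) (simp_all add: r_def right_diff_distrib left_diff_distrib sum_distrib_left
        sum_distrib_right mult.assoc)
    also have "\<dots> = inverse (A_coef x x) * (\<Sum>u\<in>W_upto (len x). of_bool (u = x) * A_coef u z)
        - inverse (A_coef x x) * (\<Sum>u\<in>W_upto (len x). \<Sum>y\<in>?S. A_coef x y * (R y u * A_coef u z))"
      by (simp add: sum_subtractf sum_distrib_left)
    also have "(\<Sum>u\<in>W_upto (len x). of_bool (u = x) * A_coef u z) =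
        (\<Sum>u\<in>W_upto (len x). if u = x then A_coef u z else 0)"
      by (rule sum.cong) auto
    also have "\<dots> = A_coef x z" using less.prems finite_W_upto by (simp add: sum.delta W_upto_iff)
    also have "(\<Sum>u\<in>W_upto (len x). \<Sum>y\<in>?S. A_coef x y * (R y u * A_coef u z)) =
        (\<Sum>y\<in>?S. A_coef x y * (\<Sum>u\<in>W_upto (len x). R y u * A_coef u z))"
      by (subst sum.swap) (simp add: sum_distrib_left)
    also have "\<dots> = (\<Sum>y\<in>?S. if y = z then A_coef x y else 0)"
      by (rule sum.cong) (use row_sum[OF R z] in auto)
    also have "\<dots> = (if z \<in> ?S then A_coef x z else 0)" using fS by (simp add: sum.delta)
    finally have eq: "(\<Sum>u\<in>W_upto (len x). r u * A_coef u z) =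
        inverse (A_coef x x) * A_coef x z - inverse (A_coef x x) *
        (if z \<in> ?S then A_coef x z else 0)" .
    show ?thesis
    proof (cases "z \<in> ?S")
      case True
      then have "x \<noteq> z" by auto
      then show ?thesis unfolding eq using True by simp
    next
      case False
      then have "z = x \<or> A_coef x z = 0"
        using z A_coef_support(2,3)[OF less.prems, of z] by (cases "A_coef x z = 0") auto
      then show ?thesis unfolding eq using False xx by auto
    qed
  qed
  ultimately show ?case unfolding row_def by blast
qed

text \<open>The coefficient \<open>loc x u\<close> is the localization of \<open>\<xi>\<^sup>u\<close> at \<open>x\<close>.\<close>

definition loc :: "(int \<Rightarrow> int) \<Rightarrow> (int \<Rightarrow> int) \<Rightarrow> mpol fract" where
  "loc x = (SOME r. row x r)"

lemma row_loc: "x \<in> W \<Longrightarrow> row x (loc x)"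
  using row_exists[of x] someI_ex[of "row x"] by (simp add: loc_def)

lemma loc_Fw: "x \<in> W \<Longrightarrow> loc x u \<in> Fw" using row_loc by (simp add: row_def)
lemma loc_support: "x \<in> W \<Longrightarrow> loc x u \<noteq> 0 \<Longrightarrow> u \<in> W_upto (len x)" using row_loc by (simp add: row_def)
lemma loc_A_coef: "x \<in> W \<Longrightarrow> y \<in> W \<Longrightarrow> len x \<le> N \<Longrightarrow>
    (\<Sum>u\<in>W_upto N. loc x u * A_coef u y) = of_bool (x = y)"
  using row_sum[OF row_loc] .

text \<open>At a longest element with nonzero coefficient, triangularity leaves only the diagonal
  term.\<close>

lemma A_coef_indep:
  assumes z: "\<And>y. y \<in> W \<Longrightarrow> (\<Sum>v\<in>W_upto N. d v * A_coef v y) = 0" and v: "v \<in> W_upto N"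
  shows "d v = 0"
proof (rule ccontr)
  let ?D = "{v \<in> W_upto N. d v \<noteq> 0}"
  assume "d v \<noteq> 0"
  then have D: "finite ?D" "?D \<noteq> {}" using v finite_W_upto by auto
  then have "Max (len ` ?D) \<in> len ` ?D" by (intro Max_in) auto
  then obtain v0 where v0: "v0 \<in> W_upto N" "d v0 \<noteq> 0" "len v0 = Max (len ` ?D)" by auto
  have max: "len u \<le> len v0" if "u \<in> W_upto N" "d u \<noteq> 0" for u
    unfolding v0(3) using that D(1) by (intro Max_ge) auto
  have W0: "v0 \<in> W" using v0 by (simp add: W_upto_iff)
  have 0: "d u * A_coef u v0 = 0" if "u \<in> W_upto N" "u \<noteq> v0" for u
  proof (rule ccontr)
    assume "\<not> ?thesis"
    then have "d u \<noteq> 0" "A_coef u v0 \<noteq> 0" by auto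
    moreover have "u \<in> W" using that by (simp add: W_upto_iff)
    ultimately show False using max[of u] A_coef_support[of u v0] that by fastforce
  qed
  have "(\<Sum>u\<in>W_upto N. d u * A_coef u v0) =
      d v0 * A_coef v0 v0 + (\<Sum>u\<in>W_upto N - {v0}. d u * A_coef u v0)"
    using v0 finite_W_upto by (simp add: sum.remove)
  also have "(\<Sum>u\<in>W_upto N - {v0}. d u * A_coef u v0) = 0" by (rule sum.neutral) (use 0 in auto)
  finally show False using z[OF W0] v0(2) A_coef_leading[OF W0] by simp
qed

text \<open>\<open>loc\<close> was built as an inverse of \<open>A_coef\<close> on one side only.
  The defect \<open>d\<close> on the other side is annihilated by \<open>A_coef\<close>, hence zero
  by independence.\<close>

lemma A_coef_loc:
  assumes u: "u \<in> W" "len u \<le> N" and v: "v \<in> W"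
  shows "(\<Sum>x\<in>W_upto N. A_coef u x * loc x v) = of_bool (u = v)"
proof (cases "v \<in> W_upto N")
  case True
  define d where "d v = (\<Sum>x\<in>W_upto N. A_coef u x * loc x v) - of_bool (u = v)" for v
  have "(\<Sum>v\<in>W_upto N. d v * A_coef v y) = 0" if y: "y \<in> W" for y
  proof -
    have "(\<Sum>v\<in>W_upto N. d v * A_coef v y) =
        (\<Sum>v\<in>W_upto N. \<Sum>x\<in>W_upto N. A_coef u x * (loc x v * A_coef v y)) -
        (\<Sum>v\<in>W_upto N. if v = u then A_coef v y else 0)"
      unfolding sum_subtractf[symmetric]
      by (rule sum.cong) (auto simp: d_def left_diff_distrib sum_distrib_right mult.assoc)
    also have "(\<Sum>v\<in>W_upto N. if v = u then A_coef v y else 0) = A_coef u y"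
      using u finite_W_upto by (simp add: sum.delta W_upto_iff)
    also have "(\<Sum>v\<in>W_upto N. \<Sum>x\<in>W_upto N. A_coef u x * (loc x v * A_coef v y)) =
        (\<Sum>x\<in>W_upto N. A_coef u x * (\<Sum>v\<in>W_upto N. loc x v * A_coef v y))"
      by (subst sum.swap) (simp add: sum_distrib_left)
    also have "\<dots> = (\<Sum>x\<in>W_upto N. if x = y then A_coef u x else 0)"
      by (rule sum.cong) (auto simp: loc_A_coef[OF _ y] W_upto_iff)
    also have "\<dots> = A_coef u y"
    proof -
      have "y \<in> W_upto N \<or> A_coef u y = 0"
        using A_coef_support(1,2)[OF u(1), of y] u(2)
          by (cases "A_coef u y = 0") (auto simp: W_upto_iff)
      then show ?thesis using finite_W_upto by (auto simp: sum.delta)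
    qed
    finally show ?thesis by simp
  qed
  from A_coef_indep[OF this True] show ?thesis by (simp add: d_def)
next
  case False
  then have "loc x v = 0" if "x \<in> W_upto N" for x
    using that loc_support[of x v] W_upto_mono[of "len x" N]
      by (cases "loc x v = 0") (auto simp: W_upto_iff)
  then show ?thesis using False u by (auto simp: W_upto_iff)
qed

text \<open>Origin: the coproduct of A_w has the coefficients of A_w at the elements x \<otimes> x,
  and \<open>loc\<close> expands both factors x in the basis A_u.\<close>

definition kk_frac :: "(int \<Rightarrow> int) \<Rightarrow> (int \<Rightarrow> int) \<Rightarrow> (int \<Rightarrow> int) \<Rightarrow> mpol fract" where
  "kk_frac w u v = (\<Sum>x\<in>W_upto (len w). A_coef w x * (loc x u * loc x v))"

lemma kk_frac_eq: assumes "w \<in> W" "len w \<le> N"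
  shows "kk_frac w u v = (\<Sum>x\<in>W_upto N. A_coef w x * (loc x u * loc x v))"
  unfolding kk_frac_def
  by (rule sum.mono_neutral_left[OF finite_W_upto W_upto_mono[OF assms(2)]])
    (use A_coef_support[OF assms(1)] in \<open>auto simp: W_upto_iff\<close>)

lemma kk_frac_Fw: "kk_frac w u v \<in> Fw"
  unfolding kk_frac_def by (intro Fw_sum Fw_mult A_coef_Fw loc_Fw) (auto simp: W_upto_iff)

section \<open>Comparison with the coproduct\<close>

lemma lookup_tw_coprod: "Poly_Mapping.lookup (tw_coprod f) (x, y) =
    (if x = y then Poly_Mapping.lookup f x else 0)"
proof -
  have "Poly_Mapping.lookup (tw_coprod f) (x, y) =
      (\<Sum>w\<in>Poly_Mapping.keys f. if w = x then (if x = y then Poly_Mapping.lookup f x else 0) else 0)"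
    unfolding tw_coprod_def lookup_sum by (rule sum.cong) (auto simp: lookup_single when_def)
  then show ?thesis by (simp add: sum.delta in_keys_iff)
qed

lemma lookup_tw_tensor: "Poly_Mapping.lookup (tw_tensor f g) (x, y) =
    Poly_Mapping.lookup f x * Poly_Mapping.lookup g y"
proof -
  have "Poly_Mapping.lookup (tw_tensor f g) (x, y) =
      (\<Sum>v\<in>Poly_Mapping.keys f. \<Sum>w\<in>Poly_Mapping.keys g.
     if w = y then (if v = x then Poly_Mapping.lookup f x * Poly_Mapping.lookup g y else 0) else 0)"
    unfolding tw_tensor_def lookup_sum by (intro sum.cong) (auto simp: lookup_single when_def)
  then show ?thesis by (cases "Poly_Mapping.lookup g y = 0") (simp_all add: sum.delta in_keys_iff)
qed

definition kk_expansion :: "(int \<Rightarrow> int) \<Rightarrow> twisted2 \<Rightarrow> bool" where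
  "kk_expansion w p \<longleftrightarrow> Poly_Mapping.keys p \<subseteq> W \<times> W \<and> (\<forall>x. Poly_Mapping.lookup p x \<in> frac_wt n) \<and>
     tw_coprod (A_elt n w) = (\<Sum>(u, v)\<in>Poly_Mapping.keys p.
       Poly_Mapping.map (\<lambda>c. Poly_Mapping.lookup p (u, v) * c) (tw_tensor (A_elt n u) (A_elt n v)))"

lemma lookup_rhs:
  "Poly_Mapping.lookup (\<Sum>(u, v)\<in>S. Poly_Mapping.map (\<lambda>c. Poly_Mapping.lookup p (u, v) *
      c) (tw_tensor (A_elt n u) (A_elt n v))) (x, y)
   = (\<Sum>(u, v)\<in>S. Poly_Mapping.lookup p (u, v) * (A_coef u x * A_coef v y))"
proof -
  have "Poly_Mapping.lookup (Poly_Mapping.map (\<lambda>c. q * c) (tw_tensor (A_elt n u) (A_elt n v)))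
      (x, y) = q * (A_coef u x * A_coef v y)" for q u v
    by (simp add: Poly_Mapping.map.rep_eq when_def lookup_tw_tensor A_coef_def)
  then show ?thesis unfolding lookup_sum by (intro sum.cong) auto
qed

text \<open>Pairing both tensor factors with the dual family \<open>loc\<close> isolates one
  coefficient. By finite support, one bound \<open>N\<close> on lengths covers all terms.\<close>

lemma kk_expansion_lookup:
  assumes w: "w \<in> W" and q: "kk_expansion w q" and u0: "u0 \<in> W" and v0: "v0 \<in> W"
  shows "Poly_Mapping.lookup q (u0, v0) = kk_frac w u0 v0"
proof -
  let ?q = "Poly_Mapping.lookup q" and ?K = "Poly_Mapping.keys q"
  have K: "?K \<subseteq> W \<times> W" using q by (simp add: kk_expansion_def)
  define N where "N = Max (insert (len w) ((\<lambda>(u, v). max (len u) (len v)) ` ?K))"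
  have Nw: "len w \<le> N" unfolding N_def by (intro Max_ge) auto
  have NK: "len u \<le> N" "len v \<le> N" if "(u, v) \<in> ?K" for u v
  proof -
    have "max (len u) (len v) \<le> N"
      unfolding N_def using that by (intro Max_ge) (auto intro!: image_eqI[of _ _ "(u, v)"])
    then show "len u \<le> N" "len v \<le> N" by simp_all
  qed
  have eq: "(if x = y then A_coef w x else 0) = (\<Sum>(u, v)\<in>?K. ?q (u, v) * (A_coef u x * A_coef v y))"
    for x y
    using q lookup_tw_coprod[of "A_elt n w" x y] lookup_rhs[of q ?K x y]
      by (simp add: kk_expansion_def A_coef_def)
  have "kk_frac w u0 v0 = (\<Sum>x\<in>W_upto N. A_coef w x * (loc x u0 * loc x v0))"
    by (rule kk_frac_eq[OF w Nw])
  also have "\<dots> =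
      (\<Sum>x\<in>W_upto N. \<Sum>y\<in>W_upto N. (if x = y then A_coef w x else 0) * (loc x u0 * loc y v0))"
  proof (rule sum.cong)
    fix x assume x: "x \<in> W_upto N"
    have "(\<Sum>y\<in>W_upto N. (if x = y then A_coef w x else 0) * (loc x u0 * loc y v0)) =
        (\<Sum>y\<in>W_upto N. if x = y then A_coef w x * (loc x u0 * loc x v0) else 0)"
      by (rule sum.cong) auto
    then show "A_coef w x * (loc x u0 * loc x v0) =
        (\<Sum>y\<in>W_upto N. (if x = y then A_coef w x else 0) * (loc x u0 * loc y v0))"
      using x finite_W_upto by (simp add: sum.delta')
  qed simp
  also have "\<dots> =
      (\<Sum>x\<in>W_upto N. \<Sum>y\<in>W_upto N. \<Sum>p\<in>?K. ?q p *
      ((A_coef (fst p) x * loc x u0) * (A_coef (snd p) y * loc y v0)))"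
    unfolding eq sum_distrib_right by (intro sum.cong) (auto simp: case_prod_beta)
  also have "\<dots> =
      (\<Sum>x\<in>W_upto N. \<Sum>p\<in>?K. \<Sum>y\<in>W_upto N. ?q p *
      ((A_coef (fst p) x * loc x u0) * (A_coef (snd p) y * loc y v0)))"
    by (intro sum.cong refl) (rule sum.swap)
  also have "\<dots> =
      (\<Sum>p\<in>?K. \<Sum>x\<in>W_upto N. \<Sum>y\<in>W_upto N. ?q p *
      ((A_coef (fst p) x * loc x u0) * (A_coef (snd p) y * loc y v0)))"
    by (rule sum.swap)
  also have "\<dots> =
      (\<Sum>p\<in>?K. ?q p *
      ((\<Sum>x\<in>W_upto N. A_coef (fst p) x * loc x u0) * (\<Sum>y\<in>W_upto N. A_coef (snd p) y * loc y v0)))"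
    by (intro sum.cong refl, simp only: sum_product, simp only: sum_distrib_left)
  also have "\<dots> = (\<Sum>p\<in>?K. if p = (u0, v0) then ?q p else 0)"
  proof (rule sum.cong)
    fix p assume p: "p \<in> ?K"
    then have "(fst p, snd p) \<in> ?K" "fst p \<in> W" "snd p \<in> W" using K by auto
    then show "?q p * ((\<Sum>x\<in>W_upto N. A_coef (fst p) x * loc x u0) *
        (\<Sum>y\<in>W_upto N. A_coef (snd p) y * loc y v0)) = (if p = (u0, v0) then ?q p else 0)"
      using NK[of "fst p" "snd p"] by (simp add: A_coef_loc u0 v0 prod_eq_iff)
  qed simp
  also have "\<dots> = ?q (u0, v0)" by (simp add: sum.delta in_keys_iff)
  finally show ?thesis ..
qed

text \<open>Summing against \<open>A_coef u x\<close> and \<open>A_coef v y\<close> undoes the two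
  expansions of each z and leaves only z = x = y.\<close>

lemma kk_expansion_exists: assumes w: "w \<in> W" shows "\<exists>q. kk_expansion w q"
proof
  let ?N = "len w"
  define q :: twisted2 where "q =
      (\<Sum>p\<in>W_upto ?N \<times> W_upto ?N. Poly_Mapping.single p (kk_frac w (fst p) (snd p)))"
  have fin: "finite (W_upto ?N \<times> W_upto ?N)" using finite_W_upto by simp
  have lq: "Poly_Mapping.lookup q p =
      (if p \<in> W_upto ?N \<times> W_upto ?N then kk_frac w (fst p) (snd p) else 0)" for p
    unfolding q_def lookup_sum lookup_single when_def using fin by (simp add: sum.delta)
  have keys: "Poly_Mapping.keys q \<subseteq> W_upto ?N \<times> W_upto ?N"
    using lq by (auto simp: in_keys_iff split: if_splits)
  have "Poly_Mapping.lookup q p \<in> frac_wt n" for p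
    using kk_frac_Fw Fw_0 unfolding lq Fw_def by simp
  moreover have "tw_coprod (A_elt n w) = (\<Sum>(u, v)\<in>Poly_Mapping.keys q.
       Poly_Mapping.map (\<lambda>c. Poly_Mapping.lookup q (u, v) * c) (tw_tensor (A_elt n u) (A_elt n v)))"
  proof (rule poly_mapping_eqI)
    fix xy :: "(int \<Rightarrow> int) \<times> (int \<Rightarrow> int)"
    obtain x y where xy: "xy = (x, y)" by (cases xy)
    have "(\<Sum>(u, v)\<in>Poly_Mapping.keys q. Poly_Mapping.lookup q (u, v) * (A_coef u x * A_coef v y))
       = (\<Sum>(u, v)\<in>W_upto ?N \<times> W_upto ?N. Poly_Mapping.lookup q (u, v) * (A_coef u x * A_coef v y))"
      by (rule sum.mono_neutral_left[OF fin keys]) (auto simp: in_keys_iff)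
    also have "\<dots> = (\<Sum>u\<in>W_upto ?N. \<Sum>v\<in>W_upto ?N. kk_frac w u v * (A_coef u x * A_coef v y))"
      unfolding sum.cartesian_product[symmetric] by (intro sum.cong) (auto simp: lq)
    also have "\<dots> =
        (\<Sum>u\<in>W_upto ?N. \<Sum>v\<in>W_upto ?N. \<Sum>z\<in>W_upto ?N. A_coef w z *
        ((loc z u * A_coef u x) * (loc z v * A_coef v y)))"
      by (intro sum.cong refl) (simp add: kk_frac_def sum_distrib_left sum_distrib_right mult_ac)
    also have "\<dots> =
        (\<Sum>u\<in>W_upto ?N. \<Sum>z\<in>W_upto ?N. \<Sum>v\<in>W_upto ?N. A_coef w z *
        ((loc z u * A_coef u x) * (loc z v * A_coef v y)))"
      by (rule sum.cong[OF refl], rule sum.swap)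
    also have "\<dots> =
        (\<Sum>z\<in>W_upto ?N. \<Sum>u\<in>W_upto ?N. \<Sum>v\<in>W_upto ?N. A_coef w z *
        ((loc z u * A_coef u x) * (loc z v * A_coef v y)))"
      by (rule sum.swap)
    also have "\<dots> =
        (\<Sum>z\<in>W_upto ?N. A_coef w z *
        ((\<Sum>u\<in>W_upto ?N. loc z u * A_coef u x) * (\<Sum>v\<in>W_upto ?N. loc z v * A_coef v y)))"
      by (rule sum.cong[OF refl], simp only: sum_product, simp only: sum_distrib_left)
    also have "\<dots> = (if x = y then A_coef w x else 0)"
    proof (cases "x \<in> W \<and> y \<in> W")
      case True
      then have "(\<Sum>z\<in>W_upto ?N. A_coef w z *
          ((\<Sum>u\<in>W_upto ?N. loc z u * A_coef u x) * (\<Sum>v\<in>W_upto ?N. loc z v * A_coef v y)))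
        = (\<Sum>z\<in>W_upto ?N. if z = x then (if x = y then A_coef w x else 0) else 0)"
        by (intro sum.cong) (auto simp: loc_A_coef W_upto_iff)
      also have "\<dots> = (if x = y then A_coef w x else 0)"
        using True finite_W_upto A_coef_support[OF w, of x] by (auto simp: sum.delta W_upto_iff)
      finally show ?thesis .
    next
      case False
      have "A_coef u z = 0" if "u \<in> W_upto ?N" "z \<notin> W" for u z
        using A_coef_support(1)[of u z] that by (cases "A_coef u z = 0") (auto simp: W_upto_iff)
      then have "(\<forall>u\<in>W_upto ?N. A_coef u x = 0) \<or> (\<forall>v\<in>W_upto ?N. A_coef v y = 0)"
        using False by blast
      then have "(\<Sum>z\<in>W_upto ?N. A_coef w z *
          ((\<Sum>u\<in>W_upto ?N. loc z u * A_coef u x) * (\<Sum>v\<in>W_upto ?N. loc z v * A_coef v y))) = 0"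
          by auto
      moreover have "(if x = y then A_coef w x else 0) = 0"
        using False A_coef_support(1)[OF w] by auto
      ultimately show ?thesis by simp
    qed
    finally show "Poly_Mapping.lookup (tw_coprod (A_elt n w)) xy =
        Poly_Mapping.lookup (\<Sum>(u, v)\<in>Poly_Mapping.keys q.
       Poly_Mapping.map (\<lambda>c. Poly_Mapping.lookup q (u, v) * c) (tw_tensor (A_elt n u) (A_elt n v)))
         xy"
      unfolding xy lookup_rhs lookup_tw_coprod by (simp add: A_coef_def)
  qed
  ultimately show "kk_expansion w q"
    unfolding kk_expansion_def using keys by (auto simp: W_upto_iff)
qed

lemma lookup_kk_coeffs: assumes w: "w \<in> W" and "u \<in> W" "v \<in> W"
  shows "Poly_Mapping.lookup (kk_coeffs n w) (u, v) = kk_frac w u v"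
proof -
  obtain q where q: "kk_expansion w q" using kk_expansion_exists[OF w] by blast
  have "kk_coeffs n w = q"
    unfolding kk_coeffs_def kk_expansion_def[symmetric]
  proof (rule the_equality[where P = "kk_expansion w", OF q])
    fix p assume p: "kk_expansion w p"
    show "p = q"
    proof (rule poly_mapping_eqI)
      fix z show "Poly_Mapping.lookup p z = Poly_Mapping.lookup q z"
      proof (cases "z \<in> W \<times> W")
        case True
        then show ?thesis using kk_expansion_lookup[OF w p] kk_expansion_lookup[OF w q] by auto
      next
        case False
        then have "z \<notin> Poly_Mapping.keys p" "z \<notin> Poly_Mapping.keys q"
          using p q by (auto simp: kk_expansion_def)
        then show ?thesis by (simp add: in_keys_iff)
      qed
    qed
  qed
  then show ?thesis using kk_expansion_lookup[OF w q] assms by simp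
qed

end

section \<open>The generating class\<close>

context affine_symmetric begin

definition E_fps :: "int \<Rightarrow> mpol fract fps" where "E_fps j = fps_const (E j)"
definition geo :: "int \<Rightarrow> mpol fract fps" where "geo j = inverse (1 - fps_X * E_fps j)"

lemma geo: "geo j * (1 - fps_X * E_fps j) = 1"
proof -
  have "fps_nth (1 - fps_X * E_fps j) 0 \<noteq> 0" by (simp add: E_fps_def)
  then show ?thesis unfolding geo_def by (rule inverse_mult_eq_1)
qed

lemma E_fps_ceq: "i \<simeq> j \<Longrightarrow> E_fps i = E_fps j" by (simp add: E_fps_def E_ceq)

definition G_set :: "int \<Rightarrow> int set \<Rightarrow> mpol fract fps" where
  "G_set l X = (\<Prod>b\<in>X - {..l}. geo b) * (\<Prod>b\<in>{..l} - X. 1 - fps_X * E_fps b)"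

text \<open>Ensures that both products in \<open>G_set\<close> are meant literally; a product over
  an infinite set would take the default value 1.\<close>

definition almost_lower :: "int \<Rightarrow> int set \<Rightarrow> bool" where
  "almost_lower l X \<longleftrightarrow> finite (X - {..l}) \<and> finite ({..l} - X)"

lemma almost_lower_insert: assumes "almost_lower l X" shows "almost_lower l (insert b X)"
proof -
  have "insert b X - {..l} \<subseteq> insert b (X - {..l})" "{..l} - insert b X \<subseteq> {..l} - X" by auto
  moreover have "finite (insert b (X - {..l}))" "finite ({..l} - X)"
    using assms by (simp_all add: almost_lower_def)
  ultimately show ?thesis unfolding almost_lower_def using finite_subset by blast
qed

text \<open>A new element b either contributes the factor \<open>geo b\<close> or, if b \<le> l,
  removes the factor to which \<open>geo b\<close> is inverse.\<close>

lemma G_set_insert: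
  assumes X: "almost_lower l X" and b: "b \<notin> X"
  shows "G_set l (insert b X) = geo b * G_set l X"
proof (cases "b \<le> l")
  case True
  have e1: "insert b X - {..l} = X - {..l}" using True by auto
  have e2: "{..l} - X = insert b ({..l} - insert b X)" using True b by auto
  have fin: "finite ({..l} - insert b X)"
    using almost_lower_insert[OF X] by (simp only: almost_lower_def)
  have "(\<Prod>b\<in>{..l} - X. 1 - fps_X * E_fps b) =
      (1 - fps_X * E_fps b) * (\<Prod>b\<in>{..l} - insert b X. 1 - fps_X * E_fps b)"
    unfolding e2 by (rule prod.insert[OF fin]) blast
  then have "geo b * G_set l X = (geo b * (1 - fps_X * E_fps b)) * G_set l (insert b X)"
    unfolding G_set_def e1 by (simp only: mult_ac)
  then show ?thesis unfolding geo by (simp only: mult_1_left)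
next
  case False
  have e1: "insert b X - {..l} = insert b (X - {..l})" and e2: "{..l} - insert b X = {..l} - X"
    using False by auto
  have fin: "finite (X - {..l})" using X by (simp only: almost_lower_def)
  have "(\<Prod>b\<in>insert b X - {..l}. geo b) = geo b * (\<Prod>b\<in>X - {..l}. geo b)"
    unfolding e1 by (rule prod.insert[OF fin]) (use b in blast)
  then show ?thesis unfolding G_set_def e2 by (simp only: mult.assoc)
qed

lemma G_set_Suc:
  assumes X: "almost_lower l X"
  shows "G_set (l + 1) X = (1 - fps_X * E_fps (l + 1)) * G_set l X"
proof -
  have i: "{..l + 1} = insert (l + 1) {..l}" by auto
  show ?thesis
  proof (cases "l + 1 \<in> X")
    case True
    have e1: "X - {..l} = insert (l + 1) (X - {..l + 1})" and e2: "{..l + 1} - X = {..l} - X"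
      unfolding i using True by auto
    have fin: "finite (X - {..l + 1})"
      by (rule finite_subset[of _ "X - {..l}"]) (use X in \<open>auto simp: almost_lower_def\<close>)
    have "(\<Prod>b\<in>X - {..l}. geo b) = geo (l + 1) * (\<Prod>b\<in>X - {..l + 1}. geo b)"
      unfolding e1 by (rule prod.insert[OF fin]) simp
    then have "(1 - fps_X * E_fps (l + 1)) * G_set l X =
        geo (l + 1) * (1 - fps_X * E_fps (l + 1)) * G_set (l + 1) X"
      unfolding G_set_def e2 by (simp only: mult_ac)
    then show ?thesis unfolding geo by (simp only: mult_1_left)
  next
    case False
    have e1: "{..l + 1} - X = insert (l + 1) ({..l} - X)" and e2: "X - {..l + 1} = X - {..l}"
      unfolding i using False by auto
    have fin: "finite ({..l} - X)" using X by (simp only: almost_lower_def)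
    have "(\<Prod>b\<in>{..l + 1} - X. 1 - fps_X * E_fps b) =
        (1 - fps_X * E_fps (l + 1)) * (\<Prod>b\<in>{..l} - X. 1 - fps_X * E_fps b)"
      unfolding e1 by (rule prod.insert[OF fin]) simp
    then show ?thesis unfolding G_set_def e2 by (simp only: mult_ac)
  qed
qed

lemma almost_lower_image: assumes "x \<in> W" shows "almost_lower l (x ` {..l})"
proof -
  obtain B where B: "\<And>p. \<bar>x p - p\<bar> \<le> B" using W_bounded[OF assms] by blast
  have "x ` {..l} - {..l} \<subseteq> {l..l + B}"
  proof
    fix b assume "b \<in> x ` {..l} - {..l}"
    then obtain p where "b = x p" "p \<le> l" "l < b" by auto
    then show "b \<in> {l..l + B}" using B[of p] by auto
  qed
  moreover have "{..l} - x ` {..l} \<subseteq> {l - B..l}"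
  proof
    fix b assume b: "b \<in> {..l} - x ` {..l}"
    then have "\<not> pos x b \<le> l" using W_pos(1)[OF assms, of b] by force
    then show "b \<in> {l - B..l}" using b B[of "pos x b"] W_pos(1)[OF assms, of b] by auto
  qed
  ultimately show ?thesis unfolding almost_lower_def
    by (meson finite_atLeastAtMost_int finite_subset)
qed

definition G :: "int \<Rightarrow> (int \<Rightarrow> int) \<Rightarrow> mpol fract fps" where "G l x = G_set l (x ` {..l})"

lemma s_image: assumes "\<not> l \<simeq> i" shows "s i ` {..l} = {..l}"
proof -
  have 1: "s i p \<le> l" if "p \<le> l" for p
  proof (cases "p = l")
    case True
    have "s i l \<le> l" by (cases l i rule: s_cases) (use assms in auto)
    then show ?thesis using True by simp
  next
    case False
    have "s i p \<le> p + 1" by (cases p i rule: s_cases) auto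
    then show ?thesis using that False by simp
  qed
  show ?thesis
  proof (intro equalityI subsetI)
    fix p assume "p \<in> {..l}"
    then show "p \<in> s i ` {..l}" using 1 by (intro image_eqI[of _ _ "s i p"]) auto
  qed (use 1 in auto)
qed

lemma G_id: "G l id = 1" by (simp add: G_def G_set_def)

lemma G_s_other: assumes "\<not> l \<simeq> i" shows "G l (x \<circ> s i) = G l x"
  by (simp only: G_def image_comp[symmetric] s_image[OF assms])

text \<open>The images of {..l} under x and x s_l share the image of {..l - 1} and add to it x l or
  x (l + 1). The difference of the two geometric factors contains the root, and what remains has
  both factors, that is, the class for l + 1.\<close>

lemma G_s:
  assumes x: "x \<in> W"
  shows "G l x - G l (x \<circ> s l) = fps_X * (E_fps (x l) - E_fps (x (l + 1))) *
      (geo (l + 1) * G (l + 1) x)"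
proof -
  let ?X = "x ` {..l - 1}"
  have i: "{..l} = insert l {..l - 1}" "{..l + 1} = insert (l + 1) {..l}" by auto
  have sl: "s l ` {..l - 1} = {..l - 1}" using not_ceq_Suc(1)[of "l - 1"] by (intro s_image) simp
  have "almost_lower (l - 1) ?X" using almost_lower_image[OF x] .
  then have alm: "almost_lower l ?X"
  proof -
    have "finite (?X - {..l})"
      by (rule finite_subset[of _ "?X -
          {..l - 1}"]) (use \<open>almost_lower (l - 1) ?X\<close> in \<open>auto simp: almost_lower_def\<close>)
    moreover have "finite ({..l} - ?X)"
      by (rule finite_subset[of _ "insert l ({..l - 1} - ?X)"]) (use \<open>almost_lower (l - 1) ?X\<close> in
        \<open>auto simp: almost_lower_def\<close>)
    ultimately show ?thesis by (simp add: almost_lower_def)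
  qed
  have nin: "x l \<notin> ?X" "x (l + 1) \<notin> ?X" "x (l + 1) \<notin> insert (x l) ?X" using W_inj[OF x] by auto
  let ?g = "geo (x l)" and ?h = "geo (x (l + 1))" and ?\<Gamma> = "G_set l ?X"
  have 1: "G l x = ?g * ?\<Gamma>" unfolding G_def i(1) image_insert by (rule G_set_insert[OF alm nin(1)])
  have "(x \<circ> s l) ` {..l} = insert (x (l + 1)) ?X"
    unfolding image_comp[symmetric] i(1) image_insert sl s_i by simp
  then have 2: "G l (x \<circ> s l) = ?h * ?\<Gamma>" unfolding G_def by (simp only: G_set_insert[OF alm nin(2)])
  have "G (l + 1) x = (1 - fps_X * E_fps (l + 1)) * G_set l (x ` {..l + 1})"
    unfolding G_def
  proof (rule G_set_Suc)
    have "x ` {..l + 1} = insert (x (l + 1)) (x ` {..l})" unfolding i(2) by simp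
    then show "almost_lower l (x ` {..l + 1})"
      using almost_lower_insert almost_lower_image[OF x] by simp
  qed
  also have "G_set l (x ` {..l + 1}) = ?h * (?g * ?\<Gamma>)"
    unfolding i(2) i(1) image_insert
      by (simp only: G_set_insert[OF almost_lower_insert[OF alm] nin(3)] G_set_insert[OF alm
      nin(1)])
  finally have 3: "geo (l + 1) * G (l + 1) x = ?h * (?g * ?\<Gamma>)"
    using geo[of "l + 1"] by (simp add: mult.assoc[symmetric])
  have "?g - ?h = ?g * (?h * (1 - fps_X * E_fps (x (l + 1)))) - ?h *
      (?g * (1 - fps_X * E_fps (x l)))"
    by (simp only: geo mult_1_right)
  also have "\<dots> = fps_X * (E_fps (x l) - E_fps (x (l + 1))) * (?h * ?g)" by (simp add: algebra_simps)
  finally have "(?g - ?h) * ?\<Gamma> = fps_X * (E_fps (x l) - E_fps (x (l + 1))) * (?h * ?g) * ?\<Gamma>" by simp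
  then show ?thesis unfolding 1 2 3 by (simp add: algebra_simps)
qed

text \<open>The scalar that \<open>A\<^sub>i\<close> contributes at \<open>x\<close> when multiplied from the right.\<close>

definition pos_root_inv :: "(int \<Rightarrow> int) \<Rightarrow> int \<Rightarrow> mpol fract" where
  "pos_root_inv x i = inverse (E (x i) - E (x (i + 1)))"

lemma pos_root_inv_ceq: assumes "x \<in> W" "i \<simeq> j" shows "pos_root_inv x i = pos_root_inv x j"
proof -
  have "x i \<simeq> x j" "x (i + 1) \<simeq> x (j + 1)" using assms W_ceq ceq_Suc_iff by simp_all
  then show ?thesis using E_ceq by (simp add: pos_root_inv_def)
qed

lemma pos_root_inv_s: "pos_root_inv (x \<circ> s i) i = - pos_root_inv x i"
proof -
  have "E (x (i + 1)) - E (x i) = - (E (x i) - E (x (i + 1)))" by simp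
  then have "inverse (E (x (i + 1)) - E (x i)) = - pos_root_inv x i"
    unfolding pos_root_inv_def by (simp only: inverse_minus_eq)
  then show ?thesis by (simp add: pos_root_inv_def)
qed

text \<open>Multiplying by A_i on the right twists the inverse root by the group element in front;
  the second sign changes because s_i negates its root. Words are evaluated from the left, so the
  induction removes the first letter.\<close>

lemma A_val_snoc: "x \<in> W \<Longrightarrow> A_val (is @ [i]) x =
    pos_root_inv x i * (A_val is x + A_val is (x \<circ> s i))"
proof (induction "is" arbitrary: x)
  case Nil
  have "A_val ([] @ [i]) x = Aop i (A_val []) x" by (simp only: append_Nil A_val_Cons)
  also have "\<dots> = pos_root_inv x i * (A_val [] x + A_val [] (x \<circ> s i))"
  proof -
    have e: "s i \<circ> x = id \<longleftrightarrow> x = s i" "x \<circ> s i = id \<longleftrightarrow> x = s i"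
    proof -
      have "x = s i" if "s i \<circ> x = id"
      proof -
        have "s i \<circ> (s i \<circ> x) = s i \<circ> id" unfolding that ..
        then show ?thesis by (simp only: s_comp_s comp_id)
      qed
      then show "s i \<circ> x = id \<longleftrightarrow> x = s i" by (auto simp only: s_comp_s)
      have "x = s i" if "x \<circ> s i = id"
      proof -
        have "x \<circ> s i \<circ> s i = id \<circ> s i" unfolding that ..
        then show ?thesis by (simp only: s_comp_s id_comp)
      qed
      then show "x \<circ> s i = id \<longleftrightarrow> x = s i" by (auto simp only: s_comp_s)
    qed
    consider "x = id" | "x = s i" | "x \<noteq> id" "x \<noteq> s i" by blast
    then show ?thesis
    proof cases
      case 1
      then show ?thesis using s_neq_id[of i]
        by (simp add: Aop_def Sop_def A_val_Nil e sg_hom pos_root_inv_def alpha_inv_def)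
    next
      case 2
      have "pos_root_inv (s i) i = - alpha_inv i"
        using pos_root_inv_s[of id i] by (simp add: pos_root_inv_def alpha_inv_def)
      then show ?thesis using 2 s_neq_id[of i] by (simp add: Aop_def Sop_def A_val_Nil e sg_hom)
    next
      case 3 then show ?thesis by (simp add: Aop_def Sop_def A_val_Nil e sg_hom)
    qed
  qed
  finally show ?case .
next
  case (Cons j "is")
  have sx: "s j \<circ> x \<in> W" using Cons.prems by simp
  have c: "sg j (pos_root_inv (s j \<circ> x) i) = pos_root_inv x i"
    by (simp add: pos_root_inv_def sg_hom)
  have "A_val ((j # is) @ [i]) x = alpha_inv j *
      (A_val (is @ [i]) x - sg j (A_val (is @ [i]) (s j \<circ> x)))"
    by (simp only: append_Cons A_val_Cons Aop_def Sop_def)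
  also have "\<dots> =
      alpha_inv j *
      (pos_root_inv x i * (A_val is x + A_val is (x \<circ> s i)) - pos_root_inv x i * (sg j (A_val is (s j \<circ> x)) + sg j (A_val is (s j \<circ> (x \<circ> s i)))))"
    unfolding Cons.IH[OF Cons.prems] Cons.IH[OF sx] sg_hom c comp_assoc ..
  also have "\<dots> = pos_root_inv x i * (A_val (j # is) x + A_val (j # is) (x \<circ> s i))"
    unfolding A_val_Cons Aop_def Sop_def by (simp add: algebra_simps)
  finally show ?case .
qed

text \<open>The value of the class G on the element of the twisted group algebra with coefficients
  f.\<close>

definition Phi :: "int \<Rightarrow> ((int \<Rightarrow> int) \<Rightarrow> mpol fract) \<Rightarrow> mpol fract fps" where
  "Phi l f = (\<Sum>x | f x \<noteq> 0. G l x * fps_const (f x))"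

lemma Phi_superset: assumes "finite S" "{x. f x \<noteq> 0} \<subseteq> S"
  shows "Phi l f = (\<Sum>x\<in>S. G l x * fps_const (f x))"
  unfolding Phi_def by (rule sum.mono_neutral_left) (use assms in auto)

lemma A_val_finite: "finite {x. A_val is x \<noteq> 0}"
  by (rule finite_lookup)

lemma A_val_W: "A_val is x \<noteq> 0 \<Longrightarrow> x \<in> W" using A_val_support by blast

text \<open>Summation by parts: substituting x s_i for x moves the difference from the coefficients
  to G, where \<open>G_s\<close> cancels the root denominator. If i is not congruent to l, the two
  values of G agree and everything cancels.\<close>

lemma Phi_snoc:
  "Phi l (A_val (is @ [i])) = (if i \<simeq> l then fps_X * geo (l + 1) * Phi (l + 1) (A_val is) else 0)"
proof -
  let ?f = "A_val is"
  let ?D = "{x. ?f x \<noteq> 0}"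
  \<comment> \<open>The support, made stable under right multiplication by
    \<open>s i\<close>.\<close>
  let ?S = "?D \<union> (\<lambda>x. x \<circ> s i) ` ?D"
  have fS: "finite ?S" using A_val_finite by simp
  have SW: "x \<in> W" if "x \<in> ?S" for x using that A_val_W by auto
  have cs: "x \<circ> s i \<circ> s i = x" for x :: "int \<Rightarrow> int" by (rule s_comp_s(3))
  have closed: "x \<circ> s i \<in> ?S" if "x \<in> ?S" for x
    using that cs by auto
  have sup: "{x. A_val (is @ [i]) x \<noteq> 0} \<subseteq> ?S"
  proof
    fix x assume "x \<in> {x. A_val (is @ [i]) x \<noteq> 0}"
    then have nz: "A_val (is @ [i]) x \<noteq> 0" by simp
    then have "?f x \<noteq> 0 \<or> ?f (x \<circ> s i) \<noteq> 0" using A_val_snoc[OF A_val_W[OF nz]] by auto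
    then show "x \<in> ?S"
    proof
      assume "?f (x \<circ> s i) \<noteq> 0"
      then have "x \<circ> s i \<circ> s i \<in> (\<lambda>x. x \<circ> s i) ` ?D" by blast
      then show ?thesis unfolding cs by blast
    qed simp
  qed
  have "Phi l (A_val (is @ [i])) = (\<Sum>x\<in>?S. G l x * fps_const (A_val (is @ [i]) x))"
    by (rule Phi_superset[OF fS sup])
  also have "\<dots> = (\<Sum>x\<in>?S. G l x * fps_const (pos_root_inv x i * ?f x)) +
      (\<Sum>x\<in>?S. G l x * fps_const (pos_root_inv x i * ?f (x \<circ> s i)))"
    unfolding sum.distrib[symmetric]
    by (rule sum.cong) (simp_all add: A_val_snoc[OF SW] distrib_left fps_const_add[symmetric] del:
      fps_const_add)
  also have "(\<Sum>x\<in>?S. G l x * fps_const (pos_root_inv x i * ?f (x \<circ> s i))) =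
      (\<Sum>x\<in>?S. G l (x \<circ> s i) * fps_const (pos_root_inv (x \<circ> s i) i * ?f x))"
    by (rule sum.reindex_bij_witness[where i = "\<lambda>x. x \<circ> s i" and j = "\<lambda>x. x \<circ> s i"])
      (simp_all only: cs closed)
  also have "(\<Sum>x\<in>?S. G l x * fps_const (pos_root_inv x i * ?f x)) +
      (\<Sum>x\<in>?S. G l (x \<circ> s i) * fps_const (pos_root_inv (x \<circ> s i) i * ?f x))
     = (\<Sum>x\<in>?S. (G l x - G l (x \<circ> s i)) * fps_const (pos_root_inv x i * ?f x))"
    unfolding sum.distrib[symmetric] pos_root_inv_s
    by (rule sum.cong) (simp_all add: algebra_simps fps_const_neg[symmetric] del: fps_const_neg)
  also have "\<dots> = (if i \<simeq> l then fps_X * geo (l + 1) * Phi (l + 1) (A_val is) else 0)"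
  proof (cases "i \<simeq> l")
    case True
    have tm: "(G l x - G l (x \<circ> s i)) * fps_const (pos_root_inv x i * ?f x) =
        fps_X * geo (l + 1) * (G (l + 1) x * fps_const (?f x))"
      if x: "x \<in> ?S" for x
    proof -
      have xW: "x \<in> W" using SW[OF x] .
      have "\<not> x l \<simeq> x (l + 1)" using W_ceq[OF xW] not_ceq_Suc by simp
      then have nz: "E (x l) - E (x (l + 1)) \<noteq> 0" using E_eq_iff by simp
      have one: "(E_fps (x l) - E_fps (x (l + 1))) * fps_const (pos_root_inv x l) = 1"
        using nz by (simp add: E_fps_def pos_root_inv_def)
      have "(G l x - G l (x \<circ> s i)) * fps_const (pos_root_inv x i * ?f x)
        = fps_X * ((E_fps (x l) - E_fps (x (l + 1))) * fps_const (pos_root_inv x l)) * (geo (l + 1)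
          * G (l + 1) x) * fps_const (?f x)"
        unfolding s_ceq[OF True] pos_root_inv_ceq[OF xW True] G_s[OF xW] fps_const_mult[symmetric]
          by (simp only: mult_ac)
      then show ?thesis unfolding one by (simp only: mult_ac mult_1_left)
    qed
    have "(\<Sum>x\<in>?S. (G l x - G l (x \<circ> s i)) * fps_const (pos_root_inv x i * ?f x)) =
        fps_X * geo (l + 1) * (\<Sum>x\<in>?S. G (l + 1) x * fps_const (?f x))"
      unfolding sum_distrib_left by (rule sum.cong) (simp_all only: tm)
    also have "(\<Sum>x\<in>?S. G (l + 1) x * fps_const (?f x)) = Phi (l + 1) ?f"
      by (rule Phi_superset[OF fS, symmetric]) blast
    finally show ?thesis using True by (simp only: if_True)
  next
    case False
    then have "\<not> l \<simeq> i" using cong_sym by blast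
    then show ?thesis using False by (simp add: G_s_other)
  qed
  finally show ?thesis .
qed

text \<open>The recursion is on the last letter, to follow \<open>Phi_snoc\<close>: removing l
  leaves the word for l + 1.\<close>

fun rho_word :: "int \<Rightarrow> nat \<Rightarrow> int list" where
  "rho_word l 0 = []" | "rho_word l (Suc k) = rho_word (l + 1) k @ [l]"

fun eta :: "int \<Rightarrow> nat \<Rightarrow> mpol fract fps" where
  "eta l 0 = 1" | "eta l (Suc k) = fps_X * geo (l + 1) * eta (l + 1) k"

abbreviation rho_at :: "int \<Rightarrow> nat \<Rightarrow> int \<Rightarrow> int" where "rho_at l k \<equiv> word_elt n (rho_word l k)"

lemma length_rho_word [simp]: "length (rho_word l k) = k" by (induction k arbitrary: l) auto

lemma Phi_Nil: "Phi l (A_val []) = 1"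
proof -
  have "Phi l (A_val []) = (\<Sum>x\<in>{id}. G l x * fps_const (A_val [] x))"
    by (rule Phi_superset) (auto simp: A_val_Nil)
  then show ?thesis by (simp add: A_val_Nil G_id)
qed

lemma Phi_word: "Phi l (A_val is) =
    (if list_all2 (\<simeq>) is (rho_word l (length is)) then eta l (length is) else 0)"
proof (induction "is" arbitrary: l rule: rev_induct)
  case Nil show ?case by (simp add: Phi_Nil)
next
  case (snoc i "is")
  have "list_all2 (\<simeq>) (is @ [i]) (rho_word (l + 1) (length is) @ [l]) \<longleftrightarrow>
      list_all2 (\<simeq>) is (rho_word (l + 1) (length is)) \<and> i \<simeq> l"
    by (subst list_all2_append) auto
  then show ?case using snoc[of "l + 1"] by (simp add: Phi_snoc)
qed

lemma eta_neq_0: "eta l k \<noteq> 0"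
proof (induction k arbitrary: l)
  case (Suc k)
  have "geo (l + 1) \<noteq> 0" using geo[of "l + 1"] by auto
  then show ?case using Suc by simp
qed simp

lemma word_ceq: "list_all2 (\<simeq>) is js \<Longrightarrow> word_elt n is = word_elt n js"
proof (induction "is" js rule: list_all2_induct)
  case (Cons i "is" j js)
  have "word_elt n (i # is) = word_elt n (j # js)" using Cons s_ceq by simp
  then show ?case .
qed simp

lemma A_val_nonzero_reduced: "A_val is x \<noteq> 0 \<Longrightarrow> reduced_word n is (word_elt n is)"
proof (induction "is" arbitrary: x)
  case Nil
  have "reduced_word n [] (word_elt n [])" by (simp add: reduced_Nil_iff)
  then show ?case .
next
  case (Cons i "is")
  have "\<exists>y. A_val is y \<noteq> 0"
  proof (rule ccontr)
    assume "\<not> ?thesis"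
    then show False using Cons.prems by (simp add: A_val_Cons Aop_def Sop_def sg_hom)
  qed
  then have r: "reduced_word n is (word_elt n is)" using Cons.IH by blast
  have "asc i (word_elt n is)"
  proof (rule ccontr)
    assume "\<not> ?thesis"
    then have "Aop i (A_coef (word_elt n is)) = (\<lambda>x. 0)" by (intro A_coef_desc) simp_all
    then show False using Cons.prems A_coef_reduced[OF r] by (simp add: A_val_Cons)
  qed
  from reduced_Cons[OF r this] have "reduced_word n (i # is) (word_elt n (i # is))" by simp
  then show ?case .
qed

text \<open>Instead of counting inversions: G has a nonzero value on this product of the A_i,
  whereas the product over a word that is not reduced vanishes.\<close>

lemma reduced_rho_word: "reduced_word n (rho_word l k) (rho_at l k)"
proof -
  have "list_all2 (\<simeq>) (rho_word l k) (rho_word l (length (rho_word l k)))"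
    by (simp add: list_all2_refl)
  then have "Phi l (A_val (rho_word l k)) \<noteq> 0" using Phi_word[of l "rho_word l k"] eta_neq_0 by simp
  moreover have "Phi l (A_val (rho_word l k)) = 0" if "\<And>x. A_val (rho_word l k) x = 0"
    using that by (simp add: Phi_def)
  ultimately obtain x where "A_val (rho_word l k) x \<noteq> 0" by blast
  then show ?thesis by (rule A_val_nonzero_reduced)
qed

lemma len_rho_at: "len (rho_at l k) = k"
  using reduced_rho_word[of l k] by (simp add: reduced_word_def)

lemma Phi_A_coef: assumes "u \<in> W"
  shows "Phi l (A_coef u) = (if u = rho_at l (len u) then eta l (len u) else 0)"
proof (cases "u = rho_at l (len u)")
  case True
  have "reduced_word n (rho_word l (len u)) u" using reduced_rho_word[of l "len u"] True by simp
  then have "A_coef u = A_val (rho_word l (len u))" by (rule A_coef_reduced)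
  moreover have "list_all2 (\<simeq>) (rho_word l (len u)) (rho_word l (len u))"
    by (simp add: list_all2_refl)
  ultimately show ?thesis using True Phi_word[of l "rho_word l (len u)"] by simp
next
  case False
  obtain "is" where "is": "reduced_word n is u" using reduced_exists[OF assms] by blast
  then have "\<not> list_all2 (\<simeq>) is (rho_word l (length is))"
    using word_ceq[of "is" "rho_word l (length is)"] False by (auto simp: reduced_word_def)
  then show ?thesis using A_coef_reduced[OF "is"] Phi_word[of l "is"] False by simp
qed

section \<open>Expansion of the generating class in Schubert classes\<close>

lemma eta_nth_0: "m < k \<Longrightarrow> fps_nth (eta l k) m = 0"
proof (induction k arbitrary: l m)
  case (Suc k)
  have "fps_nth (geo (l + 1) * eta (l + 1) k) j = 0" if "j < k" for j
    unfolding fps_mult_nth by (rule sum.neutral) (use Suc.IH that in auto)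
  then show ?case using Suc.prems by (cases m) (simp_all add: mult.assoc)
qed simp

text \<open>Expand x in the basis A_u by \<open>loc\<close> and evaluate G on it; by
  \<open>Phi_A_coef\<close> only the elements \<open>rho_at l k\<close> survive.\<close>

lemma G_expand:
  assumes x: "x \<in> W" and N: "len x \<le> N"
  shows "G l x = (\<Sum>k\<le>N. fps_const (loc x (rho_at l k)) * eta l k)"
proof -
  have Phi: "Phi l (A_coef u) = (\<Sum>y\<in>W_upto N. G l y * fps_const (A_coef u y))" if "u \<in> W_upto N"
    for u
    by (rule Phi_superset[OF finite_W_upto]) (use that A_coef_support[of u] in
      \<open>fastforce simp: W_upto_iff\<close>)
  have "(\<Sum>u\<in>W_upto N. fps_const (loc x u) * Phi l (A_coef u)) =
      (\<Sum>u\<in>W_upto N. \<Sum>y\<in>W_upto N. G l y * fps_const (loc x u * A_coef u y))"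
    by (rule sum.cong) (simp_all add: Phi sum_distrib_left fps_const_mult[symmetric] mult_ac del:
      fps_const_mult)
  also have "\<dots> = (\<Sum>y\<in>W_upto N. G l y * fps_const (\<Sum>u\<in>W_upto N. loc x u * A_coef u y))"
  proof (subst sum.swap, rule sum.cong)
    have sc: "fps_const (\<Sum>u\<in>S. h u) = (\<Sum>u\<in>S. fps_const (h u :: mpol fract))"
      for S and h :: "(int \<Rightarrow> int) \<Rightarrow> mpol fract"
      by (induction S rule: infinite_finite_induct) (simp_all add: fps_const_add[symmetric] del:
        fps_const_add)
    show "(\<Sum>u\<in>W_upto N. G l y * fps_const (loc x u * A_coef u y)) =
        G l y * fps_const (\<Sum>u\<in>W_upto N. loc x u * A_coef u y)" for y
      unfolding sc sum_distrib_left ..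
  qed simp
  also have "\<dots> = (\<Sum>y\<in>W_upto N. if y = x then G l y else 0)"
    by (rule sum.cong) (auto simp: loc_A_coef[OF x _ N] W_upto_iff)
  also have "\<dots> = G l x" using x N finite_W_upto by (simp add: sum.delta W_upto_iff)
  finally have "G l x = (\<Sum>u\<in>W_upto N. fps_const (loc x u) * Phi l (A_coef u))" ..
  also have "\<dots> = (\<Sum>u\<in>rho_at l ` {..N}. fps_const (loc x u) * Phi l (A_coef u))"
  proof (rule sum.mono_neutral_right[OF finite_W_upto])
    show "rho_at l ` {..N} \<subseteq> W_upto N" by (auto simp: W_upto_iff len_rho_at)
    show "\<forall>u\<in>W_upto N - rho_at l ` {..N}. fps_const (loc x u) * Phi l (A_coef u) = 0"
      by (auto simp: W_upto_iff Phi_A_coef)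
  qed
  also have "\<dots> = (\<Sum>k\<le>N. fps_const (loc x (rho_at l k)) * Phi l (A_coef (rho_at l k)))"
    by (rule sum.reindex_cong[of "rho_at l"]) (auto intro!: inj_onI dest: arg_cong[of _ _ len] simp:
      len_rho_at)
  also have "\<dots> = (\<Sum>k\<le>N. fps_const (loc x (rho_at l k)) * eta l k)"
    by (simp add: Phi_A_coef len_rho_at)
  finally show ?thesis .
qed

text \<open>As \<open>eta l k\<close> is divisible by t^k, the summation can stop at m, a bound that
  is the same for all x.\<close>

lemma G_nth: assumes x: "x \<in> W"
  shows "fps_nth (G l x) m = (\<Sum>k\<le>m. loc x (rho_at l k) * (fps_nth (eta l k) m))"
proof -
  have "fps_nth (G l x) m = (\<Sum>k\<le>max m (len x). loc x (rho_at l k) * (fps_nth (eta l k) m))"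
    by (subst G_expand[OF x, of "max m (len x)"]) (simp_all add: fps_sum_nth)
  also have "\<dots> = (\<Sum>k\<le>m. loc x (rho_at l k) * (fps_nth (eta l k) m))"
    by (rule sum.mono_neutral_right) (auto simp: eta_nth_0)
  finally show ?thesis .
qed

end

section \<open>Constant terms and strong strips\<close>

context affine_symmetric begin

definition sg_fps :: "int \<Rightarrow> mpol fract fps \<Rightarrow> mpol fract fps" where
  "sg_fps i f = Abs_fps (\<lambda>m. sg i (fps_nth f m))"

lemma sg_fps_nth: "fps_nth (sg_fps i f) m = sg i (fps_nth f m)" by (simp add: sg_fps_def)

lemma sg_sum: "sg i (\<Sum>x\<in>S. h x) = (\<Sum>x\<in>S. sg i (h x))"
  by (induction S rule: infinite_finite_induct) (simp_all add: sg_hom)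

lemma sg_fps_const: "sg_fps i (fps_const q) = fps_const (sg i q)"
  by (rule fps_ext) (simp add: sg_fps_nth sg_hom)

text \<open>Coefficientwise reduction of a series over Sym P to constant terms. It is a relation
  because the coefficients are given in the fraction field, and their membership in Sym P is part of
  the claim.\<close>

definition int_res :: "mpol fract fps \<Rightarrow> int fps \<Rightarrow> bool" where
  "int_res f r \<longleftrightarrow> (\<forall>m. \<exists>p\<in>sym_wt n. fps_nth f m = Fr p 1 \<and> Poly_Mapping.lookup p 0 = fps_nth r m)"

lemma Fr_diff: "Fr p 1 - Fr q 1 = Fr (p - q) 1"
  and Fr_mult: "Fr p 1 * Fr q 1 = Fr (p * q) 1"
  by simp_all

lemma Fr_0: "Fr 0 1 = 0" and Fr_1: "Fr 1 1 = 1"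
  by (simp_all add: Zero_fract_def One_fract_def)

lemma Fr_sum: "(\<Sum>i\<in>I. Fr (p i) 1) = Fr (\<Sum>i\<in>I. p i) 1"
  by (induction I rule: infinite_finite_induct) (simp_all add: Fr_0)

lemma Fr_power: "Fr p 1 ^ k = Fr (p ^ k) 1"
  by (induction k) (simp_all only: power_0 Fr_1 power_Suc Fr_mult)

lemma int_resD: assumes "int_res f r"
  obtains p where "\<And>m. p m \<in> sym_wt n" "\<And>m. fps_nth f m = Fr (p m) 1"
    "\<And>m. Poly_Mapping.lookup (p m) 0 = fps_nth r m"
proof -
  have "\<forall>m. \<exists>p. p \<in> sym_wt n \<and> fps_nth f m = Fr p 1 \<and> Poly_Mapping.lookup p 0 = fps_nth r m"
    using assms unfolding int_res_def by blast
  from choice[OF this] that show thesis by blast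
qed

lemma int_resI:
  assumes "\<And>m. p m \<in> sym_wt n" "\<And>m. fps_nth f m = Fr (p m) 1"
    "\<And>m. Poly_Mapping.lookup (p m) 0 = fps_nth r m"
  shows "int_res f r"
  unfolding int_res_def using assms by blast

lemma int_res_add: assumes "int_res f r" "int_res f' r'" shows "int_res (f + f') (r + r')"
proof -
  obtain p where p: "\<And>m. p m \<in> sym_wt n" "\<And>m. fps_nth f m = Fr (p m) 1"
    "\<And>m. Poly_Mapping.lookup (p m) 0 = fps_nth r m"
    using int_resD[OF assms(1)] by blast
  obtain q where q: "\<And>m. q m \<in> sym_wt n" "\<And>m. fps_nth f' m = Fr (q m) 1"
    "\<And>m. Poly_Mapping.lookup (q m) 0 = fps_nth r' m"
    using int_resD[OF assms(2)] by blast
  show ?thesis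
    by (rule int_resI[of "\<lambda>m. p m + q m"]) (auto simp: p q lookup_add simp del: One_nat_def)
qed

lemma int_res_diff: assumes "int_res f r" "int_res f' r'" shows "int_res (f - f') (r - r')"
proof -
  obtain p where p: "\<And>m. p m \<in> sym_wt n" "\<And>m. fps_nth f m = Fr (p m) 1"
    "\<And>m. Poly_Mapping.lookup (p m) 0 = fps_nth r m"
    using int_resD[OF assms(1)] by blast
  obtain q where q: "\<And>m. q m \<in> sym_wt n" "\<And>m. fps_nth f' m = Fr (q m) 1"
    "\<And>m. Poly_Mapping.lookup (q m) 0 = fps_nth r' m"
    using int_resD[OF assms(2)] by blast
  show ?thesis
    by (rule int_resI[of "\<lambda>m. p m - q m"]) (auto simp: p q lookup_minus)
qed

lemma lookup_0_sum: "Poly_Mapping.lookup (\<Sum>i\<in>I. p i) 0 =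
    (\<Sum>i\<in>I. Poly_Mapping.lookup (p i :: mpol) 0)"
  by (rule lookup_sum)

lemma int_res_mult: assumes "int_res f r" "int_res f' r'" shows "int_res (f * f') (r * r')"
proof -
  obtain p where p: "\<And>m. p m \<in> sym_wt n" "\<And>m. fps_nth f m = Fr (p m) 1"
    "\<And>m. Poly_Mapping.lookup (p m) 0 = fps_nth r m"
    using int_resD[OF assms(1)] by blast
  obtain q where q: "\<And>m. q m \<in> sym_wt n" "\<And>m. fps_nth f' m = Fr (q m) 1"
    "\<And>m. Poly_Mapping.lookup (q m) 0 = fps_nth r' m"
    using int_resD[OF assms(2)] by blast
  show ?thesis
  proof (rule int_resI[of "\<lambda>m. \<Sum>i = 0..m. p i * q (m - i)"])
    show "(\<Sum>i = 0..m. p i * q (m - i)) \<in> sym_wt n" for m using p q by (intro sym_wt_sum sym_wt_mult)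
    show "fps_nth (f * f') m = Fr (\<Sum>i = 0..m. p i * q (m - i)) 1" for m
      unfolding fps_mult_nth p q Fr_mult Fr_sum ..
    show "Poly_Mapping.lookup (\<Sum>i = 0..m. p i * q (m - i)) 0 = fps_nth (r * r') m" for m
      unfolding fps_mult_nth lookup_0_sum lookup_0_mult p q ..
  qed
qed

lemma int_res_0: "int_res 0 0"
  by (rule int_resI[of "\<lambda>m. 0"]) (simp_all add: Fr_0)
lemma int_res_1: "int_res 1 1"
  by (rule int_resI[of "\<lambda>m. if m = 0 then 1 else 0"]) (auto simp: Fr_0 Fr_1)
lemma int_res_X: "int_res fps_X fps_X"
  by (rule int_resI[of "\<lambda>m. if m = 1 then 1 else 0"]) (auto simp: Fr_0 Fr_1)
lemma int_res_bool: "int_res (of_bool b) (of_bool b)"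
  using int_res_0 int_res_1 by (cases b) simp_all
lemma int_res_E_fps: "int_res (E_fps j) 0"
  by (rule int_resI[of "\<lambda>m. if m =
      0 then e_wt n j else 0"]) (auto simp: Fr_0 E_fps_def E_def lookup_0_e_wt)
lemma int_res_sum: "(\<And>i. i \<in> I \<Longrightarrow> int_res (f i) (r i)) \<Longrightarrow> int_res (\<Sum>i\<in>I. f i) (\<Sum>i\<in>I. r i)"
  by (induction I rule: infinite_finite_induct) (simp_all add: int_res_0 int_res_add)
lemma int_res_prod: "(\<And>i. i \<in> I \<Longrightarrow> int_res (f i) (r i)) \<Longrightarrow> int_res (\<Prod>i\<in>I. f i) (\<Prod>i\<in>I. r i)"
  by (induction I rule: infinite_finite_induct) (simp_all add: int_res_1 int_res_mult)

lemma geo_geometric: "geo j = Abs_fps (\<lambda>m. E j ^ m)"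
proof -
  let ?h = "Abs_fps (\<lambda>m. E j ^ m)"
  have "(?h * (1 - fps_X * E_fps j)) = 1"
  proof (rule fps_ext)
    fix m
    have "?h * (1 - fps_X * E_fps j) = ?h - fps_X * (fps_const (E j) * ?h)"
      by (simp add: E_fps_def algebra_simps)
    then show "fps_nth (?h * (1 - fps_X * E_fps j)) m = fps_nth 1 m"
      by (cases m) simp_all
  qed
  then have "geo j = geo j * (?h * (1 - fps_X * E_fps j))" by simp
  also have "\<dots> = ?h * (geo j * (1 - fps_X * E_fps j))" by (simp only: mult_ac)
  finally show ?thesis unfolding geo by simp
qed

lemma int_res_geo: "int_res (geo j) 1"
proof (rule int_resI[of "\<lambda>m. e_wt n j ^ m"])
  show "e_wt n j ^ m \<in> sym_wt n" for m by (intro sym_wt_power sym_wt_e_wt)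
  show "fps_nth (geo j) m = Fr (e_wt n j ^ m) 1" for m
    unfolding geo_geometric by (simp add: E_def Fr_power)
  show "Poly_Mapping.lookup (e_wt n j ^ m) 0 = fps_nth 1 m" for m
    by (induction m) (simp_all add: lookup_0_mult lookup_0_e_wt)
qed

lemma int_res_eta: "int_res (eta l k) (fps_X ^ k)"
proof (induction k arbitrary: l)
  case (Suc k)
  have "int_res (fps_X * geo (l + 1) * eta (l + 1) k) (fps_X * 1 * fps_X ^ k)"
    by (intro int_res_mult int_res_X int_res_geo Suc)
  then show ?case by simp
qed (simp add: int_res_1)

lemma eta_nth_same: "fps_nth (eta l m) m = 1"
proof (induction m arbitrary: l)
  case (Suc k)
  have "fps_nth (geo (l + 1) * eta (l + 1) k) k =
      (\<Sum>i = 0..k. if i = 0 then fps_nth (geo (l + 1)) 0 * fps_nth (eta (l + 1) k) k else 0)"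
    unfolding fps_mult_nth by (rule sum.cong) (auto simp: eta_nth_0)
  also have "\<dots> = fps_nth (geo (l + 1)) 0" using Suc[of "l + 1"] by (simp add: sum.delta)
  also have "\<dots> = 1" by (simp add: geo_geometric)
  finally show ?case by (simp add: mult.assoc)
qed simp

lemma const_term_Fr: assumes "p \<in> sym_wt n" shows "const_term n (Fr p 1) = Poly_Mapping.lookup p 0"
proof -
  have "(THE s. s \<in> sym_wt n \<and> Fr p 1 = Fr s 1) = p"
    by (rule the_equality) (use assms in \<open>auto simp: eq_fract\<close>)
  then show ?thesis by (simp add: const_term_def)
qed

lemma rho_word_map: "rho_word l k = map (\<lambda>j. l + int j) (rev [0..<k])"
proof (induction k arbitrary: l)
  case (Suc k)
  have "[0..<Suc k] = 0 # map Suc [0..<k]" by (metis map_Suc_upt upt_conv_Cons zero_less_Suc)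
  then show ?case using Suc[of "l + 1"] by (simp add: rev_map add.assoc)
qed simp

text \<open>Conjugation by the shift by l carries \<open>s j\<close> to \<open>s (l + j)\<close>,
  hence words to words.\<close>

lemma psi_rho: "psi_zpow (- l) (rho n m) = rho_at l m"
proof -
  have sh: "s (l + j) x = s j (x - l) + l" for j x
  proof -
    have "[x = l + j] (mod int n) \<longleftrightarrow> [x - l = j] (mod int n)"
      "[x = l + j + 1] (mod int n) \<longleftrightarrow> [x - l = j + 1] (mod int n)"
      by (simp_all add: cong_iff_dvd_diff algebra_simps)
    then show ?thesis by (simp add: simple_refl_def aff_refl_def)
  qed
  have "word_elt n (map (\<lambda>j. l + int j) js) x = word_elt n (map int js) (x - l) + l" for js x
    by (induction js arbitrary: x) (simp_all add: sh)
  then show ?thesis unfolding psi_zpow rho_def rho_word_map by (simp add: fun_eq_iff)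
qed

end

context strips begin

interpretation alg: strip_algebra n l fps_X E_fps geo "\<lambda>i. fps_const (alpha_inv i)" sg_fps
proof
  show "x \<simeq> y \<Longrightarrow> E_fps x = E_fps y" for x y by (rule E_fps_ceq)
  show "x \<simeq> y \<Longrightarrow> sg_fps x = sg_fps y" for x y by (simp add: sg_fps_def[abs_def] s_ceq[of x y])
  show "fps_const (alpha_inv i) * (E_fps i - E_fps (i + 1)) = 1" for i
    using E_Suc[of i] by (simp add: E_fps_def alpha_inv_def)
  show "geo j * (1 - fps_X * E_fps j) = 1" for j by (rule geo)
  show "sg_fps i (p + q) = sg_fps i p + sg_fps i q" for i p q
    by (rule fps_ext) (simp add: sg_fps_nth sg_hom)
  show "sg_fps i (p * q) = sg_fps i p * sg_fps i q" for i p q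
    by (rule fps_ext) (simp add: sg_fps_nth fps_mult_nth sg_sum sg_hom)
  show "sg_fps i 1 = 1" for i by (rule fps_ext) (simp add: sg_fps_nth sg_hom)
  show "sg_fps i fps_X = fps_X" for i by (rule fps_ext) (simp add: sg_fps_nth sg_hom)
  show "sg_fps i (E_fps j) = E_fps (s i j)" for i j by (simp add: E_fps_def sg_fps_const sg_hom)
qed

section \<open>The marking operators on the basis of the twisted group algebra\<close>

definition A_coef_fps :: "(int \<Rightarrow> int) \<Rightarrow> (int \<Rightarrow> int) \<Rightarrow> mpol fract fps" where
  "A_coef_fps u x = fps_const (A_coef u x)"

lemma equivariant_A_coef_fps: "alg.equivariant a A_coef_fps"
  unfolding alg.equivariant_def
proof (intro ballI)
  fix u x assume u: "u \<in> W"
  have "alg.A a (A_coef_fps u) x = fps_const (Aop a (A_coef u) x)"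
    by (simp add: alg.A_def A_coef_fps_def Aop_def Sop_def sg_fps_const)
  also have "\<dots> = L a (\<lambda>v. A_coef_fps v x) u"
    using A_coef_asc[OF u, of a] A_coef_desc[OF u, of a]
      by (cases "asc a u") (simp_all add: L_def A_coef_fps_def)
  finally show "alg.A a (A_coef_fps u) x = L a (\<lambda>v. A_coef_fps v x) u" .
qed

abbreviation point_mass :: "(int \<Rightarrow> int) \<Rightarrow> (int \<Rightarrow> int) \<Rightarrow> 'b \<Rightarrow> 'r::comm_ring_1" where
  "point_mass v u x \<equiv> of_bool (u = v)"

text \<open>The operators are linear and act on the first argument of f, so their matrix entries are
  the values on point masses. The argument \<open>id\<close> is arbitrary, as point masses are
  constant in it.\<close>

lemma K_prod_expand:
  assumes V: "finite V" "\<And>w a. w \<in> V \<Longrightarrow> Ncov a w \<subseteq> V"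
  shows "w \<in> V \<Longrightarrow> alg.K_prod lo k f w x = (\<Sum>v\<in>V. alg.K_prod lo k (point_mass v) w id * f v x)"
proof (induction k arbitrary: w)
  case 0
  have "(\<Sum>v\<in>V. of_bool (w = v) * f v x) = (\<Sum>v\<in>V. if w = v then f v x else 0)"
    by (rule sum.cong) auto
  then show ?case using 0 V(1) by (simp add: sum.delta')
next
  case (Suc k)
  let ?a = "lo + int k"
  have "N ?a (\<lambda>u. alg.K_prod lo k f u x) w =
      N ?a (\<lambda>u. \<Sum>v\<in>V. alg.K_prod lo k (point_mass v) u id * f v x) w"
    by (rule alg.N_cong) (use Suc V(2) in blast)
  also have "\<dots> = (\<Sum>v\<in>V. N ?a (\<lambda>u. alg.K_prod lo k (point_mass v) u id) w * f v x)"
    unfolding N_def by (subst sum.swap) (simp add: sum_distrib_right)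
  finally have Ne: "N ?a (\<lambda>u. alg.K_prod lo k f u x) w =
      (\<Sum>v\<in>V. N ?a (\<lambda>u. alg.K_prod lo k (point_mass v) u id) w * f v x)" .
  show ?case unfolding alg.K_prod.simps(2) alg.K_def Ne Suc.IH[OF Suc.prems]
    by (simp add: sum_distrib_left sum.distrib[symmetric] algebra_simps)
qed

text \<open>K after reduction to constant terms: the weight e_a becomes 0 and the geometric factor
  becomes 1.\<close>

definition K_int :: "int \<Rightarrow> ((int \<Rightarrow> int) \<Rightarrow> int fps) \<Rightarrow> (int \<Rightarrow> int) \<Rightarrow> int fps" where
  "K_int a f u = f u + fps_X * (\<Sum>v\<in>Ncov a u. f v)"

fun K_prod_int :: "int \<Rightarrow> nat \<Rightarrow> ((int \<Rightarrow> int) \<Rightarrow> int fps) \<Rightarrow> (int \<Rightarrow> int) \<Rightarrow> int fps" where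
  "K_prod_int lo 0 f = f" | "K_prod_int lo (Suc k) f = K_int (lo + int k) (K_prod_int lo k f)"

lemma int_res_K_prod:
  assumes "\<And>u. int_res (f u x) (f' u)"
  shows "int_res (alg.K_prod lo k f u x) (K_prod_int lo k f' u)"
proof (induction k arbitrary: u)
  case (Suc k)
  let ?a = "lo + int k"
  have "int_res (alg.K ?a (alg.K_prod lo k f) u x)
     ((1 + fps_X * 1 * 0 * of_bool (pos u ?a \<le> l)) * K_prod_int lo k f' u + fps_X * 1 * (\<Sum>v\<in>Ncov ?a
       u. K_prod_int lo k f' v))"
    unfolding alg.K_def N_def theta_def
    by (intro int_res_add int_res_mult int_res_1 int_res_X int_res_geo int_res_E_fps int_res_bool
      int_res_sum Suc)
  then show ?case by (simp add: K_int_def)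
qed (simp add: assms)

text \<open>For x in the box, values below lo stand at most at l and values from lo + k on stand
  beyond l. Only the window is undecided, and there the geometric factors of values up to l cancel
  against the product in front.\<close>

lemma G_window_G:
  assumes x: "x \<in> box lo (lo + int k)" and lo: "lo \<le> l + 1"
  shows "G l x = (\<Prod>b\<in>{lo..l}. 1 - fps_X * E_fps b) * alg.G_window lo k x"
proof -
  have xW: "x \<in> W" using x by (simp add: box_def)
  let ?X = "x ` {..l}"
  have X: "b \<in> ?X \<longleftrightarrow> pos x b \<le> l" for b
    using W_pos[OF xW] by (metis atMost_iff imageE image_eqI)
  define S where "S = {b \<in> {lo..<lo + int k}. pos x b \<le> l}"
  have lt: "pos x b \<le> l" if "b < lo" for b using box_pos(1)[OF x that] .
  have gt: "b < lo + int k" if "pos x b \<le> l" for b using box_pos(2)[OF x, of b] that by linarith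
  have 1: "?X - {..l} = S - {..l}"
  proof (rule set_eqI)
    fix b show "b \<in> ?X - {..l} \<longleftrightarrow> b \<in> S - {..l}" using gt[of b] lo by (auto simp: S_def X)
  qed
  have 2: "{..l} - ?X = {lo..l} - S"
  proof (rule set_eqI)
    fix b
    have "lo \<le> b" if "\<not> pos x b \<le> l" using lt[of b] that by linarith
    then show "b \<in> {..l} - ?X \<longleftrightarrow> b \<in> {lo..l} - S" using gt[of b] by (auto simp: S_def X)
  qed
  have 3: "S = (S - {..l}) \<union> ({lo..l} \<inter> S)" by (auto simp: S_def)
  have fS: "finite S" unfolding S_def by (rule finite_Collect_conjI) simp
  have "(\<Prod>b\<in>S. geo b) = (\<Prod>b\<in>S - {..l}. geo b) * (\<Prod>b\<in>{lo..l} \<inter> S. geo b)"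
    by (subst 3, rule prod.union_disjoint) (use fS in auto)
  moreover have "(\<Prod>b\<in>{lo..l}. 1 - fps_X * E_fps b) =
      (\<Prod>b\<in>{lo..l} \<inter> S. 1 - fps_X * E_fps b) * (\<Prod>b\<in>{lo..l} - S. 1 - fps_X * E_fps b)"
    by (rule prod.Int_Diff) simp
  moreover have "(\<Prod>b\<in>{lo..l} \<inter> S. geo b) * (\<Prod>b\<in>{lo..l} \<inter> S. 1 - fps_X * E_fps b) = 1"
    unfolding prod.distrib[symmetric] by (simp add: geo)
  ultimately have "(\<Prod>b\<in>{lo..l}. 1 - fps_X * E_fps b) * (\<Prod>b\<in>S. geo b) =
      (\<Prod>b\<in>S - {..l}. geo b) * (\<Prod>b\<in>{lo..l} - S. 1 - fps_X * E_fps b)"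
    by (simp only: mult_ac) (simp only: mult.assoc[symmetric] mult_1_left)
  then show ?thesis unfolding G_def G_set_def 1 2 alg.G_window_def S_def[symmetric] by simp
qed

definition paths :: "int \<Rightarrow> nat \<Rightarrow> (int \<Rightarrow> int) \<Rightarrow> nat \<Rightarrow> (int \<Rightarrow> int) \<Rightarrow> (int \<times> (int \<Rightarrow> int)) list set"
  where
  "paths lo k u m v = {ps. marked_path n l u ps \<and> length ps = m \<and> sorted_wrt (>) (map fst ps) \<and>
     fst ` set ps \<subseteq> {lo..<lo + int k} \<and> outside (u, ps) = v}"

section \<open>Counting strips by the reduced operators\<close>

lemma outside_Cons: "outside (u, (a, v) # ps) = outside (v, ps)"
  by (simp add: outside_def)

lemma paths_0: "paths lo k u 0 v = (if u \<in> W \<and> u = v then {[]} else {})"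
  by (auto simp: paths_def outside_def)

text \<open>Markings decrease along a strip, so the largest admissible one is either absent or marks
  the first cover.\<close>

lemma paths_Suc:
  "paths lo (Suc k) u (Suc m) v = paths lo k u (Suc m) v \<union>
     (\<Union>v1\<in>Ncov (lo + int k) u. (\<lambda>ps. (lo + int k, v1) # ps) ` paths lo k v1 m v)" (is "?A = ?B \<union>
       ?C")
proof (intro equalityI subsetI)
  fix qs assume q: "qs \<in> ?A"
  then obtain a v1 ps where qs: "qs = (a, v1) # ps" by (cases qs) (auto simp: paths_def)
  have h: "marked_cover n l u a v1" "marked_path n l v1 ps" "length ps = m" "\<forall>b\<in>fst ` set ps. b < a"
    "sorted_wrt (>) (map fst ps)" "lo \<le> a" "a < lo + int (Suc k)" "\<forall>b\<in>fst ` set ps. lo \<le> b"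
      "outside (v1, ps) = v"
    using q unfolding qs by (auto simp: paths_def outside_Cons)
  show "qs \<in> ?B \<union> ?C"
  proof (cases "a = lo + int k")
    case True
    have "fst ` set ps \<subseteq> {lo..<lo + int k}"
    proof
      fix b assume "b \<in> fst ` set ps"
      then show "b \<in> {lo..<lo + int k}" using bspec[OF h(4)] bspec[OF h(8)] True by simp
    qed
    then have "ps \<in> paths lo k v1 m v" using h(2,3,5,9) by (simp add: paths_def)
    moreover have "v1 \<in> Ncov (lo + int k) u" using h(1) True by (simp add: Ncov_def)
    ultimately show ?thesis unfolding qs True by blast
  next
    case False
    then have "a < lo + int k" using h(7) by simp
    then have "qs \<in> ?B" using h q unfolding qs by (force simp: paths_def)
    then show ?thesis ..
  qed
next
  fix qs assume "qs \<in> ?B \<union> ?C"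
  then show "qs \<in> ?A"
  proof
    assume "qs \<in> ?B" then show ?thesis by (auto simp: paths_def)
  next
    assume "qs \<in> ?C"
    then obtain v1 ps where "v1 \<in> Ncov (lo + int k) u" "ps \<in> paths lo k v1 m v"
      "qs = (lo + int k, v1) # ps" by blast
    then show ?thesis by (force simp: paths_def Ncov_def outside_Cons)
  qed
qed

text \<open>The operator of the largest marking is outermost, which matches
  \<open>paths_Suc\<close>; each cover contributes one factor t.\<close>

lemma card_paths:
  assumes "u \<in> W"
  shows "finite (paths lo k u m v) \<and>
      fps_nth (K_prod_int lo k (\<lambda>u. of_bool (u = v)) u) m = int (card (paths lo k u m v))"
  using assms
proof (induction k arbitrary: u m)
  case 0
  show ?case
  proof (cases m)
    case 0
    then show ?thesis using \<open>u \<in> W\<close> by (simp add: paths_0)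
  next
    case (Suc m')
    have "paths lo 0 u m v = {}" using Suc by (auto simp: paths_def)
    then show ?thesis using Suc by (cases "u = v") simp_all
  qed
next
  case (Suc k)
  let ?P = "K_prod_int lo k (\<lambda>u. of_bool (u = v))" and ?a = "lo + int k"
  show ?case
  proof (cases m)
    case 0
    then show ?thesis using Suc.IH[OF Suc.prems, of 0] by (simp add: K_int_def paths_0)
  next
    case (Suc m')
    let ?C = "\<lambda>v1. (\<lambda>ps. (?a, v1) # ps) ` paths lo k v1 m' v"
    have IH: "finite (paths lo k v1 m' v) \<and> fps_nth (?P v1) m' = int (card (paths lo k v1 m' v))"
      if "v1 \<in> Ncov ?a u" for v1
      using Suc.IH that Ncov_W(1) by blast
    have fin: "finite (?C v1)" if "v1 \<in> Ncov ?a u" for v1 using IH[OF that] by simp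
    have cC: "card (?C v1) = card (paths lo k v1 m' v)"
      for v1 by (rule card_image) (simp add: inj_on_def)
    have disj: "paths lo k u m v \<inter> (\<Union>v1\<in>Ncov ?a u. ?C v1) = {}"
    proof -
      have "qs \<notin> paths lo k u m v" if "qs \<in> ?C v1" for qs v1 using that by (auto simp: paths_def)
      then show ?thesis by blast
    qed
    have cU: "card (\<Union>v1\<in>Ncov ?a u. ?C v1) = (\<Sum>v1\<in>Ncov ?a u. card (?C v1))"
      by (rule card_UN_disjoint[OF finite_Ncov]) (use fin in auto)
    have fU: "finite (\<Union>v1\<in>Ncov ?a u. ?C v1)" using finite_Ncov fin by blast
    have f1: "finite (paths lo k u m v)" and n1: "fps_nth (?P u) m = int (card (paths lo k u m v))"
      using Suc.IH[OF Suc.prems, of m] by auto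
    have "card (paths lo (Suc k) u m v) =
        card (paths lo k u m v) + (\<Sum>v1\<in>Ncov ?a u. card (paths lo k v1 m' v))"
      unfolding \<open>m = Suc m'\<close> paths_Suc using card_Un_disjoint[OF f1 fU disj]
        unfolding cU cC \<open>m = Suc m'\<close> .
    moreover have "fps_nth (K_prod_int lo (Suc k) (\<lambda>u. of_bool (u = v)) u) m =
        fps_nth (?P u) m + (\<Sum>v1\<in>Ncov ?a u. fps_nth (?P v1) m')"
      by (simp add: K_int_def Suc fps_sum_nth)
    moreover have "finite (paths lo (Suc k) u m v)"
      using f1 fU unfolding \<open>m = Suc m'\<close> paths_Suc by simp
    ultimately show ?thesis using n1 IH by simp
  qed
qed

lemma marked_path_box:
  "marked_path n l u ps \<Longrightarrow> u \<in> box lo hi \<Longrightarrow> fst ` set ps \<subseteq> {lo..<hi}"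
proof (induction ps arbitrary: u)
  case (Cons q ps)
  obtain a v where q: "q = (a, v)" by (cases q)
  have v: "v \<in> Ncov a u" using Cons.prems(1) by (simp add: q Ncov_def)
  have "marked_path n l v ps" using Cons.prems(1) by (simp add: q)
  then show ?case using Cons.IH box_Ncov[OF Cons.prems(2) v] by (auto simp: q)
qed simp

lemma marked_path_W: "marked_path n l u ps \<Longrightarrow> u \<in> W"
  by (cases ps) (auto simp: marked_cover_def)

text \<open>The product of G with the coefficients of A_u is expanded once by marking operators and
  once by Schubert classes. Pairing with \<open>loc x v\<close>, comparing coefficients of t^m and
  reducing to constant terms yields the count.\<close>

theorem kk_const_strips:
  assumes u: "u \<in> W" and v: "v \<in> W"
  shows "kk_const n (rho_at l m) v u =
      int (card {ps. strong_strip n l m (u, ps) \<and> outside (u, ps) = v})"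
    and "finite {ps. strong_strip n l m (u, ps) \<and> outside (u, ps) = v}"
proof -
  \<comment> \<open>\<open>W_upto M\<close> contains u and v and is closed under covers, so one
    finite index set and one box serve all sums. The identity is added to place l relative to the
    box.\<close>
  define M where "M = max (len u) (len v)"
  have "finite (insert id (W_upto M))" "insert id (W_upto M) \<subseteq> W"
    using finite_W_upto by (auto simp: W_upto_iff)
  then obtain lo hi where box: "insert id (W_upto M) \<subseteq> box lo hi" using box_exists by blast
  then have idb: "id \<in> box lo hi" by simp
  then have lo: "lo \<le> l + 1" and "l < hi" by (auto simp: box_def)
  define k where "k = nat (hi - lo)"
  have hi: "lo + int k = hi" using lo \<open>l < hi\<close> by (simp add: k_def)
  have uM: "u \<in> W_upto M" and vM: "v \<in> W_upto M" using u v by (auto simp: W_upto_iff M_def)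
  have cl: "Ncov a w \<subseteq> W_upto M" if "w \<in> W_upto M" for w a
    using that Ncov_W(1,3)[of _ a w] by (fastforce simp: W_upto_iff)
  let ?D = "\<lambda>v. alg.K_prod lo k (point_mass v) u id"
  \<comment> \<open>The factor between G and \<open>G_window\<close>; its reduction to constant
    terms is 1.\<close>
  let ?C = "\<Prod>b\<in>{lo..l}. 1 - fps_X * E_fps b"
  have sup: "insert u {x. A_coef_fps u x \<noteq> 0} \<subseteq> box lo (lo + int k)"
  proof -
    have "{x. A_coef_fps u x \<noteq> 0} \<subseteq> W_upto M"
      using A_coef_support[OF u] uM by (fastforce simp: A_coef_fps_def W_upto_iff)
    then show ?thesis using uM box hi by auto
  qed
  have exp: "\<forall>x\<in>W. alg.G_window lo k x * A_coef_fps u x = alg.K_prod lo k A_coef_fps u x"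
  proof (rule alg.strip_expansion[OF equivariant_A_coef_fps _ _ _ u sup])
    show "A_coef_fps id x = (if x = id then 1 else 0)" for x by (simp add: A_coef_fps_def A_coef_id)
    show "finite {x. A_coef_fps w x \<noteq> 0}" if "w \<in> W" for w
      by (rule finite_subset[OF _ finite_W_upto[of "len w"]]) (use A_coef_support[OF that] in
        \<open>auto simp: A_coef_fps_def W_upto_iff\<close>)
    show "x \<in> W" if "w \<in> W" "A_coef_fps w x \<noteq> 0"
      for w x using A_coef_support(1)[OF that(1)] that(2) by (auto simp: A_coef_fps_def)
  qed
  have main: "G l x * fps_const (A_coef u x) = ?C * (\<Sum>w\<in>W_upto M. ?D w * fps_const (A_coef w x))"
    if x: "x \<in> W" for x
  proof -
    have e: "alg.G_window lo k x * fps_const (A_coef u x) =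
        (\<Sum>w\<in>W_upto M. ?D w * fps_const (A_coef w x))"
      using bspec[OF exp x] K_prod_expand[OF finite_W_upto cl uM, of lo k A_coef_fps x]
        unfolding A_coef_fps_def by (rule trans)
    show ?thesis
    proof (cases "A_coef u x = 0")
      case True then show ?thesis unfolding e[symmetric] by simp
    next
      case False
      then have "x \<in> box lo (lo + int k)" using sup by (auto simp: A_coef_fps_def)
      then show ?thesis unfolding e[symmetric] by (simp add: G_window_G[OF _ lo] mult.assoc)
    qed
  qed
  have sc: "fps_const (\<Sum>x\<in>S. h x) = (\<Sum>x\<in>S. fps_const (h x :: mpol fract))"
    for S and h :: "(int \<Rightarrow> int) \<Rightarrow> mpol fract"
    by (induction S rule: infinite_finite_induct) (simp_all add: fps_const_add[symmetric] del:
      fps_const_add)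
  have "(\<Sum>x\<in>W_upto M. G l x * fps_const (A_coef u x * loc x v)) =
      (\<Sum>x\<in>W_upto M. \<Sum>w\<in>W_upto M. ?C * (?D w * fps_const (A_coef w x * loc x v)))"
  proof (rule sum.cong[OF refl])
    fix x assume "x \<in> W_upto M"
    then have x: "x \<in> W" by (simp add: W_upto_iff)
    have "G l x * fps_const (A_coef u x * loc x v) =
        (G l x * fps_const (A_coef u x)) * fps_const (loc x v)"
      by (simp only: fps_const_mult[symmetric] mult.assoc)
    also have "\<dots> = (\<Sum>w\<in>W_upto M. ?C * (?D w * fps_const (A_coef w x * loc x v)))"
      unfolding main[OF x] sum_distrib_left sum_distrib_right fps_const_mult[symmetric]
        by (simp only: mult.assoc)
    finally show "G l x * fps_const (A_coef u x * loc x v) =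
        (\<Sum>w\<in>W_upto M. ?C * (?D w * fps_const (A_coef w x * loc x v)))" .
  qed
  also have "\<dots> = (\<Sum>w\<in>W_upto M. ?C * (?D w * fps_const (\<Sum>x\<in>W_upto M. A_coef w x * loc x v)))"
    unfolding sc sum_distrib_left by (rule sum.swap)
  also have "\<dots> = (\<Sum>w\<in>W_upto M. if w = v then ?C * ?D w else 0)"
    by (rule sum.cong) (auto simp: A_coef_loc v W_upto_iff)
  also have "\<dots> = ?C * ?D v" using vM finite_W_upto by (simp add: sum.delta)
  finally have CD: "(\<Sum>x\<in>W_upto M. G l x * fps_const (A_coef u x * loc x v)) = ?C * ?D v" .
  \<comment> \<open>Inserting the expansion of G into the paired identity turns the localizations
    into structure constants.\<close>
  have rec: "(\<Sum>j\<le>m. fps_nth (eta l j) m * kk_frac u (rho_at l j) v) = fps_nth (?C * ?D v) m" for m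
  proof -
    have "fps_nth (?C * ?D v) m = (\<Sum>x\<in>W_upto M. fps_nth (G l x) m * (A_coef u x * loc x v))"
      unfolding CD[symmetric] by (simp add: fps_sum_nth)
    also have "\<dots> =
        (\<Sum>x\<in>W_upto M. \<Sum>j\<le>m. fps_nth (eta l j) m * (A_coef u x * (loc x (rho_at l j) * loc x v)))"
    proof (rule sum.cong[OF refl])
      fix x assume "x \<in> W_upto M"
      then have "x \<in> W" by (simp add: W_upto_iff)
      then show "fps_nth (G l x) m * (A_coef u x * loc x v) =
          (\<Sum>j\<le>m. fps_nth (eta l j) m * (A_coef u x * (loc x (rho_at l j) * loc x v)))"
        unfolding G_nth[OF \<open>x \<in> W\<close>] sum_distrib_right by (simp only: mult_ac)
    qed
    also have "\<dots> =
        (\<Sum>j\<le>m. \<Sum>x\<in>W_upto M. fps_nth (eta l j) m * (A_coef u x * (loc x (rho_at l j) * loc x v)))"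
      by (rule sum.swap)
    also have "\<dots> = (\<Sum>j\<le>m. fps_nth (eta l j) m * kk_frac u (rho_at l j) v)"
    proof -
      have "len u \<le> M" by (simp add: M_def)
      then show ?thesis by (simp only: kk_frac_eq[OF u] sum_distrib_left)
    qed
    finally show ?thesis ..
  qed
  let ?r = "K_prod_int lo k (\<lambda>u. of_bool (u = v)) u"
  have "int_res (?C * ?D v) ((\<Prod>b\<in>{lo..l}. 1 - fps_X * 0) * ?r)"
    by (intro int_res_mult int_res_prod int_res_diff int_res_1 int_res_X int_res_E_fps
      int_res_K_prod int_res_bool)
  then have CDr: "int_res (?C * ?D v) ?r" by simp
  obtain Q where Q: "\<And>m. Q m \<in> sym_wt n" "\<And>m. fps_nth (?C * ?D v) m = Fr (Q m) 1"
      "\<And>m. Poly_Mapping.lookup (Q m) 0 = fps_nth ?r m"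
    using int_resD[OF CDr] by blast
  have "\<exists>H. \<forall>j m. H j m \<in> sym_wt n \<and> fps_nth (eta l j) m = Fr (H j m) 1 \<and>
      Poly_Mapping.lookup (H j m) 0 = fps_nth (fps_X ^ j) m"
    by (intro choice allI) (rule int_resD[OF int_res_eta[of l]], blast)
  then obtain H where H: "\<And>j m. H j m \<in> sym_wt n" "\<And>j m. fps_nth (eta l j) m = Fr (H j m) 1"
      "\<And>j m. Poly_Mapping.lookup (H j m) 0 = fps_nth (fps_X ^ j) m" by blast
  txt \<open>The series \<^term>\<open>eta l j\<close> begins with \<open>t\<^sup>j\<close>, so that \<open>rec\<close> can be solved for the structure
    constants one after the other.\<close>
  have kk_frac_int: "\<exists>p\<in>sym_wt n. kk_frac u (rho_at l m) v = Fr p 1 \<and>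
      Poly_Mapping.lookup p 0 = fps_nth ?r m" for m
  proof (induction m rule: less_induct)
    case (less m)
    then have "\<forall>j\<in>{..<m}. \<exists>p. p \<in> sym_wt n \<and> kk_frac u (rho_at l j) v = Fr p 1" by blast
    from bchoice[OF this] obtain P where P: "\<And>j. j < m \<Longrightarrow> P j \<in> sym_wt n"
      "\<And>j. j < m \<Longrightarrow> kk_frac u (rho_at l j) v = Fr (P j) 1" by auto
    have "Fr (Q m) 1 = (\<Sum>j<Suc m. fps_nth (eta l j) m * kk_frac u (rho_at l j) v)"
      unfolding lessThan_Suc_atMost rec Q ..
    also have "\<dots> = (\<Sum>j<m. fps_nth (eta l j) m * kk_frac u (rho_at l j) v) +
        kk_frac u (rho_at l m) v"
      unfolding sum.lessThan_Suc eta_nth_same mult_1_left ..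
    also have "(\<Sum>j<m. fps_nth (eta l j) m * kk_frac u (rho_at l j) v) = Fr (\<Sum>j<m. H j m * P j) 1"
      unfolding Fr_sum[symmetric] by (rule sum.cong) (simp_all only: lessThan_iff H P(2) Fr_mult)
    finally have "Fr (Q m) 1 - Fr (\<Sum>j<m. H j m * P j) 1 = kk_frac u (rho_at l m) v"
      by (simp only: add_diff_cancel_left')
    then have "kk_frac u (rho_at l m) v = Fr (Q m - (\<Sum>j<m. H j m * P j)) 1" unfolding Fr_diff ..
    moreover have "Q m - (\<Sum>j<m. H j m * P j) \<in> sym_wt n"
      by (intro sym_wt_diff sym_wt_sum sym_wt_mult) (simp_all only: lessThan_iff Q H P)
    moreover have "Poly_Mapping.lookup (Q m - (\<Sum>j<m. H j m * P j)) 0 = fps_nth ?r m"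
    proof -
      have "(\<Sum>j<m. fps_nth (fps_X ^ j :: int fps) m * Poly_Mapping.lookup (P j) 0) = 0"
        by (rule sum.neutral) (simp add: fps_X_power_nth)
      then show ?thesis unfolding lookup_minus lookup_0_sum lookup_0_mult H Q by simp
    qed
    ultimately show ?case by blast
  qed
  obtain p where p: "p \<in> sym_wt n" "kk_frac u (rho_at l m) v = Fr p 1"
    "Poly_Mapping.lookup p 0 = fps_nth ?r m"
    using kk_frac_int by blast
  have ub: "u \<in> box lo (lo + int k)" using sup by simp
  \<comment> \<open>All markings of a path that starts in the box lie in the window, so the
    restriction in \<open>paths\<close> holds automatically.\<close>
  have S: "{ps. strong_strip n l m (u, ps) \<and> outside (u, ps) = v} = paths lo k u m v"
    using marked_path_box[OF _ ub] unfolding strong_strip_def paths_def fst_conv snd_conv by blast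
  have "kk_const n (rho_at l m) v u = Poly_Mapping.lookup p 0"
    unfolding kk_const_def lookup_kk_coeffs[OF u word_W v] p(2) by (rule const_term_Fr[OF p(1)])
  then show "kk_const n (rho_at l m) v u =
      int (card {ps. strong_strip n l m (u, ps) \<and> outside (u, ps) = v})"
    unfolding S p(3) using card_paths[OF u, of lo k m v] by simp
  show "finite {ps. strong_strip n l m (u, ps) \<and> outside (u, ps) = v}"
    unfolding S using card_paths[OF u] by simp
qed

end

theorem theorem6p5:
  fixes n m :: nat and l :: int and w :: "int \<Rightarrow> int"
  assumes "n \<ge> 2" and "m \<ge> 1" and "w \<in> aff_sym n"
  shows "cup n (schubert (psi_zpow (- l) (rho n m))) (schubert w) =
         (\<Sum>S | strong_strip n l m S \<and> outside S = w. schubert (inside S))"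
proof -
  interpret strips n l by unfold_locales (rule assms(1))
  define K where "K u = kk_const n (rho_at l m) w u" for u
  define P where "P u = {ps. strong_strip n l m (u, ps) \<and> outside (u, ps) = w}" for u
  define U where "U = {u. u \<in> W \<and> K u \<noteq> 0}"
  have K: "K u = int (card (P u))" and fin: "finite (P u)" if "u \<in> W" for u
    using kk_const_strips[OF that assms(3), of m] by (simp_all only: K_def P_def)
  have U: "u \<in> U \<longleftrightarrow> u \<in> W \<and> P u \<noteq> {}" for u
    using K[of u] fin[of u] unfolding U_def
      by (metis (mono_tags) card_0_eq mem_Collect_eq of_nat_eq_0_iff)
  have "u \<in> W" if "ps \<in> P u" for u ps
    using that marked_path_W[of u ps] by (simp add: P_def strong_strip_def)
  then have "S \<in> {S. strong_strip n l m S \<and> outside S = w} \<longleftrightarrow> S \<in> Sigma U P" for S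
    by (cases S) (auto simp: U P_def)
  then have strips: "{S. strong_strip n l m S \<and> outside S = w} = Sigma U P" by (intro set_eqI)
  have "cup n (schubert (psi_zpow (- l) (rho n m))) (schubert w) =
      (\<Sum>u\<in>U. frag_cmul (K u) (schubert u))"
    unfolding U_def K_def by (simp add: cup_def psi_rho schubert_prod_def)
  also have "\<dots> = (\<Sum>S\<in>Sigma U P. schubert (inside S))"
  proof (cases "finite U")
    case True
    have c: "(\<Sum>ps\<in>A. schubert u) = frag_cmul (int (card A)) (schubert u)" if "finite A"
      for u and A :: "(int \<times> (int \<Rightarrow> int)) list set"
      using that by (induction A rule: finite_induct) (simp_all add: frag_cmul_distrib add.commute)
    have "(\<Sum>S\<in>Sigma U P. schubert (inside S)) = (\<Sum>u\<in>U. \<Sum>ps\<in>P u. schubert (inside (u, ps)))"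
      using True fin by (subst sum.Sigma) (auto simp: U)
    also have "\<dots> = (\<Sum>u\<in>U. frag_cmul (K u) (schubert u))"
      by (rule sum.cong) (simp_all add: inside_def U K fin c)
    finally show ?thesis ..
  next
    \<comment> \<open>If U were infinite, the set of strips would be too, and both sums would take
      the default value 0.\<close>
    case False
    have "fst ` Sigma U P = U" by (auto simp: U fst_image_Sigma)
    with False have "infinite (Sigma U P)" by (metis finite_imageI)
    then show ?thesis using False by simp
  qed
  finally show ?thesis unfolding strips .
qed

end
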